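(* Let $T$ be a densely defined self-adjoint operator on a complex Hilbert space $\mathcal{H}$. Then there is a linear map $\delta_T$ on $\mathcal{B}_p(\mathbb{R})$, whose values are (possibly unbounded) linear operators in $\mathcal{H}$ and whose action on $f\in\mathcal{B}_p(\mathbb{R})$ is denoted by $$\langle \delta_T,f\rangle=\int_{-\infty}^{+\infty} f(\lambda)\,\delta(\lambda I-T)\,d\lambda ,$$ such that $\langle\delta_T,f\rangle=f(T)$ for every $f\in\mathcal{B}_p(\mathbb{R})$. Moreover: 1. If $\{f_n\}_{n=1}^\infty\subseteq\mathcal{B}_p(\mathbb{R})$ is uniformly bounded and $f_n(t)\to f(t)$ for all $t\in\mathbb{R}$, with $f\in\mathcal{B}_p(\mathbb{R})$, then $\langle\delta_T,f_n\rangle x\to\langle\delta_T,f\rangle x$ for all $x\in\mathcal{H}$. 2. If $T$ is bounded, then $\delta_T$ is an $\mathcal{L}(\mathcal{H})$-valued distribution, i.e. $f\mapsto\langle\delta_T,f\rangle$ is a continuous linear map from $\mathcal{D}(\mathbb{R})$ into $\mathcal{L}(\mathcal{H})$; so $\langle\delta_T,f\rangle$ is a bounded operator on $\mathcal{H}$ for $f\in\mathcal{D}(\mathbb{R})$. 3. $\delta(\lambda I-T)=\mathbf{0}$ if $\lambda\notin\sigma(T)$. 4. $\langle y,\delta(\lambda I-T)x\rangle=\langle\delta(\lambda I-T)y,x\rangle$ for all $x,y\in D(T)$, in the distributional sense.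
   Context: The scalar product $\langle\cdot,\cdot\rangle$ of $\mathcal{H}$ is anti-linear in the first variable. $\sigma(T)$ is the spectrum of $T$, $\sigma_p(T)$ its point spectrum (set of eigenvalues), and $D(T)$ its domain. $\mathcal{B}_p(\mathbb{R})$ is the complex linear space of all Borel-measurable functions $f:\mathbb{R}\to\mathbb{C}$ that are continuous at each point of $\sigma_p(T)$. $\{E_\lambda:\lambda\in\mathbb{R}\}$ is the (right-continuous) spectral family of $T$, and $f(T)=\int_{-\infty}^{+\infty}f(\lambda)\,dE_\lambda$ is given by the Borel functional calculus, with dense domain $$D(f(T))=\Big\{x\in\mathcal{H}:\int_{-\infty}^{+\infty}|f(\lambda)|^2\,d\|E_\lambda x\|^2<\infty\Big\}.$$ Thus $\langle\delta_T,f\rangle$ is an operator with domain $D(f(T))$, and linearity of $\delta_T$ means $\langle\delta_T,af+bg\rangle x=a\langle\delta_T,f\rangle x+b\langle\delta_T,g\rangle x$ for $a,b\in\mathbb{C}$ and $x\in D(f(T))\cap D(g(T))$. The symbol $\int f(\lambda)\,\delta(\lambda I-T)\,d\lambda$ is notation for the action of $\delta_T$ on $f$, not a true integral; weakly, $\int f(\lambda)\langle y,\delta(\lambda I-T)x\rangle\,d\lambda=\langle y,f(T)x\rangle$ for $x\in D(f(T))$, $y\in\mathcal{H}$. $\mathcal{D}(\mathbb{R})$ is the space of infinitely differentiable compactly supported functions $\mathbb{R}\to\mathbb{C}$ with its usual inductive limit topology. $\mathcal{L}(\mathcal{H})$ is the space of bounded linear operators on $\mathcal{H}$ with the strong operator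 topology. "$\delta(\lambda I-T)=\mathbf{0}$ if $\lambda\notin\sigma(T)$" means that $\langle\delta_T,f\rangle=\mathbf{0}$ for every $f\in\mathcal{B}_p(\mathbb{R})$ vanishing on $\sigma(T)$. The identity in item 4 "in the distributional sense" means that for every $f\in\mathcal{B}_p(\mathbb{R})$ and $x,y\in D(T)\cap D(f(T))$ one has $\langle y,\langle\delta_T,f\rangle x\rangle=\langle\langle\delta_T,\overline{f}\rangle y,x\rangle$. *)

theory Defs
  imports "HOL-Analysis.Analysis"
begin

section \<open>Complex Hilbert spaces\<close>

text \<open>
  The norm, the metric and the topology are those of \<^class>\<open>real_inner\<close>; they agree with the ones
  induced by the complex scalar product because \<open>inner x y = Re (cinner x y)\<close>, and \<open>cinner x x\<close> is
  real by conjugate symmetry. The scalar product is anti-linear in its first argument.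
\<close>

class chilbert_space = real_inner + complete_space +
  fixes scaleC :: "complex \<Rightarrow> 'a \<Rightarrow> 'a"  (infixr "*\<^sub>C" 75)
    and cinner :: "'a \<Rightarrow> 'a \<Rightarrow> complex"
  assumes scaleC_add_right: "a *\<^sub>C (x + y) = a *\<^sub>C x + a *\<^sub>C y"
    and scaleC_add_left: "(a + b) *\<^sub>C x = a *\<^sub>C x + b *\<^sub>C x"
    and scaleC_scaleC: "a *\<^sub>C (b *\<^sub>C x) = (a * b) *\<^sub>C x"
    and scaleR_scaleC: "r *\<^sub>R x = complex_of_real r *\<^sub>C x"
    and cinner_commute: "cinner x y = cnj (cinner y x)"
    and cinner_add_right: "cinner x (y + z) = cinner x y + cinner x z"
    and cinner_scaleC_right: "cinner x (a *\<^sub>C y) = a * cinner x y"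
    and inner_eq_Re_cinner: "inner x y = Re (cinner x y)"

instantiation complex :: chilbert_space
begin

definition scaleC_complex :: "complex \<Rightarrow> complex \<Rightarrow> complex"
  where "scaleC_complex a x = a * x"

definition cinner_complex :: "complex \<Rightarrow> complex \<Rightarrow> complex"
  where "cinner_complex x y = cnj x * y"

instance
  by standard
    (auto simp: scaleC_complex_def cinner_complex_def algebra_simps inner_complex_def scaleR_conv_of_real)

end


section \<open>Operators with a domain\<close>

text \<open>
  A (possibly unbounded) operator is a partial function \<open>A\<close> with domain \<^term>\<open>dom A\<close>, so equality of
  operators includes equality of their domains.
\<close>

type_synonym 'a operator = "'a \<Rightarrow> 'a option"

definition app :: "'a operator \<Rightarrow> 'a \<Rightarrow> 'a"  (infixl "\<bullet>\<^sub>o" 90)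
  where "A \<bullet>\<^sub>o x = the (A x)"

definition zero_operator :: "'a::chilbert_space operator"
  where "zero_operator = (\<lambda>x. Some 0)"

definition linear_operator :: "'a::chilbert_space operator \<Rightarrow> bool"
  where "linear_operator A \<longleftrightarrow>
    0 \<in> dom A \<and>
    (\<forall>x\<in>dom A. \<forall>y\<in>dom A. x + y \<in> dom A \<and> A \<bullet>\<^sub>o (x + y) = A \<bullet>\<^sub>o x + A \<bullet>\<^sub>o y) \<and>
    (\<forall>a. \<forall>x\<in>dom A. a *\<^sub>C x \<in> dom A \<and> A \<bullet>\<^sub>o (a *\<^sub>C x) = a *\<^sub>C (A \<bullet>\<^sub>o x))"

definition densely_defined :: "'a::chilbert_space operator \<Rightarrow> bool"
  where "densely_defined A \<longleftrightarrow> closure (dom A) = UNIV"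

text \<open>
  The vector \<open>z\<close> below is unique, hence equal to the value of the adjoint at \<open>y\<close>, when \<open>A\<close> is densely
  defined.
\<close>

definition op_adjoint :: "'a::chilbert_space operator \<Rightarrow> 'a operator"
  where "op_adjoint A = (\<lambda>y.
    if \<exists>z. \<forall>x\<in>dom A. cinner y (A \<bullet>\<^sub>o x) = cinner z x
    then Some (THE z. \<forall>x\<in>dom A. cinner y (A \<bullet>\<^sub>o x) = cinner z x)
    else None)"

definition self_adjoint :: "'a::chilbert_space operator \<Rightarrow> bool"
  where "self_adjoint A \<longleftrightarrow> linear_operator A \<and> densely_defined A \<and> op_adjoint A = A"

definition bounded_operator :: "'a::chilbert_space operator \<Rightarrow> bool"
  where "bounded_operator A \<longleftrightarrow> (\<exists>C. \<forall>x\<in>dom A. norm (A \<bullet>\<^sub>o x) \<le> C * norm x)"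

definition bounded_operators :: "'a::chilbert_space operator set"
  where "bounded_operators = {A. linear_operator A \<and> dom A = UNIV \<and> bounded_operator A}"

text \<open>
  This is \<^const>\<open>strong_operator_topology\<close> transferred to the present representation of operators: the
  topology of pointwise convergence on the everywhere defined bounded operators.
\<close>

definition SOT :: "'a::chilbert_space operator topology"
  where "SOT = pullback_topology bounded_operators app euclidean"

definition resolvent_set :: "'a::chilbert_space operator \<Rightarrow> complex set"
  where "resolvent_set A = {z.
    bij_betw (\<lambda>x. A \<bullet>\<^sub>o x - z *\<^sub>C x) (dom A) UNIV \<and>
    (\<exists>C. \<forall>x\<in>dom A. norm x \<le> C * norm (A \<bullet>\<^sub>o x - z *\<^sub>C x))}"

definition spectrum :: "'a::chilbert_space operator \<Rightarrow> complex set"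
  where "spectrum A = - resolvent_set A"

definition point_spectrum :: "'a::chilbert_space operator \<Rightarrow> complex set"
  where "point_spectrum A = {z. \<exists>x\<in>dom A. x \<noteq> 0 \<and> A \<bullet>\<^sub>o x = z *\<^sub>C x}"


section \<open>Spectral families and the Borel functional calculus\<close>

definition orthogonal_projection :: "('a::chilbert_space \<Rightarrow> 'a) \<Rightarrow> bool"
  where "orthogonal_projection P \<longleftrightarrow>
    (\<forall>x y. P (x + y) = P x + P y) \<and> (\<forall>a x. P (a *\<^sub>C x) = a *\<^sub>C P x) \<and>
    (\<forall>x. P (P x) = P x) \<and> (\<forall>x y. cinner (P x) y = cinner x (P y))"

definition spectral_family :: "(real \<Rightarrow> 'a::chilbert_space \<Rightarrow> 'a) \<Rightarrow> bool"
  where "spectral_family E \<longleftrightarrow>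
    (\<forall>t. orthogonal_projection (E t)) \<and>
    (\<forall>s t x. E s (E t x) = E (min s t) x) \<and>
    (\<forall>t x. ((\<lambda>s. E s x) \<longlongrightarrow> E t x) (at_right t)) \<and>
    (\<forall>x. ((\<lambda>t. E t x) \<longlongrightarrow> 0) at_bot) \<and>
    (\<forall>x. ((\<lambda>t. E t x) \<longlongrightarrow> x) at_top)"

text \<open>The Lebesgue--Stieltjes measure \<open>d \<parallel>E\<^sub>\<lambda> x\<parallel>\<^sup>2\<close>.\<close>

definition spectral_measure_at :: "(real \<Rightarrow> 'a::chilbert_space \<Rightarrow> 'a) \<Rightarrow> 'a \<Rightarrow> real measure"
  where "spectral_measure_at E x = interval_measure (\<lambda>t. (norm (E t x))\<^sup>2)"

text \<open>
  The list \<open>[(c\<^sub>1, a\<^sub>1, b\<^sub>1), \<dots>]\<close> represents the step function taking the value \<open>c\<^sub>i\<close> on \<open>(a\<^sub>i, b\<^sub>i]\<close>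
  (contributions of overlapping intervals are added); its integral with respect to \<open>dE x\<close> is the sum
  of the vectors \<open>c\<^sub>i (E b\<^sub>i x - E a\<^sub>i x)\<close>. A function \<open>f\<close> that is square integrable with respect to
  \<open>d \<parallel>E\<^sub>\<lambda> x\<parallel>\<^sup>2\<close> is the limit of step functions in that L2 space, and by the isometry property of the
  integral the integrals of the step functions converge to a vector that depends only on \<open>f\<close>.
\<close>

definition step_function :: "(complex \<times> real \<times> real) list \<Rightarrow> real \<Rightarrow> complex"
  where "step_function S t = (\<Sum>(c, a, b)\<leftarrow>S. c * indicator {a<..b} t)"

definition step_integral ::
  "(real \<Rightarrow> 'a::chilbert_space \<Rightarrow> 'a) \<Rightarrow> (complex \<times> real \<times> real) list \<Rightarrow> 'a \<Rightarrow> 'a"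
  where "step_integral E S x = (\<Sum>(c, a, b)\<leftarrow>S. c *\<^sub>C (E b x - E a x))"

definition step_lists :: "(complex \<times> real \<times> real) list set"
  where "step_lists = {S. \<forall>(c, a, b)\<in>set S. a \<le> b}"

definition has_spectral_integral ::
  "(real \<Rightarrow> 'a::chilbert_space \<Rightarrow> 'a) \<Rightarrow> (real \<Rightarrow> complex) \<Rightarrow> 'a \<Rightarrow> 'a \<Rightarrow> bool"
  where "has_spectral_integral E f x z \<longleftrightarrow>
    (\<exists>S. (\<forall>n::nat. S n \<in> step_lists) \<and>
      (\<lambda>n. \<integral>\<^sup>+t. ennreal ((cmod (f t - step_function (S n) t))\<^sup>2) \<partial>spectral_measure_at E x)
        \<longlonglongrightarrow> 0 \<and>
      (\<lambda>n. step_integral E (S n) x) \<longlonglongrightarrow> z)"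

definition spectral_integral ::
  "(real \<Rightarrow> 'a::chilbert_space \<Rightarrow> 'a) \<Rightarrow> (real \<Rightarrow> complex) \<Rightarrow> 'a operator"
  where "spectral_integral E f = (\<lambda>x.
    if (\<integral>\<^sup>+t. ennreal ((cmod (f t))\<^sup>2) \<partial>spectral_measure_at E x) < \<infinity>
    then Some (THE z. has_spectral_integral E f x z)
    else None)"

text \<open>
  By the spectral theorem every self-adjoint operator has exactly one spectral family, so the choice
  below is immaterial.
\<close>

definition spectral_family_of :: "'a::chilbert_space operator \<Rightarrow> real \<Rightarrow> 'a \<Rightarrow> 'a"
  where "spectral_family_of T =
    (SOME E. spectral_family E \<and> spectral_integral E complex_of_real = T)"

definition functional_calculus ::
  "'a::chilbert_space operator \<Rightarrow> (real \<Rightarrow> complex) \<Rightarrow> 'a operator"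
  where "functional_calculus T f = spectral_integral (spectral_family_of T) f"

definition borel_p :: "'a::chilbert_space operator \<Rightarrow> (real \<Rightarrow> complex) set"
  where "borel_p T = {f. f \<in> borel_measurable borel \<and>
    (\<forall>t. complex_of_real t \<in> point_spectrum T \<longrightarrow> isCont f t)}"


section \<open>Test functions and operator-valued distributions\<close>

definition nth_derivative :: "nat \<Rightarrow> (real \<Rightarrow> complex) \<Rightarrow> real \<Rightarrow> complex"
  where "nth_derivative n = (\<lambda>g t. vector_derivative g (at t)) ^^ n"

definition smooth_function :: "(real \<Rightarrow> complex) \<Rightarrow> bool"
  where "smooth_function f \<longleftrightarrow> (\<forall>n t. nth_derivative n f differentiable at t)"

definition test_functions_on :: "real set \<Rightarrow> (real \<Rightarrow> complex) set"
  where "test_functions_on K = {f. smooth_function f \<and> (\<forall>t. t \<notin> K \<longrightarrow> f t = 0)}"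

definition test_functions :: "(real \<Rightarrow> complex) set"
  where "test_functions = (\<Union>K\<in>{K. compact K}. test_functions_on K)"

text \<open>
  The Frechet topology on the test functions supported in \<open>K\<close> is generated by the balls of the norms
  \<open>max {sup \<bar>f\<^sup>(\<^sup>n\<^sup>)\<bar> | n \<le> N}\<close>.
\<close>

definition test_topology_on :: "real set \<Rightarrow> (real \<Rightarrow> complex) topology"
  where "test_topology_on K = topology_generated_by
    {{g \<in> test_functions_on K. \<forall>n\<le>N. \<forall>t. cmod (nth_derivative n (\<lambda>s. g s - f s) t) < e}
      | f N e. f \<in> test_functions_on K \<and> e > 0}"

text \<open>
  The inductive limit topology is the finest locally convex topology for which all inclusions of
  \<open>test_functions_on K\<close> (\<open>K\<close> compact) are continuous: a neighbourhood base at \<open>0\<close> consists of the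
  convex balanced sets whose traces on all these subspaces are open.
\<close>

definition basic_zero_nbhds :: "(real \<Rightarrow> complex) set set"
  where "basic_zero_nbhds = {W. W \<subseteq> test_functions \<and> (\<lambda>t. 0) \<in> W \<and>
    (\<forall>f\<in>W. \<forall>g\<in>W. \<forall>u::real. 0 \<le> u \<and> u \<le> 1 \<longrightarrow>
      (\<lambda>t. complex_of_real u * f t + complex_of_real (1 - u) * g t) \<in> W) \<and>
    (\<forall>f\<in>W. \<forall>a. cmod a \<le> 1 \<longrightarrow> (\<lambda>t. a * f t) \<in> W) \<and>
    (\<forall>K. compact K \<longrightarrow> openin (test_topology_on K) (W \<inter> test_functions_on K))}"

definition test_topology :: "(real \<Rightarrow> complex) topology"
  where "test_topology = topology_generated_by
    {(\<lambda>g t. f t + g t) ` W | f W. f \<in> test_functions \<and> W \<in> basic_zero_nbhds}"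

definition operator_linear_on ::
  "(real \<Rightarrow> complex) set \<Rightarrow> ((real \<Rightarrow> complex) \<Rightarrow> 'a::chilbert_space operator) \<Rightarrow> bool"
  where "operator_linear_on F \<delta> \<longleftrightarrow>
    (\<forall>a b. \<forall>f\<in>F. \<forall>g\<in>F. \<forall>x \<in> dom (\<delta> f) \<inter> dom (\<delta> g).
      x \<in> dom (\<delta> (\<lambda>t. a * f t + b * g t)) \<and>
      \<delta> (\<lambda>t. a * f t + b * g t) \<bullet>\<^sub>o x = a *\<^sub>C (\<delta> f \<bullet>\<^sub>o x) + b *\<^sub>C (\<delta> g \<bullet>\<^sub>o x))"

definition operator_valued_distribution ::
  "((real \<Rightarrow> complex) \<Rightarrow> 'a::chilbert_space operator) \<Rightarrow> bool"
  where "operator_valued_distribution \<delta> \<longleftrightarrow>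
    (\<forall>f\<in>test_functions. \<delta> f \<in> bounded_operators) \<and>
    operator_linear_on test_functions \<delta> \<and>
    continuous_map test_topology SOT \<delta>"

end

theory Submission
  imports Defs "HOL-Probability.Distribution_Functions"
begin

text \<open>
  The map is \<open>\<delta> f = f(T)\<close>. Two things have to be shown: that \<open>T\<close> has a spectral family at all, so that the
  functional calculus refers to a meaningful object, and that the spectral integral of any such family has
  the asserted properties.

  \<^emph>\<open>The spectral integral.\<close> Increments of a spectral family over disjoint intervals are orthogonal, so
  integrating step functions is an isometry from \<open>L\<^sup>2(d \<parallel>E x\<parallel>\<^sup>2)\<close> into the Hilbert space
  (\<open>norm_step_integral\<close>). Step functions are dense, even for several finite measures at once
  (\<open>step_approximable_square_integrable\<close>), which gives existence, linearity in the function and in the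
  vector, and the adjoint relation by passing to limits. The convergence statement is bounded convergence in
  \<open>L\<^sup>2\<close>. A function bounded by \<open>M\<close> gives an operator bounded by a multiple of \<open>M\<close>, and this alone
  yields a distribution, since the supremum norm is continuous on the space of test functions.

  \<^emph>\<open>The spectral theorem.\<close> For real \<open>l\<close> the real part of the resolvent \<open>(T - l - \<i>)\<^sup>-\<^sup>1\<close> is a bounded
  self-adjoint operator with the same sign as \<open>T - l\<close>, and all these operators commute with all nonreal
  resolvents. The projection \<open>E l\<close> is the one onto the part where this operator is nonpositive
  (\<open>nonpositive_spectral_projection\<close>); it is obtained from the absolute value, that is, from a square root
  given by a norm convergent iteration. On the range of \<open>E l\<close> the form of \<open>T\<close> is at most \<open>l\<close>, on the
  kernel it is at least \<open>l\<close>. Monotonicity, right continuity and the limits at infinity follow by comparing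
  these bounds. Between \<open>a\<close> and \<open>b\<close> the operator \<open>T\<close> differs from \<open>a\<close> by at most \<open>b - a\<close>, so Riemann sums
  converge to \<open>T\<close>; equality of domains comes from the closedness of \<open>T\<close>
  (\<open>spectral_integral_spec_proj\<close>).

  \<^emph>\<open>The support.\<close> If \<open>T - l\<close> has a bounded inverse, then there are no approximate eigenvectors for \<open>l\<close>, so
  the spectral family is constant near \<open>l\<close> (\<open>spectral_gap\<close>). Hence the spectral measures vanish outside
  the spectrum. This argument works for every spectral family of \<open>T\<close>, in particular for the one
  that defines \<open>f(T)\<close>.
\<close>

section \<open>Complex Hilbert space geometry\<close>

lemma cinner_add_left: "cinner (x + y) z = cinner x z + cinner y (z::'a::chilbert_space)"
  by (subst (1 2 3) cinner_commute) (simp add: cinner_add_right)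

lemma cinner_scaleC_left: "cinner (a *\<^sub>C x) y = cnj a * cinner x (y::'a::chilbert_space)"
  by (subst (1 2) cinner_commute) (simp add: cinner_scaleC_right)

lemma scaleC_of_real: "complex_of_real r *\<^sub>C x = r *\<^sub>R (x::'a::chilbert_space)"
  by (simp add: scaleR_scaleC)

lemma scaleC_one [simp]: "1 *\<^sub>C x = (x::'a::chilbert_space)"
  using scaleC_of_real[of 1 x] by simp

lemma scaleC_zero_left [simp]: "0 *\<^sub>C x = (0::'a::chilbert_space)"
  using scaleC_of_real[of 0 x] by simp

lemma scaleC_zero_right [simp]: "a *\<^sub>C (0::'a::chilbert_space) = 0"
  using scaleC_add_right[of a 0 "0::'a"] by simp

lemma scaleC_minus_right: "a *\<^sub>C (- x) = - (a *\<^sub>C (x::'a::chilbert_space))"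
  using scaleC_add_right[of a x "-x"] by (simp add: eq_neg_iff_add_eq_0 add.commute)

lemma scaleC_minus_left: "(- a) *\<^sub>C x = - (a *\<^sub>C (x::'a::chilbert_space))"
  using scaleC_add_left[of a "-a" x] by (simp add: eq_neg_iff_add_eq_0 add.commute)

lemma scaleC_diff_right: "a *\<^sub>C (x - y) = a *\<^sub>C x - a *\<^sub>C (y::'a::chilbert_space)"
  using scaleC_add_right[of a x "-y"] by (simp add: scaleC_minus_right)

lemma cinner_zero_right [simp]: "cinner x (0::'a::chilbert_space) = 0"
  using cinner_scaleC_right[of x 0 x] by simp

lemma cinner_zero_left [simp]: "cinner (0::'a::chilbert_space) x = 0"
  using cinner_scaleC_left[of 0 x x] by simp

lemma cinner_minus_right: "cinner x (- y) = - cinner x (y::'a::chilbert_space)"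
  using cinner_scaleC_right[of x "-1" y] by (simp add: scaleC_minus_left)

lemma cinner_minus_left: "cinner (- x) y = - cinner x (y::'a::chilbert_space)"
  using cinner_scaleC_left[of "-1" x y] by (simp add: scaleC_minus_left)

lemma cinner_diff_right: "cinner x (y - z) = cinner x y - cinner x (z::'a::chilbert_space)"
  using cinner_add_right[of x y "-z"] by (simp add: cinner_minus_right)

lemma cinner_diff_left: "cinner (x - y) z = cinner x z - cinner y (z::'a::chilbert_space)"
  using cinner_add_left[of x "-y" z] by (simp add: cinner_minus_left)

lemma cinner_scaleR_left: "cinner (r *\<^sub>R x) y = of_real r * cinner x (y::'a::chilbert_space)"
  by (simp add: scaleR_scaleC cinner_scaleC_left)

lemma cinner_scaleR_right: "cinner x (r *\<^sub>R y) = of_real r * cinner x (y::'a::chilbert_space)"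
  by (simp add: scaleR_scaleC cinner_scaleC_right)

lemma scaleC_scaleR: "a *\<^sub>C (r *\<^sub>R x) = r *\<^sub>R (a *\<^sub>C (x::'a::chilbert_space))"
  by (simp add: scaleR_scaleC scaleC_scaleC mult.commute)

text \<open>The imaginary part of the complex scalar product is a real one, so limits and identities of
  real scalar products transfer to complex ones.\<close>

lemma cinner_Complex: "cinner x y = Complex (inner x y) (inner (\<i> *\<^sub>C x) (y::'a::chilbert_space))"
  by (rule complex_eqI) (simp_all add: inner_eq_Re_cinner cinner_scaleC_left)

lemma cinner_self: "cinner x x = complex_of_real ((norm (x::'a::chilbert_space))\<^sup>2)"
proof -
  have "cinner x x = cnj (cinner x x)" by (rule cinner_commute)
  hence "Im (cinner x x) = 0" by (metis complex_cnj_zero_iff complex_cnj_cnj cnj.sel(2) equal_neg_zero)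
  moreover have "Re (cinner x x) = (norm x)\<^sup>2"
    by (simp flip: inner_eq_Re_cinner add: power2_norm_eq_inner)
  ultimately show ?thesis by (simp add: complex_eq_iff)
qed

lemma norm_scaleC: "norm (a *\<^sub>C x) = cmod a * norm (x::'a::chilbert_space)"
proof -
  have "cinner (a *\<^sub>C x) (a *\<^sub>C x) = complex_of_real ((cmod a * norm x)\<^sup>2)"
    by (simp add: cinner_scaleC_left cinner_scaleC_right cinner_self[of x] power_mult_distrib
        complex_norm_square[of a] mult.assoc[symmetric] mult.commute[of "cnj a"] del: of_real_power)
  hence "complex_of_real ((norm (a *\<^sub>C x))\<^sup>2) = complex_of_real ((cmod a * norm x)\<^sup>2)"
    by (simp only: cinner_self)
  hence "(norm (a *\<^sub>C x))\<^sup>2 = (cmod a * norm x)\<^sup>2" by (simp only: of_real_eq_iff)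
  thus ?thesis by (simp add: power2_eq_iff_nonneg)
qed

lemma bounded_linear_scaleC: "bounded_linear (\<lambda>x::'a::chilbert_space. a *\<^sub>C x)"
  by (rule bounded_linear_intro[where K="cmod a"])
    (simp_all add: scaleC_add_right scaleC_scaleR norm_scaleC mult.commute)

lemmas tendsto_scaleC = bounded_linear.tendsto[OF bounded_linear_scaleC]

lemma tendsto_cinner:
  assumes "(f \<longlongrightarrow> x) F" "(g \<longlongrightarrow> (y::'a::chilbert_space)) F"
  shows "((\<lambda>n. cinner (f n) (g n)) \<longlongrightarrow> cinner x y) F"
  unfolding cinner_Complex
  by (intro tendsto_Complex tendsto_inner tendsto_scaleC assms)

lemma norm_add_square: "(norm (x + y))\<^sup>2 = (norm x)\<^sup>2 + 2 * inner x y + (norm (y::'a::real_inner))\<^sup>2"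
  by (simp add: power2_norm_eq_inner inner_add_left inner_add_right inner_commute)

lemma norm_diff_square: "(norm (x - y))\<^sup>2 = (norm x)\<^sup>2 - 2 * inner x y + (norm (y::'a::real_inner))\<^sup>2"
  by (simp add: power2_norm_eq_inner inner_diff_left inner_diff_right inner_commute)

lemma parallelogram: "(norm (x + y))\<^sup>2 + (norm (x - y))\<^sup>2 = 2 * (norm x)\<^sup>2 + 2 * (norm (y::'a::real_inner))\<^sup>2"
  by (simp add: norm_add_square norm_diff_square)

text \<open>The projection theorem: a minimising sequence for the distance from \<open>x\<close> to \<open>M\<close> is Cauchy by the
  parallelogram law, and the residual at its limit is orthogonal to \<open>M\<close>, since otherwise moving along
  a vector of \<open>M\<close> would decrease the distance.\<close>

lemma orthogonal_residual:
  fixes M :: "'a::chilbert_space set" and x :: 'a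
  assumes cl: "closed M" and z: "0 \<in> M" and add: "\<And>u v. u \<in> M \<Longrightarrow> v \<in> M \<Longrightarrow> u + v \<in> M"
    and sc: "\<And>a u. u \<in> M \<Longrightarrow> a *\<^sub>C u \<in> M"
  obtains p where "p \<in> M" "\<And>m. m \<in> M \<Longrightarrow> cinner m (x - p) = 0"
proof -
  define d where "d = infdist x M"
  have d0: "0 \<le> d" and dle: "d \<le> norm (x - m)" if "m \<in> M" for m
    using that infdist_le[of m M x] by (auto simp: d_def dist_norm infdist_nonneg)
  have scR: "r *\<^sub>R u \<in> M" if "u \<in> M" for r u using sc[OF that] by (simp add: scaleR_scaleC)
  have ne: "M \<noteq> {}" using z by blast
  have "\<exists>m\<in>M. dist x m < d + e" if "e > 0" for e
  proof (rule ccontr)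
    assume "\<not> ?thesis"
    hence "\<And>m. m \<in> M \<Longrightarrow> d + e \<le> dist x m" by force
    hence "d + e \<le> infdist x M" using ne by (simp add: infdist_notempty cINF_greatest)
    thus False using that by (simp add: d_def)
  qed
  hence "\<exists>m\<in>M. norm (x - m) < d + inverse (real (Suc n))" for n by (simp add: dist_norm)
  then obtain m where mM: "\<And>n. m n \<in> M" and md: "\<And>n. norm (x - m n) < d + inverse (real (Suc n))"
    by metis
  have lim: "(\<lambda>n. (norm (x - m n))\<^sup>2) \<longlonglongrightarrow> d\<^sup>2"
  proof (rule tendsto_power, rule tendsto_sandwich)
    show "(\<lambda>n. d) \<longlonglongrightarrow> d" by simp
    show "(\<lambda>n. d + inverse (real (Suc n))) \<longlonglongrightarrow> d"
      using tendsto_add[OF tendsto_const LIMSEQ_inverse_real_of_nat, of d] by simp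
  qed (use dle[OF mM] less_imp_le[OF md] in auto)
  have par: "(norm (m i - m j))\<^sup>2 \<le> 2 * (norm (x - m i))\<^sup>2 + 2 * (norm (x - m j))\<^sup>2 - 4 * d\<^sup>2" for i j
  proof -
    have "(norm ((x - m i) + (x - m j)))\<^sup>2 + (norm ((x - m i) - (x - m j)))\<^sup>2
       = 2 * (norm (x - m i))\<^sup>2 + 2 * (norm (x - m j))\<^sup>2" by (rule parallelogram)
    moreover have "(x - m i) + (x - m j) = 2 *\<^sub>R (x - (1/2) *\<^sub>R (m i + m j))"
      by (simp add: algebra_simps scaleR_2)
    hence "norm ((x - m i) + (x - m j)) = 2 * norm (x - (1/2) *\<^sub>R (m i + m j))" by simp
    moreover have "d\<^sup>2 \<le> (norm (x - (1/2) *\<^sub>R (m i + m j)))\<^sup>2"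
      using d0[OF z] dle[OF scR[OF add[OF mM mM]]] by (intro power_mono) auto
    ultimately show ?thesis by (simp add: norm_minus_commute power_mult_distrib)
  qed
  have "Cauchy m"
  proof (rule metric_CauchyI)
    fix e :: real assume e: "e > 0"
    have "\<forall>\<^sub>F n in sequentially. (norm (x - m n))\<^sup>2 < d\<^sup>2 + e\<^sup>2 / 8"
      using lim e by (intro order_tendstoD) auto
    then obtain N where N: "\<And>n. n \<ge> N \<Longrightarrow> (norm (x - m n))\<^sup>2 < d\<^sup>2 + e\<^sup>2 / 8"
      by (auto simp: eventually_sequentially)
    show "\<exists>N. \<forall>i\<ge>N. \<forall>j\<ge>N. dist (m i) (m j) < e"
    proof (intro exI allI impI)
      fix i j assume "i \<ge> N" "j \<ge> N"
      hence "(norm (m i - m j))\<^sup>2 < e\<^sup>2" using par[of i j] N[of i] N[of j] e zero_less_power[OF e, of 2] by linarith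
      thus "dist (m i) (m j) < e" using e by (simp add: dist_norm power_less_imp_less_base)
    qed
  qed
  then obtain p where p: "m \<longlonglongrightarrow> p" using Cauchy_convergent convergent_def by blast
  have pM: "p \<in> M" using cl p mM closed_sequentially by blast
  have pd: "(norm (x - p))\<^sup>2 = d\<^sup>2"
    by (rule LIMSEQ_unique[OF _ lim]) (intro tendsto_intros p)
  have ortho: "inner u (x - p) = 0" if u: "u \<in> M" for u
  proof (cases "u = 0")
    case False
    define t where "t = inner u (x - p) / (norm u)\<^sup>2"
    have "p + t *\<^sub>R u \<in> M" using pM u by (intro add scR)
    hence "d\<^sup>2 \<le> (norm (x - (p + t *\<^sub>R u)))\<^sup>2" using d0[OF z] dle by (intro power_mono) auto
    also have "x - (p + t *\<^sub>R u) = (x - p) - t *\<^sub>R u" by simp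
    also have "(norm \<dots>)\<^sup>2 = d\<^sup>2 - 2 * t * inner u (x - p) + t\<^sup>2 * (norm u)\<^sup>2"
      unfolding norm_diff_square[of "x - p" "t *\<^sub>R u"] pd by (simp add: inner_commute power_mult_distrib)
    also have "\<dots> = d\<^sup>2 - (inner u (x - p))\<^sup>2 / (norm u)\<^sup>2"
      using False by (simp add: t_def field_simps power2_eq_square)
    finally have "(inner u (x - p))\<^sup>2 / (norm u)\<^sup>2 \<le> 0" by simp
    thus ?thesis using False by (simp add: divide_le_0_iff)
  qed simp
  show thesis
  proof (rule that[OF pM])
    fix u assume u: "u \<in> M"
    show "cinner u (x - p) = 0"
      unfolding cinner_Complex using ortho[OF u] ortho[OF sc[OF u, of \<i>]] by (simp add: zero_complex.code)
  qed
qed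

section \<open>Density of step functions in spaces of square integrable functions\<close>

text \<open>The distance of \<open>L\<^sup>2(\<mu>)\<close> enters only through its square. This avoids square roots of
  extended numbers, at the price of the factor \<open>2\<close> in the triangle inequality, which is harmless
  for convergence.\<close>

definition sqdist :: "real measure \<Rightarrow> (real \<Rightarrow> complex) \<Rightarrow> (real \<Rightarrow> complex) \<Rightarrow> ennreal"
  where "sqdist \<mu> f g = (\<integral>\<^sup>+t. ennreal ((cmod (f t - g t))\<^sup>2) \<partial>\<mu>)"

lemma cmod_diff_square_le: "(cmod (a - c))\<^sup>2 \<le> 2 * (cmod (a - b))\<^sup>2 + 2 * (cmod (b - c))\<^sup>2"
proof -
  have "cmod (a - c) \<le> cmod (a - b) + cmod (b - c)" using norm_triangle_ineq[of "a - b" "b - c"] by simp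
  hence "(cmod (a - c))\<^sup>2 \<le> (cmod (a - b) + cmod (b - c))\<^sup>2" by (intro power_mono) auto
  also have "\<dots> \<le> 2 * (cmod (a - b))\<^sup>2 + 2 * (cmod (b - c))\<^sup>2"
    using zero_le_power2[of "cmod (a - b) - cmod (b - c)"] unfolding power2_sum power2_diff by linarith
  finally show ?thesis .
qed

lemma sqdist_triangle:
  assumes "sets \<mu> = sets borel" "f \<in> borel_measurable borel" "g \<in> borel_measurable borel" "h \<in> borel_measurable borel"
  shows "sqdist \<mu> f h \<le> 2 * sqdist \<mu> f g + 2 * sqdist \<mu> g h"
proof -
  note assms(1)[measurable_cong] assms(2-4)[measurable]
  have "sqdist \<mu> f h \<le> (\<integral>\<^sup>+t. (2 * ennreal ((cmod (f t - g t))\<^sup>2) + 2 * ennreal ((cmod (g t - h t))\<^sup>2)) \<partial>\<mu>)"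
    unfolding sqdist_def
  proof (rule nn_integral_mono)
    fix t
    have "ennreal ((cmod (f t - h t))\<^sup>2) \<le> ennreal (2 * (cmod (f t - g t))\<^sup>2 + 2 * (cmod (g t - h t))\<^sup>2)"
      by (rule ennreal_leI, rule cmod_diff_square_le)
    thus "ennreal ((cmod (f t - h t))\<^sup>2) \<le> 2 * ennreal ((cmod (f t - g t))\<^sup>2) + 2 * ennreal ((cmod (g t - h t))\<^sup>2)"
      by (simp add: ennreal_plus ennreal_mult')
  qed
  also have "\<dots> = 2 * sqdist \<mu> f g + 2 * sqdist \<mu> g h"
    unfolding sqdist_def by (simp add: nn_integral_add nn_integral_cmult)
  finally show ?thesis .
qed

lemma sqdist_commute: "sqdist \<mu> f g = sqdist \<mu> g f"
  by (simp add: sqdist_def norm_minus_commute)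

lemma sqdist_scale: "sqdist \<mu> (\<lambda>t. c * f t) (\<lambda>t. c * g t) = ennreal ((cmod c)\<^sup>2) * sqdist \<mu> f g"
  if "sets \<mu> = sets borel" "f \<in> borel_measurable borel" "g \<in> borel_measurable borel"
proof -
  note that(1)[measurable_cong] that(2,3)[measurable]
  show ?thesis unfolding sqdist_def
    by (simp add: nn_integral_cmult[symmetric] ennreal_mult'[symmetric] power_mult_distrib[symmetric]
        norm_mult[symmetric] right_diff_distrib)
qed

lemma sqdist_add:
  assumes "sets \<mu> = sets borel" "f \<in> borel_measurable borel" "g \<in> borel_measurable borel"
    "f' \<in> borel_measurable borel" "g' \<in> borel_measurable borel"
  shows "sqdist \<mu> (\<lambda>t. f t + g t) (\<lambda>t. f' t + g' t) \<le> 2 * sqdist \<mu> f f' + 2 * sqdist \<mu> g g'"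
proof -
  have "sqdist \<mu> (\<lambda>t. f t + g t) (\<lambda>t. f' t + g' t)
     \<le> 2 * sqdist \<mu> (\<lambda>t. f t + g t) (\<lambda>t. f' t + g t) + 2 * sqdist \<mu> (\<lambda>t. f' t + g t) (\<lambda>t. f' t + g' t)"
    by (rule sqdist_triangle) (use assms in auto)
  thus ?thesis by (simp add: sqdist_def)
qed

lemma sqdist_linear:
  assumes mu: "sets \<mu> = sets borel"
    and m: "f \<in> borel_measurable borel" "g \<in> borel_measurable borel"
      "f' \<in> borel_measurable borel" "g' \<in> borel_measurable borel"
  shows "sqdist \<mu> (\<lambda>t. a * f t + b * g t) (\<lambda>t. a * f' t + b * g' t)
    \<le> 2 * (ennreal ((cmod a)\<^sup>2) * sqdist \<mu> f f') + 2 * (ennreal ((cmod b)\<^sup>2) * sqdist \<mu> g g')"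
proof -
  have "sqdist \<mu> (\<lambda>t. a * f t + b * g t) (\<lambda>t. a * f' t + b * g' t)
     \<le> 2 * sqdist \<mu> (\<lambda>t. a * f t) (\<lambda>t. a * f' t) + 2 * sqdist \<mu> (\<lambda>t. b * g t) (\<lambda>t. b * g' t)"
    by (rule sqdist_add) (use mu m in auto)
  thus ?thesis using mu m by (simp add: sqdist_scale)
qed

lemma step_function_Nil [simp]: "step_function [] t = 0"
  by (simp add: step_function_def)

lemma step_function_Cons [simp]: "step_function ((c, a, b) # S) t = c * indicator {a<..b} t + step_function S t"
  by (simp add: step_function_def)

lemma step_function_append: "step_function (S @ S') t = step_function S t + step_function S' t"
  by (simp add: step_function_def)

definition map_coeff :: "(complex \<Rightarrow> complex) \<Rightarrow> (complex \<times> real \<times> real) list \<Rightarrow> (complex \<times> real \<times> real) list"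
  where "map_coeff h S = map (\<lambda>(c, a, b). (h c, a, b)) S"

lemma step_function_scale: "step_function (map_coeff (\<lambda>c. d * c) S) t = d * step_function S t"
  by (induction S) (auto simp: map_coeff_def algebra_simps)

lemma step_function_cnj: "step_function (map_coeff cnj S) t = cnj (step_function S t)"
  by (induction S) (auto simp: map_coeff_def indicator_def)

lemma step_lists_Nil [simp]: "[] \<in> step_lists" by (simp add: step_lists_def)

lemma step_lists_Cons: "(c, a, b) # S \<in> step_lists \<longleftrightarrow> a \<le> b \<and> S \<in> step_lists"
  by (auto simp: step_lists_def)

lemma step_lists_append: "S \<in> step_lists \<Longrightarrow> S' \<in> step_lists \<Longrightarrow> S @ S' \<in> step_lists"
  by (auto simp: step_lists_def)

lemma step_lists_map_coeff: "S \<in> step_lists \<Longrightarrow> map_coeff h S \<in> step_lists"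
  by (fastforce simp: step_lists_def map_coeff_def)

lemma measurable_step_function [measurable]: "step_function S \<in> borel_measurable borel"
proof (induction S)
  case (Cons p S)
  obtain c a b where "p = (c, a, b)" by (cases p)
  with Cons show ?case by (simp flip: fun_eq_iff add: step_function_def)
qed (simp add: step_function_def)

lemma step_sequence_linear:
  assumes "sets \<mu> = sets borel" "f \<in> borel_measurable borel" "g \<in> borel_measurable borel"
    and S: "(\<lambda>n. sqdist \<mu> f (step_function (S n))) \<longlonglongrightarrow> 0" "(\<lambda>n. sqdist \<mu> g (step_function (S' n))) \<longlonglongrightarrow> 0"
  shows "(\<lambda>n. sqdist \<mu> (\<lambda>t. a * f t + b * g t)
    (step_function (map_coeff (\<lambda>z. a * z) (S n) @ map_coeff (\<lambda>z. b * z) (S' n)))) \<longlonglongrightarrow> 0"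
    (is "(\<lambda>n. sqdist \<mu> ?h (step_function (?U n))) \<longlonglongrightarrow> 0")
proof (rule tendsto_sandwich[OF _ _ tendsto_const])
  let ?d = "\<lambda>n. 2 * (ennreal ((cmod a)\<^sup>2) * sqdist \<mu> f (step_function (S n)))
    + 2 * (ennreal ((cmod b)\<^sup>2) * sqdist \<mu> g (step_function (S' n)))"
  have "step_function (?U n) = (\<lambda>t. a * step_function (S n) t + b * step_function (S' n) t)" for n
    by (auto simp: step_function_append step_function_scale)
  thus "\<forall>\<^sub>F n in sequentially. sqdist \<mu> ?h (step_function (?U n)) \<le> ?d n"
    using assms(1-3) by (auto intro!: sqdist_linear always_eventually)
  have "?d \<longlonglongrightarrow> 2 * (ennreal ((cmod a)\<^sup>2) * 0) + 2 * (ennreal ((cmod b)\<^sup>2) * 0)"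
    by (intro tendsto_add ennreal_tendsto_cmult S) auto
  thus "?d \<longlonglongrightarrow> 0" by simp
qed simp

text \<open>Approximation is asked simultaneously for all measures of the set \<open>I\<close>. Additivity of spectral
  integrals in the vector compares the scalar measures of several vectors, and needs one sequence of
  step functions that serves all of them.\<close>

definition step_approximable :: "real measure set \<Rightarrow> (real \<Rightarrow> complex) \<Rightarrow> bool"
  where "step_approximable I f \<longleftrightarrow>
    (\<forall>e>0. \<exists>S\<in>step_lists. \<forall>\<mu>\<in>I. sqdist \<mu> f (step_function S) < ennreal e)"

context
  fixes I :: "real measure set"
  assumes finite_I: "finite I" and finite_measures: "\<And>\<mu>. \<mu> \<in> I \<Longrightarrow> finite_measure \<mu>"
    and sets_I: "\<And>\<mu>. \<mu> \<in> I \<Longrightarrow> sets \<mu> = sets borel"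
begin

lemma step_approximable_limit:
  assumes f: "f \<in> borel_measurable borel" and fn: "\<And>n. fn n \<in> borel_measurable borel"
    and app: "\<And>n. step_approximable I (fn n)"
    and lim: "\<And>\<mu>. \<mu> \<in> I \<Longrightarrow> (\<lambda>n::nat. sqdist \<mu> f (fn n)) \<longlonglongrightarrow> 0"
  shows "step_approximable I f"
  unfolding step_approximable_def
proof (intro allI impI)
  fix e :: real assume e: "e > 0"
  have "\<forall>\<^sub>F n in sequentially. \<forall>\<mu>\<in>I. sqdist \<mu> f (fn n) < ennreal (e/4)"
    using finite_I by (rule eventually_ball_finite) (use e in \<open>auto intro!: order_tendstoD(2)[OF lim]\<close>)
  then obtain n where n: "\<And>\<mu>. \<mu> \<in> I \<Longrightarrow> sqdist \<mu> f (fn n) < ennreal (e/4)"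
    by (auto simp: eventually_sequentially)
  obtain S where S: "S \<in> step_lists" "\<And>\<mu>. \<mu> \<in> I \<Longrightarrow> sqdist \<mu> (fn n) (step_function S) < ennreal (e/4)"
    using app[of n] e by (auto simp: step_approximable_def dest!: spec[of _ "e/4"])
  have "sqdist \<mu> f (step_function S) < ennreal e" if "\<mu> \<in> I" for \<mu>
  proof -
    have "sqdist \<mu> f (step_function S) \<le> 2 * sqdist \<mu> f (fn n) + 2 * sqdist \<mu> (fn n) (step_function S)"
      by (rule sqdist_triangle) (use sets_I[OF that] f fn in auto)
    also have "\<dots> < 2 * ennreal (e/4) + 2 * ennreal (e/4)"
      by (intro add_strict_mono ennreal_mult_strict_left_mono n S(2) that) auto
    also have "\<dots> = ennreal (2 * (e/4) + 2 * (e/4))"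
      using e by (simp only: ennreal_plus[symmetric] ennreal_mult'[symmetric] ennreal_numeral[symmetric] zero_le_divide_iff mult_nonneg_nonneg)
    finally show ?thesis by simp
  qed
  with S(1) show "\<exists>S\<in>step_lists. \<forall>\<mu>\<in>I. sqdist \<mu> f (step_function S) < ennreal e" by blast
qed

lemma step_approximable_sequence:
  assumes app: "step_approximable I f"
  obtains S where "\<And>n::nat. S n \<in> step_lists" "\<And>\<mu>. \<mu> \<in> I \<Longrightarrow> (\<lambda>n. sqdist \<mu> f (step_function (S n))) \<longlonglongrightarrow> 0"
proof -
  have "\<forall>n. \<exists>S\<in>step_lists. \<forall>\<mu>\<in>I. sqdist \<mu> f (step_function S) < ennreal (inverse (real (Suc n)))"
    using app by (simp add: step_approximable_def)
  then obtain S where S: "\<And>n. S n \<in> step_lists"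
    "\<And>n \<mu>. \<mu> \<in> I \<Longrightarrow> sqdist \<mu> f (step_function (S n)) < ennreal (inverse (real (Suc n)))" by metis
  have "(\<lambda>n. sqdist \<mu> f (step_function (S n))) \<longlonglongrightarrow> 0" if "\<mu> \<in> I" for \<mu>
  proof (rule tendsto_sandwich[OF _ _ tendsto_const])
    show "(\<lambda>n. ennreal (inverse (real (Suc n)))) \<longlonglongrightarrow> 0"
      using tendsto_ennrealI[OF LIMSEQ_inverse_real_of_nat] by simp
  qed (use less_imp_le[OF S(2)[OF that]] in auto)
  with S(1) that show thesis by blast
qed

lemma step_approximable_of_sequence:
  assumes f: "f \<in> borel_measurable borel" and S: "\<And>n::nat. S n \<in> step_lists"
    and lim: "\<And>\<mu>. \<mu> \<in> I \<Longrightarrow> (\<lambda>n. sqdist \<mu> f (step_function (S n))) \<longlonglongrightarrow> 0"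
  shows "step_approximable I f"
proof (rule step_approximable_limit[OF f])
  show "step_approximable I (step_function (S n))" for n
    unfolding step_approximable_def by (auto intro!: bexI[OF _ S[of n]] simp: sqdist_def)
qed (use lim in auto)

lemma step_approximable_linear:
  assumes f: "f \<in> borel_measurable borel" and g: "g \<in> borel_measurable borel"
    and "step_approximable I f" "step_approximable I g"
  shows "step_approximable I (\<lambda>t. c * f t + d * g t)"
proof -
  obtain S where S: "\<And>n::nat. S n \<in> step_lists" "\<And>\<mu>. \<mu> \<in> I \<Longrightarrow> (\<lambda>n. sqdist \<mu> f (step_function (S n))) \<longlonglongrightarrow> 0"
    using step_approximable_sequence assms(3) by blast
  obtain S' where S': "\<And>n::nat. S' n \<in> step_lists" "\<And>\<mu>. \<mu> \<in> I \<Longrightarrow> (\<lambda>n. sqdist \<mu> g (step_function (S' n))) \<longlonglongrightarrow> 0"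
    using step_approximable_sequence assms(4) by blast
  show ?thesis
    by (rule step_approximable_of_sequence[OF _ _ step_sequence_linear[OF sets_I f g S(2) S'(2)]])
      (use f g S(1) S'(1) in \<open>auto intro!: step_lists_append step_lists_map_coeff\<close>)
qed

lemma sqdist_dominated:
  assumes mu: "\<mu> \<in> I" and f: "f \<in> borel_measurable borel" and fn: "\<And>n. fn n \<in> borel_measurable borel"
    and w: "w \<in> borel_measurable borel" "(\<integral>\<^sup>+t. w t \<partial>\<mu>) < \<infinity>"
    and bound: "\<And>n t. ennreal ((cmod (f t - fn n t))\<^sup>2) \<le> w t"
    and lim: "\<And>t. (\<lambda>n. fn n t) \<longlonglongrightarrow> f t"
  shows "(\<lambda>n. sqdist \<mu> f (fn n)) \<longlonglongrightarrow> 0"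
proof -
  note sets_I[OF mu, measurable_cong] f[measurable] fn[measurable] w(1)[measurable]
  have "(\<lambda>n. sqdist \<mu> f (fn n)) \<longlonglongrightarrow> (\<integral>\<^sup>+t. ennreal 0 \<partial>\<mu>)"
    unfolding sqdist_def
  proof (rule nn_integral_dominated_convergence[where w=w])
    show "AE t in \<mu>. (\<lambda>n. ennreal ((cmod (f t - fn n t))\<^sup>2)) \<longlonglongrightarrow> ennreal 0"
    proof (intro AE_I2 tendsto_ennrealI)
      fix t
      have "(\<lambda>n. (cmod (f t - fn n t))\<^sup>2) \<longlonglongrightarrow> (cmod (f t - f t))\<^sup>2" by (intro tendsto_intros lim)
      thus "(\<lambda>n. (cmod (f t - fn n t))\<^sup>2) \<longlonglongrightarrow> 0" by simp
    qed
  qed (use w(2) bound in auto)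
  thus ?thesis by simp
qed

lemma sqdist_bounded_limit:
  assumes mu: "\<mu> \<in> I" and f: "f \<in> borel_measurable borel" and fn: "\<And>n. fn n \<in> borel_measurable borel"
    and bound: "\<And>n t. cmod (f t - fn n t) \<le> M"
    and lim: "\<And>t. (\<lambda>n. fn n t) \<longlonglongrightarrow> f t"
  shows "(\<lambda>n. sqdist \<mu> f (fn n)) \<longlonglongrightarrow> 0"
proof (rule sqdist_dominated[OF mu f fn])
  interpret finite_measure \<mu> by (rule finite_measures[OF mu])
  show "(\<integral>\<^sup>+t. ennreal (M\<^sup>2) \<partial>\<mu>) < \<infinity>"
    by (simp add: ennreal_mult_less_top less_top[symmetric] ennreal_mult_eq_top_iff)
  show "ennreal ((cmod (f t - fn n t))\<^sup>2) \<le> ennreal (M\<^sup>2)" for n t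
    by (intro ennreal_leI power_mono bound) auto
qed (use lim in auto)

lemma step_approximable_indicator_UNIV: "step_approximable I (indicator UNIV)"
proof (rule step_approximable_of_sequence[where S="\<lambda>n. [(1, - real n, real n)]"])
  fix \<mu> assume mu: "\<mu> \<in> I"
  show "(\<lambda>n. sqdist \<mu> (indicator UNIV) (step_function [(1, - real n, real n)])) \<longlonglongrightarrow> 0"
  proof (rule sqdist_bounded_limit[OF mu, where M=1])
    fix t :: real
    obtain N where N: "\<bar>t\<bar> < real N" using reals_Archimedean2 by blast
    have "\<forall>\<^sub>F n in sequentially. step_function [(1, - real n, real n)] t = 1"
      using eventually_ge_at_top[of N] by eventually_elim (use N in \<open>auto simp: indicator_def\<close>)
    thus "(\<lambda>n. step_function [(1, - real n, real n)] t) \<longlonglongrightarrow> indicator UNIV t"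
      by (simp add: tendsto_eventually)
  qed (auto simp: indicator_def)
qed (auto simp: step_lists_Cons)

text \<open>The sets whose indicator is approximable form a Dynkin system: complements are handled by linearity
  and disjoint unions by bounded convergence. It contains the half-open intervals, which generate the
  Borel sets and are stable under intersection.\<close>

lemma step_approximable_indicator:
  assumes "B \<in> sets borel" shows "step_approximable I (indicator B)"
proof -
  let ?G = "range (\<lambda>(a, b). {a <.. b::real})"
  have sets: "sets borel = sigma_sets UNIV ?G" by (subst borel_sigma_sets_Ioc) (simp add: sets_measure_of)
  have "Int_stable ?G" by (auto simp: Int_stable_def)
  moreover have "?G \<subseteq> Pow UNIV" by simp
  moreover have "B \<in> sigma_sets UNIV ?G" using assms by (simp add: sets)
  ultimately show ?thesis
  proof (induction rule: sigma_sets_induct_disjoint)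
    case (basic A)
    then obtain a b where A: "A = {a<..b}" by auto
    show ?case
    proof (cases "a \<le> b")
      case True
      have "indicator A = step_function [(1, a, b)]" by (auto simp: A)
      thus ?thesis using True by (intro step_approximable_of_sequence[where S="\<lambda>n. [(1, a, b)]"])
          (auto simp: step_lists_Cons sqdist_def)
    next
      case False
      have "indicator A = step_function []" using False by (auto simp: A)
      thus ?thesis using False by (intro step_approximable_of_sequence[where S="\<lambda>n. []"])
          (auto simp: step_lists_Cons sqdist_def)
    qed
  next
    case empty
    have "indicator {} = step_function []" by auto
    thus ?case by (intro step_approximable_of_sequence[where S="\<lambda>n. []"]) (auto simp: sqdist_def)
  next
    case (compl A)
    hence A: "A \<in> sets borel" by (simp add: sets)
    have "indicator (UNIV - A) = (\<lambda>t. 1 * indicator UNIV t + (-1) * (indicator A t :: complex))"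
      by (auto simp: indicator_def)
    moreover have "step_approximable I (\<lambda>t. 1 * indicator UNIV t + (-1) * (indicator A t :: complex))"
      by (rule step_approximable_linear) (use compl A step_approximable_indicator_UNIV in auto)
    ultimately show ?case by simp
  next
    case (union A)
    have A: "A i \<in> sets borel" for i using union(2) by (auto simp: sets)
    have part: "step_approximable I (indicator (\<Union>i<k. A i))" for k
    proof (induction k)
      case 0
      have "indicator {} = step_function []" by auto
      thus ?case by (intro step_approximable_of_sequence[where S="\<lambda>n. []"]) (auto simp: sqdist_def)
    next
      case (Suc k)
      have "A i \<inter> A k = {}" if "i < k" for i using union(1) that by (simp add: disjoint_family_on_def)
      hence "(\<Union>i<k. A i) \<inter> A k = {}" by blast
      hence "indicator (\<Union>i<Suc k. A i) = (\<lambda>t. 1 * indicator (\<Union>i<k. A i) t + 1 * (indicator (A k) t :: complex))"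
        by (intro ext) (auto simp: lessThan_Suc indicator_def of_bool_def)
      moreover have "step_approximable I (\<lambda>t. 1 * indicator (\<Union>i<k. A i) t + 1 * (indicator (A k) t :: complex))"
      proof (rule step_approximable_linear)
        show "step_approximable I (indicator (A k))" using union(3)[of k] A[of k] by (simp add: sets)
      qed (use Suc A in auto)
      ultimately show ?case by (simp only:)
    qed
    show ?case
    proof (rule step_approximable_limit[OF _ _ part])
      fix \<mu> assume mu: "\<mu> \<in> I"
      show "(\<lambda>k. sqdist \<mu> (indicator (\<Union>i. A i)) (indicator (\<Union>i<k. A i))) \<longlonglongrightarrow> 0"
      proof (rule sqdist_bounded_limit[OF mu, where M=1])
        show "cmod (indicator (\<Union>i. A i) t - indicator (\<Union>i<k. A i) t) \<le> 1" for k t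
          by (auto simp: indicator_def)
        show "(\<lambda>k. indicator (\<Union>i<k. A i) t) \<longlonglongrightarrow> (indicator (\<Union>i. A i) t :: complex)" for t
          by (rule LIMSEQ_indicator_UN)
      qed (use A in auto)
    qed (use A in auto)
  qed
qed

lemma step_approximable_simple:
  assumes "simple_function borel s" shows "step_approximable I s"
proof -
  have fin: "finite (range s)" using assms by (simp add: simple_function_def)
  have vB: "s -` {c} \<in> sets borel" for c using assms by (simp add: simple_function_def) (metis (no_types, lifting) Int_UNIV_right empty_iff rangeI sets.empty_sets vimage_singleton_eq subsetI subset_empty)
  have "step_approximable I (\<lambda>t. \<Sum>c\<in>C. c * indicator (s -` {c}) t)" if "finite C" for C
    using that
  proof (induction C)
    case empty
    have "(\<lambda>t. 0) = step_function []" by auto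
    thus ?case by (intro step_approximable_of_sequence[where S="\<lambda>n. []"]) (auto simp: sqdist_def)
  next
    case (insert c C)
    have "step_approximable I (\<lambda>t. c * indicator (s -` {c}) t + 1 * (\<Sum>c\<in>C. c * indicator (s -` {c}) t))"
    proof (rule step_approximable_linear)
      show "(\<lambda>t. \<Sum>c\<in>C. c * indicator (s -` {c}) t) \<in> borel_measurable borel"
        by (intro borel_measurable_sum borel_measurable_times borel_measurable_indicator vB) auto
    qed (use insert vB step_approximable_indicator in auto)
    moreover have "(\<lambda>t. \<Sum>c\<in>insert c C. c * indicator (s -` {c}) t)
      = (\<lambda>t. c * indicator (s -` {c}) t + 1 * (\<Sum>c\<in>C. c * indicator (s -` {c}) t))"
      by (rule ext) (subst sum.insert[OF insert(1,2)], simp only: mult_1)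
    ultimately show ?case by (simp only:)
  qed
  from this[OF fin] have "step_approximable I (\<lambda>t. \<Sum>c\<in>range s. c * indicator (s -` {c}) t)" .
  moreover have "(\<lambda>t. \<Sum>c\<in>range s. c * indicator (s -` {c}) t) = s"
  proof
    fix t
    have "(\<Sum>c\<in>range s. c * indicator (s -` {c}) t) = (\<Sum>c\<in>range s. if c = s t then c else 0)"
      by (intro sum.cong) (auto simp: indicator_def)
    thus "(\<Sum>c\<in>range s. c * indicator (s -` {c}) t) = s t" using fin by simp
  qed
  ultimately show ?thesis by simp
qed

text \<open>Simple functions bounded by a multiple of \<open>\<bar>f\<bar>\<close> converge to \<open>f\<close> pointwise, hence in \<open>L\<^sup>2\<close> by
  dominated convergence.\<close>

theorem step_approximable_square_integrable:
  assumes f: "f \<in> borel_measurable borel"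
    and L2: "\<And>\<mu>. \<mu> \<in> I \<Longrightarrow> (\<integral>\<^sup>+t. ennreal ((cmod (f t))\<^sup>2) \<partial>\<mu>) < \<infinity>"
  shows "step_approximable I f"
proof -
  obtain s where s: "\<And>i. simple_function borel (s i)" "\<And>t. (\<lambda>i. s i t) \<longlonglongrightarrow> f t"
    "\<And>i t. dist (s i t) 0 \<le> 2 * dist (f t) 0"
    using borel_measurable_implies_sequence_metric[OF f, of 0] by auto
  show ?thesis
  proof (rule step_approximable_limit[OF f _ step_approximable_simple[OF s(1)]])
    fix \<mu> assume mu: "\<mu> \<in> I"
    note sets_I[OF mu, measurable_cong] f[measurable]
    show "(\<lambda>n. sqdist \<mu> f (s n)) \<longlonglongrightarrow> 0"
    proof (rule sqdist_dominated[OF mu f _ _ _ _ s(2)])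
      show "(\<integral>\<^sup>+t. ennreal 9 * ennreal ((cmod (f t))\<^sup>2) \<partial>\<mu>) < \<infinity>"
        using L2[OF mu] by (subst nn_integral_cmult) (auto simp: ennreal_mult_less_top)
      fix n t
      have "cmod (f t - s n t) \<le> 3 * cmod (f t)" using s(3)[of n t] norm_triangle_ineq4[of "f t" "s n t"] by simp
      hence "(cmod (f t - s n t))\<^sup>2 \<le> (3 * cmod (f t))\<^sup>2" by (intro power_mono) auto
      hence "(cmod (f t - s n t))\<^sup>2 \<le> 9 * (cmod (f t))\<^sup>2" by (simp add: power_mult_distrib)
      thus "ennreal ((cmod (f t - s n t))\<^sup>2) \<le> ennreal 9 * ennreal ((cmod (f t))\<^sup>2)"
        by (simp flip: ennreal_mult' add: ennreal_leI del: ennreal_numeral)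
    qed (use s(1) in \<open>auto intro: borel_measurable_simple_function\<close>)
  qed (use s(1) in \<open>auto intro: borel_measurable_simple_function\<close>)
qed

end

section \<open>Integration against a spectral family\<close>

lemma measurable_cnj: "f \<in> borel_measurable borel \<Longrightarrow> (\<lambda>t. cnj (f t)) \<in> borel_measurable borel"
  by (rule measurable_compose[OF _ borel_measurable_continuous_onI]) (auto intro: continuous_intros)

text \<open>Truncation replaces large values of \<open>f\<close> by \<open>0\<close>, so that its square increases to that of \<open>f\<close>.\<close>

definition truncate :: "(real \<Rightarrow> complex) \<Rightarrow> nat \<Rightarrow> real \<Rightarrow> complex"
  where "truncate f n t = (if cmod (f t) \<le> real n then f t else 0)"

lemma measurable_truncate:
  assumes [measurable]: "f \<in> borel_measurable borel" shows "truncate f n \<in> borel_measurable borel"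
  unfolding truncate_def[abs_def] by measurable

lemma truncate_bound: "cmod (truncate f n t) \<le> real n"
  by (simp add: truncate_def)

lemma sqdist_truncate_le: "sqdist \<mu> (truncate f n) (\<lambda>_. 0) \<le> sqdist \<mu> f (\<lambda>_. 0)"
  unfolding sqdist_def by (intro nn_integral_mono ennreal_leI) (auto simp: truncate_def)

lemma step_function_bounded: "\<exists>B. \<forall>t. cmod (step_function S t) \<le> B"
proof (induction S)
  case (Cons p S)
  obtain c a b where p: "p = (c, a, b)" by (cases p)
  obtain B where B: "\<And>t. cmod (step_function S t) \<le> B" using Cons by blast
  have "cmod (step_function (p # S) t) \<le> cmod c + B" for t
    using norm_triangle_ineq[of "c * indicator {a<..b} t" "step_function S t"] B[of t]
    by (cases "t \<in> {a<..b}") (auto simp: p intro: add_increasing)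
  thus ?case by blast
qed (auto intro: exI[of _ 0])

lemma tendsto_zero_of_norm_square:
  fixes u :: "nat \<Rightarrow> 'a::real_normed_vector"
  assumes "(\<lambda>n. ennreal ((norm (u n))\<^sup>2)) \<longlonglongrightarrow> 0" shows "u \<longlonglongrightarrow> 0"
proof (rule tendsto_norm_zero_cancel)
  have "(\<lambda>n. (norm (u n))\<^sup>2) \<longlonglongrightarrow> 0" using assms by (simp add: ennreal_tendsto_0_iff)
  from tendsto_real_sqrt[OF this] show "(\<lambda>n. norm (u n)) \<longlonglongrightarrow> 0" by simp
qed

lemma step_integral_Nil [simp]: "step_integral E [] x = 0"
  by (simp add: step_integral_def)

lemma step_integral_Cons [simp]:
  "step_integral E ((c, a, b) # S) x = c *\<^sub>C (E b x - E a x) + step_integral E S x"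
  by (simp add: step_integral_def)

lemma step_integral_append: "step_integral E (S @ S') x = step_integral E S x + step_integral E S' x"
  by (simp add: step_integral_def)

lemma step_integral_scale: "step_integral E (map_coeff (\<lambda>c. d * c) S) x = d *\<^sub>C step_integral E S x"
  by (induction S) (auto simp: map_coeff_def scaleC_add_right scaleC_scaleC)

lemma orthogonal_projectionD:
  assumes "orthogonal_projection P"
  shows "P (x + y) = P x + P y" "P (a *\<^sub>C x) = a *\<^sub>C P x" "P (P x) = P x" "cinner (P x) y = cinner x (P y)"
  using assms by (auto simp: orthogonal_projection_def)

lemma orthogonal_projection_zero: "orthogonal_projection P \<Longrightarrow> P 0 = 0"
  using orthogonal_projectionD(2)[of P 0 0] by simp

lemma orthogonal_projection_diff: "orthogonal_projection P \<Longrightarrow> P (x - y) = P x - P y"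
  using orthogonal_projectionD(1)[of P x "-1 *\<^sub>C y"] orthogonal_projectionD(2)[of P "-1" y]
  by (simp add: scaleC_minus_left)

lemma orthogonal_projection_scaleR: "orthogonal_projection P \<Longrightarrow> P (r *\<^sub>R x) = r *\<^sub>R P x"
  by (simp add: scaleR_scaleC orthogonal_projectionD)

lemma orthogonal_projection_inner: "orthogonal_projection P \<Longrightarrow> inner (P x) y = inner x (P y)"
  by (simp add: inner_eq_Re_cinner orthogonal_projectionD)

lemma orthogonal_projection_norm_square:
  assumes "orthogonal_projection P" shows "(norm (P x))\<^sup>2 = inner x (P x)"
  using assms orthogonal_projection_inner[OF assms, of x "P x"]
  by (simp add: power2_norm_eq_inner orthogonal_projectionD)

lemma orthogonal_projection_norm_le:
  assumes "orthogonal_projection P" shows "norm (P x) \<le> norm x"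
proof -
  have "norm (P x) * norm (P x) \<le> norm x * norm (P x)"
    using orthogonal_projection_norm_square[OF assms, of x] norm_cauchy_schwarz[of x "P x"]
    by (simp add: power2_eq_square)
  thus ?thesis by (cases "norm (P x) = 0") (simp_all add: mult_le_cancel_right)
qed

lemma orthogonal_projection_bounded_linear:
  assumes "orthogonal_projection P" shows "bounded_linear P"
  by (rule bounded_linear_intro[where K=1])
    (use assms in \<open>simp_all add: orthogonal_projectionD orthogonal_projection_scaleR orthogonal_projection_norm_le\<close>)

context
  fixes E :: "real \<Rightarrow> 'a::chilbert_space \<Rightarrow> 'a"
  assumes E: "spectral_family E"
begin

lemma spectral_family_projection: "orthogonal_projection (E t)"
  using E by (simp add: spectral_family_def)

lemma spectral_family_min: "E s (E t x) = E (min s t) x"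
  using E by (simp add: spectral_family_def)

lemma spectral_family_norm_mono: "s \<le> t \<Longrightarrow> norm (E s x) \<le> norm (E t x)"
  using orthogonal_projection_norm_le[OF spectral_family_projection, of s "E t x"]
  by (simp add: spectral_family_min)

lemma spectral_family_cinner:
  "cinner (E s x) (E t x) = complex_of_real ((norm (E (min s t) x))\<^sup>2)"
proof -
  have "cinner (E s x) (E t x) = cinner x (E (min s t) (E (min s t) x))"
    by (simp add: orthogonal_projectionD(4)[OF spectral_family_projection] spectral_family_min)
  thus ?thesis
    by (simp add: orthogonal_projectionD(4)[OF spectral_family_projection, symmetric] cinner_self)
qed

lemma spectral_measure:
  shows sets_spectral_measure: "sets (spectral_measure_at E x) = sets borel"
    and finite_spectral_measure: "finite_measure (spectral_measure_at E x)"
    and emeasure_spectral_measure_UNIV: "emeasure (spectral_measure_at E x) UNIV = ennreal ((norm x)\<^sup>2)"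
    and measure_spectral_measure_Ioc:
      "a \<le> b \<Longrightarrow> measure (spectral_measure_at E x) {a<..b} = (norm (E b x))\<^sup>2 - (norm (E a x))\<^sup>2"
proof -
  have mono: "(norm (E s x))\<^sup>2 \<le> (norm (E t x))\<^sup>2" if "s \<le> t" for s t
    using spectral_family_norm_mono[OF that] by (simp add: power_mono)
  have rc: "continuous (at_right t) (\<lambda>t. (norm (E t x))\<^sup>2)" for t
    unfolding continuous_within using E by (auto simp: spectral_family_def intro!: tendsto_intros)
  have bot: "((\<lambda>t. (norm (E t x))\<^sup>2) \<longlongrightarrow> 0) at_bot"
    using tendsto_power[OF tendsto_norm, of "\<lambda>t. E t x" 0 at_bot 2] E by (auto simp: spectral_family_def)
  have top: "((\<lambda>t. (norm (E t x))\<^sup>2) \<longlongrightarrow> (norm x)\<^sup>2) at_top"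
    using E by (auto simp: spectral_family_def intro!: tendsto_intros)
  show "sets (spectral_measure_at E x) = sets borel" by (simp add: spectral_measure_at_def)
  show "emeasure (spectral_measure_at E x) UNIV = ennreal ((norm x)\<^sup>2)"
    unfolding spectral_measure_at_def by (rule interval_measure_UNIV[OF mono rc bot top]) auto
  show "finite_measure (spectral_measure_at E x)"
    using finite_borel_measure_interval_measure[OF mono rc bot top] unfolding spectral_measure_at_def
    by (simp add: finite_borel_measure_def)
  show "measure (spectral_measure_at E x) {a<..b} = (norm (E b x))\<^sup>2 - (norm (E a x))\<^sup>2" if "a \<le> b"
    unfolding spectral_measure_at_def by (rule measure_interval_measure_Ioc[OF that mono rc])
qed

lemma measurable_spectral_measure: "f \<in> borel_measurable borel \<Longrightarrow> f \<in> borel_measurable (spectral_measure_at E x)"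
  using measurable_cong_sets[OF sets_spectral_measure refl] by blast

lemma space_spectral_measure [simp]: "space (spectral_measure_at E x) = UNIV"
  by (simp add: spectral_measure_at_def)

text \<open>Increments of the spectral family over disjoint intervals are orthogonal. This identity is the source
  of the isometry between step functions in \<open>L\<^sup>2\<close> and their spectral integrals.\<close>

lemma cinner_spectral_increments:
  assumes "a \<le> b" "a' \<le> b'"
  shows "cinner (E b x - E a x) (E b' x - E a' x)
    = complex_of_real (measure (spectral_measure_at E x) ({a<..b} \<inter> {a'<..b'}))"
proof -
  have "measure (spectral_measure_at E x) ({a<..b} \<inter> {a'<..b'})
     = (norm (E (min b b') x))\<^sup>2 - (norm (E (min b a') x))\<^sup>2
       - (norm (E (min a b') x))\<^sup>2 + (norm (E (min a a') x))\<^sup>2"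
  proof (cases "max a a' \<le> min b b'")
    case True
    have "{a<..b} \<inter> {a'<..b'} = {max a a'<..min b b'}" by auto
    moreover have "min b a' = a'" "min a b' = a" using True assms by auto
    ultimately show ?thesis using True
      by (cases "a \<le> a'") (simp_all add: measure_spectral_measure_Ioc min_absorb1 min_absorb2 max_absorb1 max_absorb2)
  next
    case False
    hence "{a<..b} \<inter> {a'<..b'} = {}" by auto
    thus ?thesis using False assms by (auto simp add: min_def max_def)
  qed
  thus ?thesis by (simp add: cinner_diff_left cinner_diff_right spectral_family_cinner)
qed

lemma integrable_step_function_product:
  "integrable (spectral_measure_at E x) (\<lambda>t. cnj (step_function S t) * step_function S' t)"
proof -
  obtain B B' where B: "\<And>t. cmod (step_function S t) \<le> B" "\<And>t. cmod (step_function S' t) \<le> B'"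
    using step_function_bounded by metis
  show ?thesis
  proof (rule finite_measure.integrable_const_bound[OF finite_spectral_measure])
    show "AE t in spectral_measure_at E x. norm (cnj (step_function S t) * step_function S' t) \<le> B * B'"
      using B order_trans[OF norm_ge_zero B(1)] by (intro AE_I2) (auto simp: norm_mult intro!: mult_mono)
    show "(\<lambda>t. cnj (step_function S t) * step_function S' t) \<in> borel_measurable (spectral_measure_at E x)"
      by (intro measurable_spectral_measure borel_measurable_times measurable_cnj
          measurable_step_function)
  qed
qed

lemma cinner_step_integral:
  assumes "S \<in> step_lists" "S' \<in> step_lists"
  shows "cinner (step_integral E S x) (step_integral E S' x)
    = (\<integral>t. cnj (step_function S t) * step_function S' t \<partial>spectral_measure_at E x)"
proof -
  let ?\<mu> = "spectral_measure_at E x"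
  note sets_spectral_measure[measurable_cong]
  have single: "cinner (c *\<^sub>C (E b x - E a x)) (step_integral E S' x)
    = (\<integral>t. cnj (c * indicator {a<..b} t) * step_function S' t \<partial>?\<mu>)"
    if "a \<le> b" "S' \<in> step_lists" for c a b S'
    using that(2)
  proof (induction S')
    case (Cons p S')
    obtain c' a' b' where p: "p = (c', a', b')" by (cases p)
    have le: "a' \<le> b'" and S': "S' \<in> step_lists" using Cons.prems by (auto simp: p step_lists_Cons)
    let ?I = "{a<..b} \<inter> {a'<..b'}"
    have ind: "integrable ?\<mu> (\<lambda>t. (cnj c * c') * complex_of_real (indicator ?I t))"
      using finite_measure.emeasure_finite[OF finite_spectral_measure, of x ?I]
      by (intro integrable_mult_right integrable_of_real integrable_real_indicator) (auto simp: less_top)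
    have rest: "integrable ?\<mu> (\<lambda>t. cnj (c * indicator {a<..b} t) * step_function S' t)"
      using integrable_step_function_product[of x "[(c, a, b)]" S'] by simp
    have "cinner (c *\<^sub>C (E b x - E a x)) (step_integral E (p # S') x)
        = (cnj c * c') * complex_of_real (measure ?\<mu> ?I)
          + (\<integral>t. cnj (c * indicator {a<..b} t) * step_function S' t \<partial>?\<mu>)"
      unfolding Cons.IH[OF S', symmetric] p step_integral_Cons cinner_add_right
      by (simp add: cinner_scaleC_left cinner_scaleC_right cinner_spectral_increments[OF that(1) le])
    also have "complex_of_real (measure ?\<mu> ?I) = (\<integral>t. complex_of_real (indicator ?I t) \<partial>?\<mu>)"
      by simp
    also have "(cnj c * c') * \<dots> = (\<integral>t. (cnj c * c') * complex_of_real (indicator ?I t) \<partial>?\<mu>)"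
      by (rule integral_mult_right_zero[symmetric])
    also have "\<dots> + (\<integral>t. cnj (c * indicator {a<..b} t) * step_function S' t \<partial>?\<mu>)
        = (\<integral>t. (cnj c * c') * complex_of_real (indicator ?I t)
              + cnj (c * indicator {a<..b} t) * step_function S' t \<partial>?\<mu>)"
      by (rule Bochner_Integration.integral_add[symmetric, OF ind rest])
    also have "\<dots> = (\<integral>t. cnj (c * indicator {a<..b} t) * step_function (p # S') t \<partial>?\<mu>)"
      by (intro Bochner_Integration.integral_cong) (auto simp: p indicator_def algebra_simps)
    finally show ?case .
  qed simp
  show ?thesis using assms(1)
  proof (induction S)
    case (Cons p S)
    obtain c a b where p: "p = (c, a, b)" by (cases p)
    have le: "a \<le> b" and S: "S \<in> step_lists" using Cons.prems by (auto simp: p step_lists_Cons)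
    have "cinner (step_integral E (p # S) x) (step_integral E S' x)
      = (\<integral>t. cnj (c * indicator {a<..b} t) * step_function S' t \<partial>?\<mu>)
        + (\<integral>t. cnj (step_function S t) * step_function S' t \<partial>?\<mu>)"
      by (simp add: p cinner_add_left Cons.IH[OF S] single[OF le assms(2)])
    also have "\<dots> = (\<integral>t. cnj (c * indicator {a<..b} t) * step_function S' t
        + cnj (step_function S t) * step_function S' t \<partial>?\<mu>)"
      using integrable_step_function_product[of x "[(c, a, b)]" S'] integrable_step_function_product[of x S S']
      by (intro Bochner_Integration.integral_add[symmetric]) simp_all
    also have "\<dots> = (\<integral>t. cnj (step_function (p # S) t) * step_function S' t \<partial>?\<mu>)"
      by (intro Bochner_Integration.integral_cong) (auto simp: p algebra_simps)
    finally show ?case .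
  qed simp
qed

lemma norm_step_integral:
  assumes "S \<in> step_lists"
  shows "ennreal ((norm (step_integral E S x))\<^sup>2) = sqdist (spectral_measure_at E x) (step_function S) (\<lambda>_. 0)"
proof -
  let ?\<mu> = "spectral_measure_at E x"
  have eq: "cnj (step_function S t) * step_function S t = complex_of_real ((cmod (step_function S t))\<^sup>2)" for t
    by (metis complex_norm_square mult.commute)
  have "integrable ?\<mu> (\<lambda>t. complex_of_real ((cmod (step_function S t))\<^sup>2))"
    using integrable_step_function_product[of x S S] by (simp only: eq)
  hence int: "integrable ?\<mu> (\<lambda>t. (cmod (step_function S t))\<^sup>2)"
    by (simp only: complex_of_real_integrable_eq)
  have "complex_of_real ((norm (step_integral E S x))\<^sup>2) = complex_of_real (\<integral>t. (cmod (step_function S t))\<^sup>2 \<partial>?\<mu>)"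
    by (simp only: cinner_self[of "step_integral E S x", symmetric] cinner_step_integral[OF assms assms] eq integral_complex_of_real)
  hence "(norm (step_integral E S x))\<^sup>2 = (\<integral>t. (cmod (step_function S t))\<^sup>2 \<partial>?\<mu>)"
    by (simp only: of_real_eq_iff)
  thus ?thesis unfolding sqdist_def by (simp add: nn_integral_eq_integral[OF int])
qed

lemma norm_step_integral_diff:
  assumes "S \<in> step_lists" "S' \<in> step_lists"
  shows "ennreal ((norm (step_integral E S x - step_integral E S' x))\<^sup>2)
    = sqdist (spectral_measure_at E x) (step_function S) (step_function S')"
proof -
  let ?U = "S @ map_coeff (\<lambda>c. (-1) * c) S'"
  have "step_integral E ?U x = step_integral E S x - step_integral E S' x"
    by (simp only: step_integral_append step_integral_scale scaleC_minus_left scaleC_one) simp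
  moreover have "step_function ?U t = step_function S t - step_function S' t" for t
    by (simp only: step_function_append step_function_scale) simp
  moreover have "?U \<in> step_lists" by (intro step_lists_append step_lists_map_coeff assms)
  ultimately show ?thesis using norm_step_integral[of ?U x] by (simp add: sqdist_def)
qed

lemma step_integral_vector_linear:
  "step_integral E S (a *\<^sub>C x + b *\<^sub>C y) = a *\<^sub>C step_integral E S x + b *\<^sub>C step_integral E S y"
proof (induction S)
  case (Cons p S)
  obtain c s t where p: "p = (c, s, t)" by (cases p)
  have "E r (a *\<^sub>C x + b *\<^sub>C y) = a *\<^sub>C E r x + b *\<^sub>C E r y" for r
    by (simp add: orthogonal_projectionD[OF spectral_family_projection])
  thus ?case
    by (simp add: p Cons scaleC_add_right scaleC_diff_right scaleC_scaleC mult.commute algebra_simps)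
qed simp

lemma step_integral_adjoint: "cinner y (step_integral E S x) = cinner (step_integral E (map_coeff cnj S) y) x"
proof (induction S)
  case (Cons p S)
  thus ?case
    by (cases p) (simp add: map_coeff_def cinner_add_left cinner_add_right cinner_scaleC_left cinner_scaleC_right
        cinner_diff_left cinner_diff_right orthogonal_projectionD(4)[OF spectral_family_projection])
qed (simp add: map_coeff_def)

definition square_integrable_at :: "(real \<Rightarrow> complex) \<Rightarrow> 'a \<Rightarrow> bool"
  where "square_integrable_at f x \<longleftrightarrow> sqdist (spectral_measure_at E x) f (\<lambda>_. 0) < \<infinity>"

lemma dom_spectral_integral: "x \<in> dom (spectral_integral E f) \<longleftrightarrow> square_integrable_at f x"
  by (auto simp: spectral_integral_def square_integrable_at_def sqdist_def dom_def)

lemma step_integrals_converge: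
  assumes f: "f \<in> borel_measurable borel" and S: "\<And>n. S n \<in> step_lists"
    and lim: "(\<lambda>n. sqdist (spectral_measure_at E x) f (step_function (S n))) \<longlonglongrightarrow> 0"
  shows "convergent (\<lambda>n. step_integral E (S n) x)"
proof (rule Cauchy_convergent, rule metric_CauchyI)
  fix e :: real assume e: "e > 0"
  let ?d = "\<lambda>n. sqdist (spectral_measure_at E x) f (step_function (S n))"
  have "\<forall>\<^sub>F n in sequentially. ?d n < ennreal (e\<^sup>2/4)"
    by (rule order_tendstoD(2)[OF lim]) (use e in simp)
  then obtain N where N: "\<And>n. n \<ge> N \<Longrightarrow> ?d n < ennreal (e\<^sup>2/4)" by (auto simp: eventually_sequentially)
  show "\<exists>N. \<forall>m\<ge>N. \<forall>n\<ge>N. dist (step_integral E (S m) x) (step_integral E (S n) x) < e"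
  proof (intro exI allI impI)
    fix m n assume mn: "m \<ge> N" "n \<ge> N"
    have "ennreal ((norm (step_integral E (S m) x - step_integral E (S n) x))\<^sup>2) \<le> 2 * ?d m + 2 * ?d n"
      unfolding norm_step_integral_diff[OF S S]
      using sqdist_triangle[OF sets_spectral_measure measurable_step_function f measurable_step_function,
          of x "S m" "S n"] by (simp add: sqdist_commute)
    also have "\<dots> < 2 * ennreal (e\<^sup>2/4) + 2 * ennreal (e\<^sup>2/4)"
      by (intro add_strict_mono ennreal_mult_strict_left_mono N mn) auto
    also have "\<dots> = ennreal (e\<^sup>2)"
      using e by (simp flip: ennreal_plus ennreal_numeral ennreal_mult')
    finally have "(norm (step_integral E (S m) x - step_integral E (S n) x))\<^sup>2 < e\<^sup>2"
      using e by (simp add: ennreal_less_iff)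
    thus "dist (step_integral E (S m) x) (step_integral E (S n) x) < e"
      using e by (simp add: dist_norm power_less_imp_less_base)
  qed
qed

text \<open>By the isometry on step functions, the integrals of two sequences with the same \<open>L\<^sup>2\<close> limit have
  vanishing difference. This makes the definite description in the spectral integral meaningful.\<close>

lemma has_spectral_integral_unique_limit:
  assumes f: "f \<in> borel_measurable borel" and z: "has_spectral_integral E f x z"
    and S: "\<And>n. S n \<in> step_lists"
    and lim: "(\<lambda>n. sqdist (spectral_measure_at E x) f (step_function (S n))) \<longlonglongrightarrow> 0"
  shows "(\<lambda>n. step_integral E (S n) x) \<longlonglongrightarrow> z"
proof -
  let ?d = "\<lambda>S. sqdist (spectral_measure_at E x) f (step_function S)"
  obtain S' where S': "\<And>n. S' n \<in> step_lists" "(\<lambda>n. ?d (S' n)) \<longlonglongrightarrow> 0" "(\<lambda>n. step_integral E (S' n) x) \<longlonglongrightarrow> z"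
    using z unfolding has_spectral_integral_def sqdist_def by blast
  have "(\<lambda>n. step_integral E (S n) x - step_integral E (S' n) x) \<longlonglongrightarrow> 0"
  proof (rule tendsto_zero_of_norm_square, rule tendsto_sandwich[OF _ _ tendsto_const])
    show "(\<lambda>n. 2 * ?d (S n) + 2 * ?d (S' n)) \<longlonglongrightarrow> 0"
      using tendsto_add[OF ennreal_tendsto_cmult[OF _ lim, of 2] ennreal_tendsto_cmult[OF _ S'(2), of 2]] by simp
    show "\<forall>\<^sub>F n in sequentially. ennreal ((norm (step_integral E (S n) x - step_integral E (S' n) x))\<^sup>2)
        \<le> 2 * ?d (S n) + 2 * ?d (S' n)"
      unfolding norm_step_integral_diff[OF S S'(1)]
      using sqdist_triangle[OF sets_spectral_measure measurable_step_function f measurable_step_function]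
      by (intro always_eventually allI) (simp add: sqdist_commute[of _ f])
  qed simp
  from tendsto_add[OF this S'(3)] show ?thesis by simp
qed

text \<open>With one sequence of step functions for several vectors, linear relations pass from step integrals,
  where they are evident, to the spectral integral.\<close>

lemma common_step_sequence:
  assumes f: "f \<in> borel_measurable borel" and X: "finite X" "\<And>x. x \<in> X \<Longrightarrow> square_integrable_at f x"
  obtains S where "\<And>n::nat. S n \<in> step_lists"
    "\<And>x. x \<in> X \<Longrightarrow> (\<lambda>n. sqdist (spectral_measure_at E x) f (step_function (S n))) \<longlonglongrightarrow> 0"
    "\<And>x. x \<in> X \<Longrightarrow> (\<lambda>n. step_integral E (S n) x) \<longlonglongrightarrow> spectral_integral E f \<bullet>\<^sub>o x"
proof -
  let ?I = "spectral_measure_at E ` X"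
  have app: "step_approximable ?I f"
    by (rule step_approximable_square_integrable)
      (use X f in \<open>auto simp: sets_spectral_measure finite_spectral_measure square_integrable_at_def sqdist_def\<close>)
  have "finite ?I" "\<And>\<mu>. \<mu> \<in> ?I \<Longrightarrow> finite_measure \<mu>" "\<And>\<mu>. \<mu> \<in> ?I \<Longrightarrow> sets \<mu> = sets borel"
    using X(1) sets_spectral_measure finite_spectral_measure by auto
  from step_approximable_sequence[OF this app]
  obtain S where S: "\<And>n::nat. S n \<in> step_lists"
    "\<And>\<mu>. \<mu> \<in> ?I \<Longrightarrow> (\<lambda>n. sqdist \<mu> f (step_function (S n))) \<longlonglongrightarrow> 0"
    by blast
  have lim: "(\<lambda>n. sqdist (spectral_measure_at E x) f (step_function (S n))) \<longlonglongrightarrow> 0" if "x \<in> X" for x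
    using S(2) that by blast
  have "(\<lambda>n. step_integral E (S n) x) \<longlonglongrightarrow> spectral_integral E f \<bullet>\<^sub>o x" if x: "x \<in> X" for x
  proof -
    obtain z where z: "(\<lambda>n. step_integral E (S n) x) \<longlonglongrightarrow> z"
      using step_integrals_converge[OF f S(1) lim[OF x]] by (auto simp: convergent_def)
    have has: "has_spectral_integral E f x z"
      unfolding has_spectral_integral_def using S(1) lim[OF x] z by (auto simp: sqdist_def intro!: exI[of _ S])
    have "(THE z. has_spectral_integral E f x z) = z"
    proof (rule the_equality[of "has_spectral_integral E f x", OF has])
      fix w assume "has_spectral_integral E f x w"
      from has_spectral_integral_unique_limit[OF f this S(1) lim[OF x]] z show "w = z"
        by (rule LIMSEQ_unique)
    qed
    thus ?thesis using z X(2)[OF x]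
      by (simp add: spectral_integral_def app_def square_integrable_at_def sqdist_def)
  qed
  with S(1) lim show thesis by (rule that)
qed

lemma spectral_integral_limit:
  assumes f: "f \<in> borel_measurable borel" and x: "square_integrable_at f x" and S: "\<And>n. S n \<in> step_lists"
    and lim: "(\<lambda>n. sqdist (spectral_measure_at E x) f (step_function (S n))) \<longlonglongrightarrow> 0"
  shows "(\<lambda>n. step_integral E (S n) x) \<longlonglongrightarrow> spectral_integral E f \<bullet>\<^sub>o x"
proof -
  obtain S' where S': "\<And>n::nat. S' n \<in> step_lists"
    "(\<lambda>n. sqdist (spectral_measure_at E x) f (step_function (S' n))) \<longlonglongrightarrow> 0"
    "(\<lambda>n. step_integral E (S' n) x) \<longlonglongrightarrow> spectral_integral E f \<bullet>\<^sub>o x"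
    using common_step_sequence[OF f, of "{x}"] x by auto
  hence "has_spectral_integral E f x (spectral_integral E f \<bullet>\<^sub>o x)"
    by (auto simp: has_spectral_integral_def sqdist_def)
  from has_spectral_integral_unique_limit[OF f this S lim] show ?thesis .
qed

text \<open>The integral is in fact isometric; two-sided bounds up to the factor \<open>2\<close> follow from the isometry
  on step functions by the crude triangle inequality for squared distances, and are as good for
  convergence and finiteness.\<close>

lemma spectral_integral_norm:
  assumes f: "f \<in> borel_measurable borel" and x: "square_integrable_at f x"
  shows "ennreal ((norm (spectral_integral E f \<bullet>\<^sub>o x))\<^sup>2) \<le> 2 * sqdist (spectral_measure_at E x) f (\<lambda>_. 0)"
    and "sqdist (spectral_measure_at E x) f (\<lambda>_. 0) \<le> 2 * ennreal ((norm (spectral_integral E f \<bullet>\<^sub>o x))\<^sup>2)"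
proof -
  let ?\<mu> = "spectral_measure_at E x" and ?N = "ennreal ((norm (spectral_integral E f \<bullet>\<^sub>o x))\<^sup>2)"
  obtain S where S: "\<And>n::nat. S n \<in> step_lists"
    "(\<lambda>n. sqdist ?\<mu> f (step_function (S n))) \<longlonglongrightarrow> 0"
    "(\<lambda>n. step_integral E (S n) x) \<longlonglongrightarrow> spectral_integral E f \<bullet>\<^sub>o x"
    using common_step_sequence[OF f, of "{x}"] x by auto
  have N: "(\<lambda>n. ennreal ((norm (step_integral E (S n) x))\<^sup>2)) \<longlonglongrightarrow> ?N"
    by (intro tendsto_intros S(3))
  show "?N \<le> 2 * sqdist ?\<mu> f (\<lambda>_. 0)"
  proof (rule tendsto_le[OF _ _ N])
    show "(\<lambda>n. 2 * sqdist ?\<mu> f (step_function (S n)) + 2 * sqdist ?\<mu> f (\<lambda>_. 0)) \<longlonglongrightarrow> 2 * sqdist ?\<mu> f (\<lambda>_. 0)"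
      using tendsto_add[OF ennreal_tendsto_cmult[OF _ S(2), of 2] tendsto_const] by simp
    show "\<forall>\<^sub>F n in sequentially. ennreal ((norm (step_integral E (S n) x))\<^sup>2)
        \<le> 2 * sqdist ?\<mu> f (step_function (S n)) + 2 * sqdist ?\<mu> f (\<lambda>_. 0)"
      unfolding norm_step_integral[OF S(1)]
      using sqdist_triangle[OF sets_spectral_measure measurable_step_function f, of "\<lambda>_. 0" x]
      by (simp add: sqdist_commute)
  qed simp
  show "sqdist ?\<mu> f (\<lambda>_. 0) \<le> 2 * ?N"
  proof (rule tendsto_le[OF _ _ tendsto_const])
    show "(\<lambda>n. 2 * sqdist ?\<mu> f (step_function (S n)) + 2 * ennreal ((norm (step_integral E (S n) x))\<^sup>2)) \<longlonglongrightarrow> 2 * ?N"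
      using tendsto_add[OF ennreal_tendsto_cmult[OF _ S(2), of 2] ennreal_tendsto_cmult[OF _ N, of 2]] by simp
    show "\<forall>\<^sub>F n in sequentially. sqdist ?\<mu> f (\<lambda>_. 0)
        \<le> 2 * sqdist ?\<mu> f (step_function (S n)) + 2 * ennreal ((norm (step_integral E (S n) x))\<^sup>2)"
      unfolding norm_step_integral[OF S(1)]
      using sqdist_triangle[OF sets_spectral_measure f measurable_step_function, of "\<lambda>_. 0" x]
      by simp
  qed simp
qed

lemma square_integrable_linear:
  assumes f: "f \<in> borel_measurable borel" and g: "g \<in> borel_measurable borel"
    and "square_integrable_at f x" "square_integrable_at g x"
  shows "square_integrable_at (\<lambda>t. a * f t + b * g t) x"
proof -
  let ?s = "\<lambda>f. sqdist (spectral_measure_at E x) f (\<lambda>_. 0)"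
  have "?s (\<lambda>t. a * f t + b * g t) \<le> 2 * (ennreal ((cmod a)\<^sup>2) * ?s f) + 2 * (ennreal ((cmod b)\<^sup>2) * ?s g)"
    using sqdist_linear[OF sets_spectral_measure f g, of "\<lambda>_. 0" "\<lambda>_. 0"] by simp
  also have "\<dots> < \<infinity>" using assms(3,4) by (simp add: square_integrable_at_def ennreal_mult_less_top)
  finally show ?thesis by (simp add: square_integrable_at_def)
qed

lemma spectral_integral_linear:
  assumes f: "f \<in> borel_measurable borel" and g: "g \<in> borel_measurable borel"
    and x: "square_integrable_at f x" "square_integrable_at g x"
  shows "spectral_integral E (\<lambda>t. a * f t + b * g t) \<bullet>\<^sub>o x
    = a *\<^sub>C (spectral_integral E f \<bullet>\<^sub>o x) + b *\<^sub>C (spectral_integral E g \<bullet>\<^sub>o x)"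
proof -
  let ?\<mu> = "spectral_measure_at E x"
  obtain S where S: "\<And>n::nat. S n \<in> step_lists" "(\<lambda>n. sqdist ?\<mu> f (step_function (S n))) \<longlonglongrightarrow> 0"
    "(\<lambda>n. step_integral E (S n) x) \<longlonglongrightarrow> spectral_integral E f \<bullet>\<^sub>o x"
    using common_step_sequence[OF f, of "{x}"] x by auto
  obtain S' where S': "\<And>n::nat. S' n \<in> step_lists" "(\<lambda>n. sqdist ?\<mu> g (step_function (S' n))) \<longlonglongrightarrow> 0"
    "(\<lambda>n. step_integral E (S' n) x) \<longlonglongrightarrow> spectral_integral E g \<bullet>\<^sub>o x"
    using common_step_sequence[OF g, of "{x}"] x by auto
  let ?U = "\<lambda>n. map_coeff (\<lambda>z. a * z) (S n) @ map_coeff (\<lambda>z. b * z) (S' n)"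
  have "(\<lambda>n. step_integral E (?U n) x) \<longlonglongrightarrow> spectral_integral E (\<lambda>t. a * f t + b * g t) \<bullet>\<^sub>o x"
    by (rule spectral_integral_limit[OF _ square_integrable_linear[OF f g x] _
          step_sequence_linear[OF sets_spectral_measure f g S(2) S'(2)]])
      (use f g S(1) S'(1) in \<open>auto intro!: step_lists_append step_lists_map_coeff\<close>)
  moreover have "(\<lambda>n. step_integral E (?U n) x) \<longlonglongrightarrow> a *\<^sub>C (spectral_integral E f \<bullet>\<^sub>o x) + b *\<^sub>C (spectral_integral E g \<bullet>\<^sub>o x)"
    unfolding step_integral_append step_integral_scale by (intro tendsto_add tendsto_scaleC S(3) S'(3))
  ultimately show ?thesis by (rule LIMSEQ_unique)
qed

lemma spectral_integral_diff_norm: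
  assumes f: "f \<in> borel_measurable borel" and g: "g \<in> borel_measurable borel"
    and x: "square_integrable_at f x" "square_integrable_at g x"
  shows "ennreal ((norm (spectral_integral E f \<bullet>\<^sub>o x - spectral_integral E g \<bullet>\<^sub>o x))\<^sup>2)
    \<le> 2 * sqdist (spectral_measure_at E x) f g"
proof -
  have "spectral_integral E (\<lambda>t. 1 * f t + (-1) * g t) \<bullet>\<^sub>o x = spectral_integral E f \<bullet>\<^sub>o x - spectral_integral E g \<bullet>\<^sub>o x"
    unfolding spectral_integral_linear[OF f g x] by (simp add: scaleC_minus_left)
  moreover have "sqdist (spectral_measure_at E x) (\<lambda>t. 1 * f t + (-1) * g t) (\<lambda>_. 0) = sqdist (spectral_measure_at E x) f g"
    by (simp add: sqdist_def)
  moreover have "(\<lambda>t. 1 * f t + (-1) * g t) \<in> borel_measurable borel" using f g by measurable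
  ultimately show ?thesis
    using spectral_integral_norm(1)[OF _ square_integrable_linear[OF f g x, of 1 "-1"]] by (simp only:)
qed

lemma sqdist_bounded:
  assumes "\<And>t. cmod (f t) \<le> M"
  shows "sqdist (spectral_measure_at E x) f (\<lambda>_. 0) \<le> ennreal (M\<^sup>2 * (norm x)\<^sup>2)"
proof -
  have "sqdist (spectral_measure_at E x) f (\<lambda>_. 0) \<le> (\<integral>\<^sup>+t. ennreal (M\<^sup>2) \<partial>spectral_measure_at E x)"
    unfolding sqdist_def using assms by (intro nn_integral_mono ennreal_leI power_mono) auto
  thus ?thesis by (simp add: emeasure_spectral_measure_UNIV ennreal_mult')
qed

lemma square_integrable_bounded:
  assumes "\<And>t. cmod (f t) \<le> M" shows "square_integrable_at f x"
  using le_less_trans[OF sqdist_bounded[OF assms] ennreal_less_top] by (simp add: square_integrable_at_def)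

lemma spectral_integral_bound:
  assumes f: "f \<in> borel_measurable borel" and M: "\<And>t. cmod (f t) \<le> M"
  shows "norm (spectral_integral E f \<bullet>\<^sub>o x) \<le> 2 * M * norm x"
proof -
  have M0: "0 \<le> M" using order_trans[OF norm_ge_zero M] .
  have "ennreal ((norm (spectral_integral E f \<bullet>\<^sub>o x))\<^sup>2) \<le> 2 * sqdist (spectral_measure_at E x) f (\<lambda>_. 0)"
    by (rule spectral_integral_norm(1)[OF f square_integrable_bounded[OF M]])
  also have "\<dots> \<le> 2 * ennreal (M\<^sup>2 * (norm x)\<^sup>2)" by (intro mult_left_mono sqdist_bounded M) simp
  also have "\<dots> = ennreal (2 * (M\<^sup>2 * (norm x)\<^sup>2))" by (simp add: ennreal_mult')
  finally have "(norm (spectral_integral E f \<bullet>\<^sub>o x))\<^sup>2 \<le> 2 * (M\<^sup>2 * (norm x)\<^sup>2)" by (simp add: ennreal_le_iff)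
  also have "\<dots> \<le> (2 * M * norm x)\<^sup>2" by (simp add: power_mult_distrib)
  finally show ?thesis by (rule power2_le_imp_le) (use M0 in simp)
qed

lemma spectral_integral_vector_linear:
  assumes f: "f \<in> borel_measurable borel" and x: "square_integrable_at f x" and y: "square_integrable_at f y"
    and xy: "square_integrable_at f (a *\<^sub>C x + b *\<^sub>C y)"
  shows "spectral_integral E f \<bullet>\<^sub>o (a *\<^sub>C x + b *\<^sub>C y)
    = a *\<^sub>C (spectral_integral E f \<bullet>\<^sub>o x) + b *\<^sub>C (spectral_integral E f \<bullet>\<^sub>o y)"
proof -
  let ?X = "{x, y, a *\<^sub>C x + b *\<^sub>C y}"
  have fin: "finite ?X" by simp
  have L2: "square_integrable_at f v" if "v \<in> ?X" for v using that x y xy by blast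
  obtain S where "\<And>n::nat. S n \<in> step_lists"
    "\<And>v. v \<in> ?X \<Longrightarrow> (\<lambda>n. sqdist (spectral_measure_at E v) f (step_function (S n))) \<longlonglongrightarrow> 0"
    and S: "\<And>v. v \<in> ?X \<Longrightarrow> (\<lambda>n. step_integral E (S n) v) \<longlonglongrightarrow> spectral_integral E f \<bullet>\<^sub>o v"
    using common_step_sequence[OF f fin L2] by blast
  have "(\<lambda>n. step_integral E (S n) (a *\<^sub>C x + b *\<^sub>C y)) \<longlonglongrightarrow> a *\<^sub>C (spectral_integral E f \<bullet>\<^sub>o x) + b *\<^sub>C (spectral_integral E f \<bullet>\<^sub>o y)"
    unfolding step_integral_vector_linear by (intro tendsto_add tendsto_scaleC S) auto
  with S[of "a *\<^sub>C x + b *\<^sub>C y"] show ?thesis by (auto intro: LIMSEQ_unique)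
qed

lemma spectral_integral_truncate_norm:
  assumes f: "f \<in> borel_measurable borel"
  shows "ennreal ((norm (spectral_integral E (truncate f n) \<bullet>\<^sub>o x))\<^sup>2)
    \<le> 2 * sqdist (spectral_measure_at E x) f (\<lambda>_. 0)"
proof -
  have "ennreal ((norm (spectral_integral E (truncate f n) \<bullet>\<^sub>o x))\<^sup>2)
      \<le> 2 * sqdist (spectral_measure_at E x) (truncate f n) (\<lambda>_. 0)"
    by (intro spectral_integral_norm(1) measurable_truncate f square_integrable_bounded[OF truncate_bound])
  also have "\<dots> \<le> 2 * sqdist (spectral_measure_at E x) f (\<lambda>_. 0)"
    by (intro mult_left_mono sqdist_truncate_le) auto
  finally show ?thesis .
qed

text \<open>Monotone convergence reduces membership in the domain to a uniform bound for truncated functions,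
  whose integrals are everywhere defined.\<close>

lemma square_integrable_of_truncations:
  assumes f: "f \<in> borel_measurable borel"
    and le: "\<And>n. sqdist (spectral_measure_at E x) (truncate f n) (\<lambda>_. 0) \<le> C" and C: "C < \<infinity>"
  shows "square_integrable_at f x"
proof -
  let ?\<mu> = "spectral_measure_at E x"
  note sets_spectral_measure[measurable_cong] measurable_truncate[OF f, measurable]
  have ptw: "ennreal ((cmod (f t - 0))\<^sup>2) = (SUP n. ennreal ((cmod (truncate f n t - 0))\<^sup>2))" for t
  proof (rule antisym)
    obtain n where "cmod (f t) \<le> real n" using real_arch_simple by blast
    thus "ennreal ((cmod (f t - 0))\<^sup>2) \<le> (SUP n. ennreal ((cmod (truncate f n t - 0))\<^sup>2))"
      by (intro SUP_upper2[of n]) (auto simp: truncate_def)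
  qed (auto intro!: SUP_least ennreal_leI simp: truncate_def)
  have "sqdist ?\<mu> f (\<lambda>_. 0) = (SUP n. sqdist ?\<mu> (truncate f n) (\<lambda>_. 0))"
    unfolding sqdist_def ptw
  proof (rule nn_integral_monotone_convergence_SUP)
    show "incseq (\<lambda>n t. ennreal ((cmod (truncate f n t - 0))\<^sup>2))"
      by (intro incseq_SucI le_funI ennreal_leI power_mono) (auto simp: truncate_def)
  qed measurable
  also have "\<dots> \<le> C" by (intro SUP_least le)
  finally show ?thesis using C by (simp add: square_integrable_at_def)
qed

text \<open>The integrals of the truncations of \<open>f\<close> are everywhere defined and linear in the vector, which bounds
  their square integrals at a linear combination by those at \<open>x\<close> and \<open>y\<close>.\<close>

lemma square_integrable_vector_linear:
  assumes f: "f \<in> borel_measurable borel" and x: "square_integrable_at f x" and y: "square_integrable_at f y"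
  shows "square_integrable_at f (a *\<^sub>C x + b *\<^sub>C y)"
proof (rule square_integrable_of_truncations[OF f])
  let ?s = "\<lambda>v f. sqdist (spectral_measure_at E v) f (\<lambda>_. 0)"
  let ?A = "ennreal ((cmod a)\<^sup>2)" and ?B = "ennreal ((cmod b)\<^sup>2)"
  fix n
  let ?f = "truncate f n"
  have m: "?f \<in> borel_measurable borel" by (rule measurable_truncate[OF f])
  have L2: "square_integrable_at ?f v" for v by (rule square_integrable_bounded[OF truncate_bound])
  let ?u = "spectral_integral E ?f \<bullet>\<^sub>o x" and ?v = "spectral_integral E ?f \<bullet>\<^sub>o y"
  let ?w = "a *\<^sub>C ?u + b *\<^sub>C ?v"
  have "(norm ?w)\<^sup>2 \<le> 2 * (norm (a *\<^sub>C ?u))\<^sup>2 + 2 * (norm (b *\<^sub>C ?v))\<^sup>2"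
    using parallelogram[of "a *\<^sub>C ?u" "b *\<^sub>C ?v"] zero_le_power2[of "norm (a *\<^sub>C ?u - b *\<^sub>C ?v)"] by linarith
  hence "ennreal ((norm ?w)\<^sup>2) \<le> ennreal (2 * ((cmod a)\<^sup>2 * (norm ?u)\<^sup>2) + 2 * ((cmod b)\<^sup>2 * (norm ?v)\<^sup>2))"
    by (intro ennreal_leI) (simp add: norm_scaleC power_mult_distrib)
  hence le: "ennreal ((norm ?w)\<^sup>2) \<le> 2 * (?A * ennreal ((norm ?u)\<^sup>2)) + 2 * (?B * ennreal ((norm ?v)\<^sup>2))"
    by (simp add: ennreal_plus ennreal_mult')
  have "?s (a *\<^sub>C x + b *\<^sub>C y) ?f \<le> 2 * ennreal ((norm ?w)\<^sup>2)"
    using spectral_integral_norm(2)[OF m L2, of "a *\<^sub>C x + b *\<^sub>C y"]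
    by (simp add: spectral_integral_vector_linear[OF m L2 L2 L2])
  also have "\<dots> \<le> 2 * (2 * (?A * ennreal ((norm ?u)\<^sup>2)) + 2 * (?B * ennreal ((norm ?v)\<^sup>2)))"
    by (intro mult_left_mono le) auto
  also have "\<dots> \<le> 2 * (2 * (?A * (2 * ?s x f)) + 2 * (?B * (2 * ?s y f)))"
    by (intro mult_left_mono add_mono spectral_integral_truncate_norm f) auto
  finally show "?s (a *\<^sub>C x + b *\<^sub>C y) ?f \<le> 2 * (2 * (?A * (2 * ?s x f)) + 2 * (?B * (2 * ?s y f)))" .
qed (use x y in \<open>simp add: square_integrable_at_def ennreal_mult_less_top\<close>)

theorem linear_operator_spectral_integral:
  assumes f: "f \<in> borel_measurable borel" shows "linear_operator (spectral_integral E f)"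
proof -
  have zero: "square_integrable_at f 0"
  proof (rule square_integrable_of_truncations[OF f])
    fix n
    have m: "truncate f n \<in> borel_measurable borel" by (rule measurable_truncate[OF f])
    have L2: "square_integrable_at (truncate f n) v" for v by (rule square_integrable_bounded[OF truncate_bound])
    show "sqdist (spectral_measure_at E 0) (truncate f n) (\<lambda>_. 0) \<le> 0"
      using spectral_integral_vector_linear[OF m L2 L2 L2, of 0 0 0 0] spectral_integral_norm(2)[OF m L2, of 0] by simp
  qed simp
  note sq = square_integrable_vector_linear[OF f] and lin = spectral_integral_vector_linear[OF f]
  show ?thesis
    unfolding linear_operator_def
  proof (intro conjI ballI allI)
    show "0 \<in> dom (spectral_integral E f)" using zero by (simp only: dom_spectral_integral)
  next
    fix x y assume "x \<in> dom (spectral_integral E f)" "y \<in> dom (spectral_integral E f)"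
    hence xy: "square_integrable_at f x" "square_integrable_at f y" by (simp_all only: dom_spectral_integral)
    have sum: "square_integrable_at f (1 *\<^sub>C x + 1 *\<^sub>C y)" by (rule sq[OF xy])
    thus "x + y \<in> dom (spectral_integral E f)" by (simp add: dom_spectral_integral)
    show "spectral_integral E f \<bullet>\<^sub>o (x + y) = spectral_integral E f \<bullet>\<^sub>o x + spectral_integral E f \<bullet>\<^sub>o y"
      using lin[OF xy sum] by simp
  next
    fix a x assume "x \<in> dom (spectral_integral E f)"
    hence x: "square_integrable_at f x" by (simp only: dom_spectral_integral)
    have scaled: "square_integrable_at f (a *\<^sub>C x + 0 *\<^sub>C x)" by (rule sq[OF x x])
    thus "a *\<^sub>C x \<in> dom (spectral_integral E f)" by (simp add: dom_spectral_integral)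
    show "spectral_integral E f \<bullet>\<^sub>o (a *\<^sub>C x) = a *\<^sub>C (spectral_integral E f \<bullet>\<^sub>o x)"
      using lin[OF x x scaled] by simp
  qed
qed

lemma square_integrable_cnj: "square_integrable_at f x \<Longrightarrow> square_integrable_at (\<lambda>t. cnj (f t)) x"
  by (simp add: square_integrable_at_def sqdist_def)

text \<open>For step functions the adjoint is obtained by conjugating the coefficients, because the spectral
  projections are symmetric; a sequence that serves both vectors carries this to the limit.\<close>

lemma spectral_integral_adjoint:
  assumes f: "f \<in> borel_measurable borel" and x: "square_integrable_at f x" and y: "square_integrable_at f y"
  shows "cinner y (spectral_integral E f \<bullet>\<^sub>o x) = cinner (spectral_integral E (\<lambda>t. cnj (f t)) \<bullet>\<^sub>o y) x"
proof -
  have fin: "finite {x, y}" by simp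
  have L2: "square_integrable_at f v" if "v \<in> {x, y}" for v using that x y by blast
  obtain S where S: "\<And>n::nat. S n \<in> step_lists"
    "\<And>v. v \<in> {x, y} \<Longrightarrow> (\<lambda>n. sqdist (spectral_measure_at E v) f (step_function (S n))) \<longlonglongrightarrow> 0"
    "\<And>v. v \<in> {x, y} \<Longrightarrow> (\<lambda>n::nat. step_integral E (S n) v) \<longlonglongrightarrow> spectral_integral E f \<bullet>\<^sub>o v"
    using common_step_sequence[OF f fin L2] by blast
  have "sqdist \<mu> (\<lambda>t. cnj (f t)) (step_function (map_coeff cnj S)) = sqdist \<mu> f (step_function S)" for \<mu> S
    unfolding sqdist_def step_function_cnj complex_cnj_diff[symmetric] complex_mod_cnj ..
  hence "(\<lambda>n. step_integral E (map_coeff cnj (S n)) y) \<longlonglongrightarrow> spectral_integral E (\<lambda>t. cnj (f t)) \<bullet>\<^sub>o y"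
    using f S(1) S(2)[of y]
    by (intro spectral_integral_limit square_integrable_cnj y measurable_cnj) (auto intro: step_lists_map_coeff)
  hence "(\<lambda>n. cinner (step_integral E (map_coeff cnj (S n)) y) x) \<longlonglongrightarrow> cinner (spectral_integral E (\<lambda>t. cnj (f t)) \<bullet>\<^sub>o y) x"
    by (intro tendsto_cinner tendsto_const)
  moreover have "(\<lambda>n. cinner y (step_integral E (S n) x)) \<longlonglongrightarrow> cinner y (spectral_integral E f \<bullet>\<^sub>o x)"
    by (intro tendsto_cinner tendsto_const S(3)) simp
  ultimately show ?thesis unfolding step_integral_adjoint by (metis LIMSEQ_unique)
qed

lemma spectral_integral_bounded_convergence:
  assumes f: "f \<in> borel_measurable borel" and fn: "\<And>n::nat. fn n \<in> borel_measurable borel"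
    and M: "\<And>n t. cmod (fn n t) \<le> M" and lim: "\<And>t. (\<lambda>n. fn n t) \<longlonglongrightarrow> f t"
  shows "\<And>n. square_integrable_at (fn n) x" "square_integrable_at f x"
    "(\<lambda>n. spectral_integral E (fn n) \<bullet>\<^sub>o x) \<longlonglongrightarrow> spectral_integral E f \<bullet>\<^sub>o x"
proof -
  let ?\<mu> = "spectral_measure_at E x"
  have Mf: "cmod (f t) \<le> M" for t
    by (rule tendsto_upperbound[OF tendsto_norm[OF lim]]) (use M in auto)
  show L2n: "square_integrable_at (fn n) x" for n by (rule square_integrable_bounded[OF M])
  show L2: "square_integrable_at f x" by (rule square_integrable_bounded[OF Mf])
  have dist: "(\<lambda>n. sqdist ?\<mu> f (fn n)) \<longlonglongrightarrow> 0"
  proof (rule sqdist_bounded_limit[of "{?\<mu>}"])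
    show "cmod (f t - fn n t) \<le> M + M" for n t
      using norm_triangle_ineq4[of "f t" "fn n t"] Mf[of t] M[of n t] by linarith
  qed (use f fn lim finite_spectral_measure sets_spectral_measure in auto)
  have "(\<lambda>n. spectral_integral E f \<bullet>\<^sub>o x - spectral_integral E (fn n) \<bullet>\<^sub>o x) \<longlonglongrightarrow> 0"
  proof (rule tendsto_zero_of_norm_square, rule tendsto_sandwich[OF _ _ tendsto_const])
    show "(\<lambda>n. 2 * sqdist ?\<mu> f (fn n)) \<longlonglongrightarrow> 0" using ennreal_tendsto_cmult[OF _ dist, of 2] by simp
  qed (auto intro!: always_eventually spectral_integral_diff_norm f fn L2 L2n)
  from tendsto_diff[OF tendsto_const[of "spectral_integral E f \<bullet>\<^sub>o x"] this] show "(\<lambda>n. spectral_integral E (fn n) \<bullet>\<^sub>o x) \<longlonglongrightarrow> spectral_integral E f \<bullet>\<^sub>o x"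
    by simp
qed

end

section \<open>Symmetric contractions and their spectral projections\<close>

text \<open>Bounded self-adjoint operators, scaled to norm at most \<open>1\<close>. All spectral analysis of \<open>T\<close> is reduced to
  them through the resolvents of \<open>T\<close>.\<close>

definition symmetric_contraction :: "('a::chilbert_space \<Rightarrow> 'a) \<Rightarrow> bool"
  where "symmetric_contraction A \<longleftrightarrow>
    (\<forall>x y. A (x + y) = A x + A y) \<and> (\<forall>a x. A (a *\<^sub>C x) = a *\<^sub>C A x) \<and>
    (\<forall>x y. cinner (A x) y = cinner x (A y)) \<and> (\<forall>x. norm (A x) \<le> norm x)"

lemma symmetric_contractionD:
  assumes "symmetric_contraction A"
  shows "A (x + y) = A x + A y" "A (a *\<^sub>C x) = a *\<^sub>C A x" "cinner (A x) y = cinner x (A y)" "norm (A x) \<le> norm x"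
  using assms by (auto simp: symmetric_contraction_def)

lemma symmetric_contraction_scaleR: "symmetric_contraction A \<Longrightarrow> A (r *\<^sub>R x) = r *\<^sub>R A x"
  by (simp add: scaleR_scaleC symmetric_contractionD)

lemma symmetric_contraction_bounded_linear: "symmetric_contraction A \<Longrightarrow> bounded_linear A"
  by (rule bounded_linear_intro[where K=1]) (simp_all add: symmetric_contractionD symmetric_contraction_scaleR)

lemma symmetric_contraction_diff: "symmetric_contraction A \<Longrightarrow> A (x - y) = A x - A y"
  by (intro linear_diff bounded_linear.linear symmetric_contraction_bounded_linear)

lemma symmetric_contraction_zero: "symmetric_contraction A \<Longrightarrow> A 0 = 0"
  by (intro linear_0 bounded_linear.linear symmetric_contraction_bounded_linear)

lemma symmetric_contraction_inner: "symmetric_contraction A \<Longrightarrow> inner (A x) y = inner x (A y)"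
  by (simp add: inner_eq_Re_cinner symmetric_contractionD)

lemma symmetric_contraction_norm_square: "symmetric_contraction A \<Longrightarrow> (norm (A x))\<^sup>2 = inner x (A (A x))"
  by (simp add: power2_norm_eq_inner symmetric_contraction_inner)

definition commuting :: "('a \<Rightarrow> 'a) \<Rightarrow> ('a \<Rightarrow> 'a) \<Rightarrow> bool"
  where "commuting A Z \<longleftrightarrow> (\<forall>x. A (Z x) = Z (A x))"

lemma symmetric_contraction_limit:
  assumes A: "\<And>n::nat. symmetric_contraction (A n)" and lim: "\<And>x. (\<lambda>n. A n x) \<longlonglongrightarrow> B x"
  shows "symmetric_contraction B"
  unfolding symmetric_contraction_def
proof (intro conjI allI)
  fix x y a
  show "B (x + y) = B x + B y"
    using lim[of "x + y"] tendsto_add[OF lim[of x] lim[of y]] unfolding symmetric_contractionD(1)[OF A]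
    by (rule LIMSEQ_unique)
  show "B (a *\<^sub>C x) = a *\<^sub>C B x"
    using lim[of "a *\<^sub>C x"] tendsto_scaleC[OF lim[of x], of a] unfolding symmetric_contractionD(2)[OF A]
    by (rule LIMSEQ_unique)
  show "cinner (B x) y = cinner x (B y)"
    using tendsto_cinner[OF lim[of x] tendsto_const[of y]] tendsto_cinner[OF tendsto_const[of x] lim[of y]]
    unfolding symmetric_contractionD(3)[OF A] by (rule LIMSEQ_unique)
  show "norm (B x) \<le> norm x"
    by (rule tendsto_upperbound[OF tendsto_norm[OF lim[of x]]]) (auto simp: symmetric_contractionD(4)[OF A])
qed

lemma commuting_limit:
  assumes "\<And>n::nat. commuting (A n) Z" and lim: "\<And>x. (\<lambda>n. A n x) \<longlonglongrightarrow> B x" and Z: "bounded_linear Z"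
  shows "commuting B Z"
  unfolding commuting_def
proof
  fix x
  have "(\<lambda>n. Z (A n x)) \<longlonglongrightarrow> Z (B x)" by (rule bounded_linear.tendsto[OF Z lim])
  moreover have "(\<lambda>n. Z (A n x)) \<longlonglongrightarrow> B (Z x)"
    using lim[of "Z x"] assms(1) by (simp add: commuting_def)
  ultimately show "B (Z x) = Z (B x)" by (metis LIMSEQ_unique)
qed

text \<open>The solution \<open>Y\<close> of \<open>Y = (X + Y\<^sup>2) / 2\<close> gives \<open>(1 - Y)\<^sup>2 = 1 - X\<close>, a square root. The iteration from
  \<open>0\<close> converges because its increments are dominated by those of the same iteration for the scalar
  \<open>X = 1\<close>, which increases to \<open>1\<close>.\<close>

fun root_iteration :: "('a::chilbert_space \<Rightarrow> 'a) \<Rightarrow> nat \<Rightarrow> 'a \<Rightarrow> 'a" where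
  "root_iteration X 0 x = 0"
| "root_iteration X (Suc n) x = (1/2) *\<^sub>R (X x + root_iteration X n (root_iteration X n x))"

fun scalar_iteration :: "nat \<Rightarrow> real" where
  "scalar_iteration 0 = 0"
| "scalar_iteration (Suc n) = (1 + (scalar_iteration n)\<^sup>2) / 2"

lemma scalar_iteration_bounds: "0 \<le> scalar_iteration n \<and> scalar_iteration n \<le> 1"
  by (induction n) (auto simp: power_le_one)

lemma scalar_iteration_incseq: "incseq scalar_iteration"
proof (rule incseq_SucI)
  show "scalar_iteration n \<le> scalar_iteration (Suc n)" for n
    using zero_le_power2[of "scalar_iteration n - 1"] by (simp add: power2_diff)
qed

context
  fixes X :: "'a::chilbert_space \<Rightarrow> 'a"
  assumes X: "symmetric_contraction X"
begin

lemma symmetric_contraction_root_iteration: "symmetric_contraction (root_iteration X n)"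
proof (induction n)
  case (Suc n)
  let ?Y = "root_iteration X n"
  note D = symmetric_contractionD[OF Suc] symmetric_contractionD[OF X]
  show ?case
    unfolding symmetric_contraction_def
  proof (intro conjI allI)
    fix x y a
    show "root_iteration X (Suc n) (x + y) = root_iteration X (Suc n) x + root_iteration X (Suc n) y"
      by (simp add: D scaleR_add_right)
    show "root_iteration X (Suc n) (a *\<^sub>C x) = a *\<^sub>C root_iteration X (Suc n) x"
      by (simp add: D scaleC_scaleR scaleC_add_right)
    show "cinner (root_iteration X (Suc n) x) y = cinner x (root_iteration X (Suc n) y)"
      by (simp add: cinner_scaleR_left cinner_scaleR_right cinner_add_left cinner_add_right
          D(3) D(7))
    have "norm (root_iteration X (Suc n) x) \<le> (1/2) * (norm (X x) + norm (?Y (?Y x)))"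
      using norm_triangle_ineq[of "X x" "?Y (?Y x)"] by simp
    also have "\<dots> \<le> norm x"
      using D(8)[of x] D(4)[of x] D(4)[of "?Y x"] by simp
    finally show "norm (root_iteration X (Suc n) x) \<le> norm x" .
  qed
qed (simp add: symmetric_contraction_def)

lemma root_iteration_norm: "norm (root_iteration X n x) \<le> scalar_iteration n * norm x"
proof (induction n arbitrary: x)
  case (Suc n)
  let ?Y = "root_iteration X n" and ?y = "scalar_iteration n"
  have "norm (?Y (?Y x)) \<le> ?y * (?y * norm x)"
    using Suc[of "?Y x"] mult_left_mono[OF Suc[of x], of ?y] scalar_iteration_bounds[of n] by simp
  hence "norm (X x) + norm (?Y (?Y x)) \<le> norm x + ?y\<^sup>2 * norm x"
    using symmetric_contractionD(4)[OF X, of x] by (simp add: power2_eq_square)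
  hence "norm (root_iteration X (Suc n) x) \<le> (1/2) * (norm x + ?y\<^sup>2 * norm x)"
    using norm_triangle_ineq[of "X x" "?Y (?Y x)"] by simp
  also have "\<dots> = scalar_iteration (Suc n) * norm x" by (simp add: algebra_simps)
  finally show ?case .
qed simp

lemma root_iteration_step:
  "norm (root_iteration X (Suc n) x - root_iteration X n x) \<le> (scalar_iteration (Suc n) - scalar_iteration n) * norm x"
proof (induction n arbitrary: x)
  case 0
  show ?case using symmetric_contractionD(4)[OF X, of x] by simp
next
  case (Suc n)
  let ?Y = "root_iteration X n" and ?Y' = "root_iteration X (Suc n)"
  let ?y = "scalar_iteration n" and ?y' = "scalar_iteration (Suc n)"
  have d: "0 \<le> ?y' - ?y" using scalar_iteration_incseq by (simp add: incseq_Suc_iff del: scalar_iteration.simps)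
  have bd: "0 \<le> ?y" "0 \<le> ?y'" using scalar_iteration_bounds[of n] scalar_iteration_bounds[of "Suc n"] by auto
  have "root_iteration X (Suc (Suc n)) x - ?Y' x = (1/2) *\<^sub>R (?Y' (?Y' x) - ?Y (?Y x))"
    using arg_cong2[OF root_iteration.simps(2)[of X "Suc n" x] root_iteration.simps(2)[of X n x], of minus]
    by (simp only: scaleR_right_diff_distrib[symmetric] add_diff_cancel_left)
  also have "?Y' (?Y' x) - ?Y (?Y x) = ?Y' (?Y' x - ?Y x) + (?Y' (?Y x) - ?Y (?Y x))"
    by (simp add: symmetric_contraction_diff[OF symmetric_contraction_root_iteration] del: root_iteration.simps)
  finally have "norm (root_iteration X (Suc (Suc n)) x - ?Y' x)
      \<le> (1/2) * (norm (?Y' (?Y' x - ?Y x)) + norm (?Y' (?Y x) - ?Y (?Y x)))"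
    using norm_triangle_ineq[of "?Y' (?Y' x - ?Y x)" "?Y' (?Y x) - ?Y (?Y x)"] by (simp del: root_iteration.simps)
  also have "\<dots> \<le> (1/2) * (?y' * ((?y' - ?y) * norm x) + (?y' - ?y) * (?y * norm x))"
  proof (intro mult_left_mono add_mono)
    show "norm (?Y' (?Y' x - ?Y x)) \<le> ?y' * ((?y' - ?y) * norm x)"
      using root_iteration_norm[of "Suc n" "?Y' x - ?Y x"] mult_left_mono[OF Suc[of x] bd(2)] by linarith
    show "norm (?Y' (?Y x) - ?Y (?Y x)) \<le> (?y' - ?y) * (?y * norm x)"
      using Suc[of "?Y x"] mult_left_mono[OF root_iteration_norm[of n x] d] by linarith
  qed simp
  also have "\<dots> = (?y'\<^sup>2 - ?y\<^sup>2) / 2 * norm x" by (simp add: algebra_simps power2_eq_square del: scalar_iteration.simps)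
  also have "(?y'\<^sup>2 - ?y\<^sup>2) / 2 = scalar_iteration (Suc (Suc n)) - ?y'"
    using arg_cong2[OF scalar_iteration.simps(2)[of "Suc n"] scalar_iteration.simps(2)[of n], of minus]
    by (simp add: diff_divide_distrib add_divide_distrib del: scalar_iteration.simps)
  finally show ?case .
qed

lemma root_iteration_diff:
  "m \<le> n \<Longrightarrow> norm (root_iteration X n x - root_iteration X m x) \<le> (scalar_iteration n - scalar_iteration m) * norm x"
proof (induction n rule: dec_induct)
  case (step n)
  have "norm (root_iteration X (Suc n) x - root_iteration X m x)
     \<le> norm (root_iteration X (Suc n) x - root_iteration X n x) + norm (root_iteration X n x - root_iteration X m x)"
    using norm_triangle_ineq[of "root_iteration X (Suc n) x - root_iteration X n x" "root_iteration X n x - root_iteration X m x"]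
    by (simp del: root_iteration.simps)
  also have "\<dots> \<le> (scalar_iteration (Suc n) - scalar_iteration n) * norm x + (scalar_iteration n - scalar_iteration m) * norm x"
    by (intro add_mono root_iteration_step step.IH)
  finally show ?case by (simp add: algebra_simps del: root_iteration.simps scalar_iteration.simps)
qed simp

lemma commuting_root_iteration:
  assumes "commuting X Z" "bounded_linear Z" shows "commuting (root_iteration X n) Z"
proof -
  interpret bounded_linear Z by fact
  show ?thesis using assms(1)
    by (induction n) (simp_all add: commuting_def zero scaleR add)
qed

lemma root_iteration_fixpoint:
  obtains Y where "symmetric_contraction Y" "\<And>x. Y x = (1/2) *\<^sub>R (X x + Y (Y x))"
    "\<And>Z. bounded_linear Z \<Longrightarrow> commuting X Z \<Longrightarrow> commuting Y Z"
proof -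
  have "convergent scalar_iteration"
    by (rule Bseq_monoseq_convergent)
      (use scalar_iteration_incseq scalar_iteration_bounds in \<open>auto simp: incseq_imp_monoseq intro!: BseqI'[of _ 1]\<close>)
  hence cau: "Cauchy scalar_iteration" by (rule convergent_Cauchy)
  have "convergent (\<lambda>n. root_iteration X n x)" for x
  proof (rule Cauchy_convergent, rule metric_CauchyI)
    fix e :: real assume e: "e > 0"
    have "0 < e / (norm x + 1)" using e by (simp add: add_nonneg_pos)
    then obtain N where N: "\<And>m n. m \<ge> N \<Longrightarrow> n \<ge> N \<Longrightarrow> dist (scalar_iteration m) (scalar_iteration n) < e / (norm x + 1)"
      using metric_CauchyD[OF cau] by metis
    have le: "dist (root_iteration X n x) (root_iteration X m x) < e" if "m \<ge> N" "n \<ge> m" for m n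
    proof -
      have "dist (root_iteration X n x) (root_iteration X m x) \<le> (scalar_iteration n - scalar_iteration m) * norm x"
        using root_iteration_diff[OF that(2)] by (simp add: dist_norm)
      also have "\<dots> \<le> e / (norm x + 1) * norm x"
        using N[of n m] that by (intro mult_right_mono) (auto simp: dist_real_def)
      also have "\<dots> < e"
        using e add_nonneg_pos[OF norm_ge_zero zero_less_one, of x] by (simp add: divide_less_eq algebra_simps)
      finally show ?thesis .
    qed
    show "\<exists>N. \<forall>m\<ge>N. \<forall>n\<ge>N. dist (root_iteration X m x) (root_iteration X n x) < e"
      using le by (metis dist_commute nle_le)
  qed
  hence "\<exists>y. (\<lambda>n. root_iteration X n x) \<longlonglongrightarrow> y" for x by (simp add: convergent_def)
  then obtain Y where Y: "\<And>x. (\<lambda>n. root_iteration X n x) \<longlonglongrightarrow> Y x" by metis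
  show thesis
  proof (rule that)
    show "symmetric_contraction Y" by (rule symmetric_contraction_limit[OF symmetric_contraction_root_iteration Y])
    show "commuting Y Z" if "bounded_linear Z" "commuting X Z" for Z
      by (rule commuting_limit[OF commuting_root_iteration Y]) (use that in auto)
    fix x
    have "(\<lambda>n. root_iteration X n (root_iteration X n x - Y x)) \<longlonglongrightarrow> 0"
    proof (rule tendsto_norm_zero_cancel, rule tendsto_sandwich[OF _ _ tendsto_const])
      show "(\<lambda>n. norm (root_iteration X n x - Y x)) \<longlonglongrightarrow> 0"
        using tendsto_norm[OF tendsto_diff[OF Y[of x] tendsto_const[of "Y x"]]] by simp
    qed (auto simp: symmetric_contractionD(4)[OF symmetric_contraction_root_iteration])
    from tendsto_add[OF this Y[of "Y x"]]
    have "(\<lambda>n. root_iteration X n (root_iteration X n x)) \<longlonglongrightarrow> Y (Y x)"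
      by (simp add: symmetric_contraction_diff[OF symmetric_contraction_root_iteration])
    hence "(\<lambda>n. root_iteration X (Suc n) x) \<longlonglongrightarrow> (1/2) *\<^sub>R (X x + Y (Y x))"
      unfolding root_iteration.simps by (intro tendsto_intros)
    with LIMSEQ_Suc[OF Y[of x]] show "Y x = (1/2) *\<^sub>R (X x + Y (Y x))" by (rule LIMSEQ_unique)
  qed
qed

end

lemma symmetric_contraction_one_minus_square:
  assumes A: "symmetric_contraction A" shows "symmetric_contraction (\<lambda>x. x - A (A x))"
  unfolding symmetric_contraction_def
proof (intro conjI allI)
  fix x y a
  show "x + y - A (A (x + y)) = x - A (A x) + (y - A (A y))" by (simp add: symmetric_contractionD[OF A])
  show "a *\<^sub>C x - A (A (a *\<^sub>C x)) = a *\<^sub>C (x - A (A x))" by (simp add: symmetric_contractionD[OF A] scaleC_diff_right)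
  show "cinner (x - A (A x)) y = cinner x (y - A (A y))"
    by (simp add: symmetric_contractionD(3)[OF A] cinner_diff_left cinner_diff_right)
  have "(norm (x - A (A x)))\<^sup>2 = (norm x)\<^sup>2 - 2 * (norm (A x))\<^sup>2 + (norm (A (A x)))\<^sup>2"
    by (simp add: norm_diff_square symmetric_contraction_norm_square[OF A, symmetric])
  moreover have "(norm (A (A x)))\<^sup>2 \<le> (norm (A x))\<^sup>2"
    by (intro power_mono symmetric_contractionD(4)[OF A]) simp
  ultimately have "(norm (x - A (A x)))\<^sup>2 \<le> (norm x)\<^sup>2" using zero_le_power2[of "norm (A x)"] by linarith
  thus "norm (x - A (A x)) \<le> norm x" by (rule power2_le_imp_le) simp
qed

text \<open>\<open>P = 1 - Y\<close> is the square root of \<open>A\<^sup>2\<close>, where \<open>Y\<close> is the fixed point for \<open>X = 1 - A\<^sup>2\<close>. It is positive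
  because \<open>Y\<close> is a contraction.\<close>

lemma absolute_value_exists:
  assumes A: "symmetric_contraction A"
  obtains P where "symmetric_contraction P" "\<And>x. P (P x) = A (A x)" "\<And>x. 0 \<le> inner (P x) x"
    "\<And>Z. bounded_linear Z \<Longrightarrow> commuting A Z \<Longrightarrow> commuting P Z"
proof -
  let ?X = "\<lambda>x. x - A (A x)"
  obtain Y where Y: "symmetric_contraction Y" "\<And>x. Y x = (1/2) *\<^sub>R (?X x + Y (Y x))"
    "\<And>Z. bounded_linear Z \<Longrightarrow> commuting ?X Z \<Longrightarrow> commuting Y Z"
    using root_iteration_fixpoint[OF symmetric_contraction_one_minus_square[OF A]] by blast
  define P where "P x = x - Y x" for x
  have PP: "P (P x) = A (A x)" for x
  proof -
    have "2 *\<^sub>R Y x = ?X x + Y (Y x)" by (subst Y(2)) simp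
    moreover have "P (P x) = x - 2 *\<^sub>R Y x + Y (Y x)"
      by (simp add: P_def symmetric_contraction_diff[OF Y(1)] scaleR_2)
    ultimately show ?thesis by simp
  qed
  have sym: "cinner (P x) y = cinner x (P y)" for x y
    by (simp add: P_def cinner_diff_left cinner_diff_right symmetric_contractionD(3)[OF Y(1)])
  have "norm (P x) = norm (A x)" for x
  proof -
    have "complex_of_real ((norm (P x))\<^sup>2) = complex_of_real ((norm (A x))\<^sup>2)"
      unfolding cinner_self[symmetric] by (simp add: sym PP symmetric_contractionD(3)[OF A])
    hence "(norm (P x))\<^sup>2 = (norm (A x))\<^sup>2" by (simp only: of_real_eq_iff)
    thus ?thesis by (simp add: power2_eq_iff_nonneg)
  qed
  hence sc: "symmetric_contraction P"
    unfolding symmetric_contraction_def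
    using sym symmetric_contractionD(4)[OF A] by (auto simp: P_def symmetric_contractionD[OF Y(1)] scaleC_diff_right)
  show thesis
  proof (rule that[OF sc PP])
    show "0 \<le> inner (P x) x" for x
    proof -
      have "inner (Y x) x \<le> norm (Y x) * norm x" by (rule norm_cauchy_schwarz)
      also have "\<dots> \<le> norm x * norm x" by (intro mult_right_mono symmetric_contractionD(4)[OF Y(1)]) simp
      finally show ?thesis by (simp add: P_def inner_diff_left power2_norm_eq_inner[symmetric] power2_eq_square)
    qed
    show "commuting P Z" if Z: "bounded_linear Z" "commuting A Z" for Z
    proof -
      interpret bounded_linear Z by fact
      have "commuting ?X Z" using Z(2) by (simp add: commuting_def diff)
      thus ?thesis using Y(3)[OF Z(1)] by (simp add: commuting_def P_def diff)
    qed
  qed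
qed

text \<open>The projection is the strong limit of the powers \<open>C\<^sup>2\<^sup>n\<close> of the positive contraction
  \<open>C = 1 - K\<^sup>2\<close>. The squared norms \<open>\<parallel>C\<^sup>k x\<parallel>\<^sup>2\<close> decrease with \<open>k\<close>, and
  \<open>\<parallel>C\<^sup>2\<^sup>m x - C\<^sup>2\<^sup>n x\<parallel>\<^sup>2\<close> is a second difference of them, so the limit exists. Unlike an abstract
  closest point argument, this shows at once that the projection commutes with all that commutes
  with \<open>K\<close>.\<close>

lemma kernel_projection:
  assumes K: "symmetric_contraction K"
  obtains Q where "orthogonal_projection Q" "\<And>x. Q x = x \<longleftrightarrow> K x = 0"
    "\<And>Z. bounded_linear Z \<Longrightarrow> commuting K Z \<Longrightarrow> commuting Q Z"
proof -
  define C where "C x = x - K (K x)" for x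
  have C: "symmetric_contraction C"
    unfolding C_def[abs_def] by (rule symmetric_contraction_one_minus_square[OF K])
  have fix_iff: "C x = x \<longleftrightarrow> K x = 0" for x
  proof
    assume "C x = x"
    hence "K (K x) = 0" by (simp add: C_def)
    hence "(norm (K x))\<^sup>2 = 0" by (simp add: symmetric_contraction_norm_square[OF K])
    thus "K x = 0" by simp
  qed (simp add: C_def symmetric_contraction_zero[OF K])
  have Ck: "symmetric_contraction (C ^^ k)" for k
  proof (induction k)
    case (Suc k)
    note D = symmetric_contractionD[OF C] symmetric_contractionD[OF Suc]
    have "C ((C ^^ k) y) = (C ^^ k) (C y)" for y by (rule funpow_swap1)
    thus ?case unfolding symmetric_contraction_def
      by (auto simp: D(1,2,5,6)) (metis D(3,7), metis D(4,8) order_trans)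
  qed (simp add: symmetric_contraction_def)
  have powers: "inner ((C ^^ m) x) ((C ^^ n) x) = inner x ((C ^^ (m + n)) x)" for m n x
    by (simp add: symmetric_contraction_inner[OF Ck] funpow_add)
  define a where "a x k = (norm ((C ^^ k) x))\<^sup>2" for x k
  have a_dec: "decseq (a x)" for x
    by (rule decseq_SucI) (auto simp: a_def intro!: power_mono symmetric_contractionD(4)[OF C])
  have a_conv: "convergent (a x)" for x
    by (rule decseq_convergent[OF a_dec[of x], of 0]) (auto simp: a_def convergent_def)
  have diff: "(norm ((C ^^ (2*m)) x - (C ^^ (2*n)) x))\<^sup>2 = a x (2*m) - 2 * a x (m + n) + a x (2*n)" for x m n
  proof -
    have "inner ((C ^^ (2*m)) x) ((C ^^ (2*n)) x) = inner ((C ^^ (m+n)) x) ((C ^^ (m+n)) x)"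
    proof -
      have "2 * m + 2 * n = (m + n) + (m + n)" by simp
      thus ?thesis by (simp only: powers)
    qed
    thus ?thesis by (simp add: norm_diff_square a_def power2_norm_eq_inner[of "(C ^^ (m+n)) x"])
  qed
  have "convergent (\<lambda>n. (C ^^ (2*n)) x)" for x
  proof (rule Cauchy_convergent, rule metric_CauchyI)
    fix e :: real assume e: "e > 0"
    then obtain N where N: "\<And>m n. m \<ge> N \<Longrightarrow> n \<ge> N \<Longrightarrow> dist (a x m) (a x n) < e\<^sup>2 / 2"
      using metric_CauchyD[OF convergent_Cauchy[OF a_conv[of x]], of "e\<^sup>2/2"] by auto
    show "\<exists>N. \<forall>m\<ge>N. \<forall>n\<ge>N. dist ((C ^^ (2*m)) x) ((C ^^ (2*n)) x) < e"
    proof (intro exI allI impI)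
      fix m n assume mn: "m \<ge> N" "n \<ge> N"
      have "(norm ((C ^^ (2*m)) x - (C ^^ (2*n)) x))\<^sup>2 < e\<^sup>2"
        unfolding diff using N[of "2*m" "m+n"] N[of "2*n" "m+n"] mn by (simp add: dist_real_def abs_if split: if_splits)
      thus "dist ((C ^^ (2*m)) x) ((C ^^ (2*n)) x) < e"
        using e by (simp add: dist_norm power_less_imp_less_base)
    qed
  qed
  hence "\<exists>y. (\<lambda>n. (C ^^ (2*n)) x) \<longlonglongrightarrow> y" for x by (simp add: convergent_def)
  then obtain Q where Q: "\<And>x. (\<lambda>n. (C ^^ (2*n)) x) \<longlonglongrightarrow> Q x" by metis
  have sc: "symmetric_contraction Q" by (rule symmetric_contraction_limit[OF Ck Q])
  have fixed: "Q x = x" if "K x = 0" for x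
  proof -
    have "C x = x" using that fix_iff by blast
    hence "(C ^^ k) x = x" for k by (induction k) auto
    with Q[of x] show ?thesis by (simp add: LIMSEQ_const_iff)
  qed
  have range: "K (Q x) = 0" for x
  proof -
    let ?y = "Q x"
    have "(\<lambda>n. C (C ((C ^^ (2*n)) x))) \<longlonglongrightarrow> C (C ?y)"
      by (intro bounded_linear.tendsto[OF symmetric_contraction_bounded_linear[OF C]] Q)
    moreover have "(\<lambda>n. C (C ((C ^^ (2*n)) x))) \<longlonglongrightarrow> ?y"
      using LIMSEQ_Suc[OF Q[of x]] by simp
    ultimately have CC: "C (C ?y) = ?y" by (rule LIMSEQ_unique)
    \<comment> \<open>\<open>w = C y - y\<close> is an eigenvector of the positive operator \<open>C\<close> for the eigenvalue \<open>-1\<close>\<close>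
    define w where "w = C ?y - ?y"
    have "C w = - w" by (simp add: w_def symmetric_contraction_diff[OF C] CC)
    hence "inner (C w) w = - (norm w)\<^sup>2" by (simp add: power2_norm_eq_inner)
    moreover have "inner (C w) w = (norm w)\<^sup>2 - (norm (K w))\<^sup>2"
      by (simp add: C_def inner_diff_left power2_norm_eq_inner symmetric_contraction_inner[OF K])
    moreover have "(norm (K w))\<^sup>2 \<le> (norm w)\<^sup>2" by (intro power_mono symmetric_contractionD(4)[OF K]) simp
    ultimately have "(norm w)\<^sup>2 = 0" using zero_le_power2[of "norm w"] by linarith
    hence "C ?y = ?y" by (simp add: w_def)
    thus ?thesis by (simp add: fix_iff)
  qed
  show thesis
  proof (rule that)
    show "orthogonal_projection Q"
      using symmetric_contractionD[OF sc] fixed[OF range] by (simp add: orthogonal_projection_def)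
    show "Q x = x \<longleftrightarrow> K x = 0" for x using fixed range by metis
    show "commuting Q Z" if Z: "bounded_linear Z" "commuting K Z" for Z
    proof (rule commuting_limit[OF _ Q Z(1)])
      interpret bounded_linear Z by fact
      have "commuting C Z" using Z(2) by (simp add: commuting_def C_def diff)
      hence "commuting (C ^^ k) Z" for k by (induction k) (auto simp: commuting_def)
      thus "commuting (C ^^ (2*n)) Z" for n .
    qed
  qed
qed

text \<open>The spectral projection of \<open>A\<close> for the half line of nonpositive numbers projects onto the kernel
  of the positive part \<open>(\<bar>A\<bar> + A) / 2\<close>. On its range \<open>A = - \<bar>A\<bar>\<close>. The negative part \<open>(\<bar>A\<bar> - A) / 2\<close>
  maps into that range, so it vanishes on the orthogonal complement, where therefore \<open>A = \<bar>A\<bar>\<close>.\<close>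

lemma nonpositive_spectral_projection:
  assumes A: "symmetric_contraction A"
  obtains Q where "orthogonal_projection Q" "\<And>x. Q x = x \<Longrightarrow> inner (A x) x \<le> 0"
    "\<And>x. Q x = 0 \<Longrightarrow> 0 \<le> inner (A x) x" "\<And>x. Q x = 0 \<Longrightarrow> inner (A x) x = 0 \<Longrightarrow> x = 0"
    "\<And>Z. bounded_linear Z \<Longrightarrow> commuting A Z \<Longrightarrow> commuting Q Z"
proof -
  obtain P where P: "symmetric_contraction P" "\<And>x. P (P x) = A (A x)" "\<And>x. 0 \<le> inner (P x) x"
    "\<And>Z. bounded_linear Z \<Longrightarrow> commuting A Z \<Longrightarrow> commuting P Z"
    using absolute_value_exists[OF A] by blast
  note DA = symmetric_contractionD[OF A] and DP = symmetric_contractionD[OF P(1)]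
  have blA: "bounded_linear A" and blP: "bounded_linear P"
    by (intro symmetric_contraction_bounded_linear A P(1))+
  have PA: "P (A x) = A (P x)" for x using P(4)[OF blA] by (simp add: commuting_def)
  define K where "K x = (1/2) *\<^sub>R (P x + A x)" for x
  have K: "symmetric_contraction K"
    unfolding symmetric_contraction_def
  proof (intro conjI allI)
    fix x y a
    show "K (x + y) = K x + K y" by (simp add: K_def DA(1) DP(1) algebra_simps)
    show "K (a *\<^sub>C x) = a *\<^sub>C K x" by (simp add: K_def DA(2) DP(2) scaleC_scaleR scaleC_add_right)
    show "cinner (K x) y = cinner x (K y)"
      by (simp add: K_def cinner_scaleR_left cinner_scaleR_right cinner_add_left cinner_add_right DA(3) DP(3))
    show "norm (K x) \<le> norm x" using norm_triangle_ineq[of "P x" "A x"] DA(4)[of x] DP(4)[of x] by (simp add: K_def)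
  qed
  obtain Q where Q: "orthogonal_projection Q" "\<And>x. Q x = x \<longleftrightarrow> K x = 0"
    "\<And>Z. bounded_linear Z \<Longrightarrow> commuting K Z \<Longrightarrow> commuting Q Z"
    using kernel_projection[OF K] by blast
  have QZ: "commuting Q Z" if Z: "bounded_linear Z" "commuting A Z" for Z
  proof (rule Q(3)[OF Z(1)])
    interpret bounded_linear Z by fact
    show "commuting K Z" using Z(2) P(4)[OF Z] by (simp add: commuting_def K_def scaleR add)
  qed
  have QA: "Q (A x) = A (Q x)" and QP: "Q (P x) = P (Q x)" for x
    using QZ[OF blA] QZ[OF blP] PA by (simp_all add: commuting_def)
  have complement: "P x = A x" if "Q x = 0" for x
  proof -
    let ?w = "(1/2) *\<^sub>R (P x - A x)"
    have "K ?w = 0"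
      by (simp add: K_def symmetric_contraction_scaleR[OF A] symmetric_contraction_scaleR[OF P(1)]
          symmetric_contraction_diff[OF A] symmetric_contraction_diff[OF P(1)] P(2) PA algebra_simps)
    hence "Q ?w = ?w" by (simp add: Q(2))
    moreover have "Q ?w = 0"
      by (simp add: orthogonal_projection_scaleR[OF Q(1)] orthogonal_projection_diff[OF Q(1)] QA QP that
          symmetric_contraction_zero[OF A] symmetric_contraction_zero[OF P(1)])
    ultimately show ?thesis by simp
  qed
  show thesis
  proof (rule that[OF Q(1) _ _ _ QZ])
    fix x
    show "inner (A x) x \<le> 0" if "Q x = x"
    proof -
      have "P x + A x = 0" using that Q(2)[of x] by (simp add: K_def)
      hence "A x = - P x" by (simp add: eq_neg_iff_add_eq_0 add.commute)
      thus ?thesis using P(3)[of x] by simp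
    qed
    assume Qx: "Q x = 0"
    show "0 \<le> inner (A x) x" using complement[OF Qx] P(3)[of x] by simp
    assume "inner (A x) x = 0"
    hence zero: "inner (P x) x = 0" using complement[OF Qx] by simp
    have "0 \<le> inner (P (x - P x)) (x - P x)" by (rule P(3))
    also have "\<dots> = inner (P (P x)) (P x) - 2 * (norm (P x))\<^sup>2"
      using zero by (simp add: symmetric_contraction_diff[OF P(1)] inner_diff_left inner_diff_right
          symmetric_contraction_inner[OF P(1)] power2_norm_eq_inner inner_commute)
    also have "inner (P (P x)) (P x) \<le> (norm (P x))\<^sup>2"
      using norm_cauchy_schwarz[of "P (P x)" "P x"] mult_right_mono[OF DP(4)[of "P x"], of "norm (P x)"]
      by (simp add: power2_eq_square)
    finally have "(norm (P x))\<^sup>2 \<le> 0" by simp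
    hence "P x = 0" by simp
    hence "K x = 0" using complement[OF Qx] by (simp add: K_def)
    thus "x = 0" using Q(2)[of x] Qx by simp
  qed
qed

section \<open>Sequences of projections\<close>

text \<open>By orthogonality \<open>\<parallel>Q m x - Q n x\<parallel>\<^sup>2\<close> is a difference of terms of the decreasing sequence
  \<open>\<parallel>Q n x\<parallel>\<^sup>2\<close>.\<close>

lemma decreasing_projections_converge:
  fixes Q :: "nat \<Rightarrow> 'a::chilbert_space \<Rightarrow> 'a"
  assumes proj: "\<And>n. orthogonal_projection (Q n)" and dec: "\<And>m n x. m \<le> n \<Longrightarrow> Q m (Q n x) = Q n x"
  obtains y where "(\<lambda>n. Q n x) \<longlonglongrightarrow> y" "\<And>m. Q m y = y"
proof -
  have dist: "(norm (Q m x - Q n x))\<^sup>2 = (norm (Q m x))\<^sup>2 - (norm (Q n x))\<^sup>2" if "m \<le> n" for m n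
  proof -
    have "inner (Q m x) (Q n x) = (norm (Q n x))\<^sup>2"
      by (simp add: orthogonal_projection_inner[OF proj] dec[OF that] orthogonal_projection_norm_square[OF proj])
    thus ?thesis by (simp add: norm_diff_square)
  qed
  have decs: "decseq (\<lambda>n. (norm (Q n x))\<^sup>2)"
    unfolding decseq_def using dist by (metis diff_ge_0_iff_ge zero_le_power2)
  have "convergent (\<lambda>n. (norm (Q n x))\<^sup>2)"
    by (rule decseq_convergent[OF decs, of 0]) (auto simp: convergent_def)
  hence cau: "Cauchy (\<lambda>n. (norm (Q n x))\<^sup>2)" by (rule convergent_Cauchy)
  have "Cauchy (\<lambda>n. Q n x)"
  proof (rule metric_CauchyI)
    fix e :: real assume e: "e > 0"
    then obtain N where N: "\<And>m n. m \<ge> N \<Longrightarrow> n \<ge> N \<Longrightarrow> dist ((norm (Q m x))\<^sup>2) ((norm (Q n x))\<^sup>2) < e\<^sup>2"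
      using metric_CauchyD[OF cau, of "e\<^sup>2"] by auto
    have "dist (Q m x) (Q n x) < e" if "m \<ge> N" "n \<ge> m" for m n
    proof -
      have "(norm (Q m x - Q n x))\<^sup>2 < e\<^sup>2" using dist[OF that(2)] N[of m n] that by (simp add: dist_real_def)
      thus ?thesis using e by (simp add: dist_norm power_less_imp_less_base)
    qed
    thus "\<exists>N. \<forall>m\<ge>N. \<forall>n\<ge>N. dist (Q m x) (Q n x) < e" by (metis dist_commute nle_le)
  qed
  then obtain y where y: "(\<lambda>n. Q n x) \<longlonglongrightarrow> y" using Cauchy_convergent convergent_def by blast
  have "Q m y = y" for m
  proof (rule LIMSEQ_unique)
    show "(\<lambda>n. Q m (Q n x)) \<longlonglongrightarrow> Q m y"
      by (rule bounded_linear.tendsto[OF orthogonal_projection_bounded_linear[OF proj] y])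
    show "(\<lambda>n. Q m (Q n x)) \<longlonglongrightarrow> y"
      by (rule Lim_transform_eventually[OF y]) (use eventually_ge_at_top[of m] in eventually_elim, simp add: dec)
  qed
  with y show thesis by (rule that)
qed

lemma orthogonal_projection_complement:
  "orthogonal_projection P \<Longrightarrow> orthogonal_projection (\<lambda>x. x - P x)"
  by (simp add: orthogonal_projection_def[of "\<lambda>x. x - P x"] orthogonal_projectionD orthogonal_projection_diff
      scaleC_diff_right cinner_diff_left cinner_diff_right)

section \<open>Resolvents of a self-adjoint operator\<close>

locale self_adjoint_operator =
  fixes T :: "'a::chilbert_space operator"
  assumes sa: "self_adjoint T"
begin

lemma domain_add: "x \<in> dom T \<Longrightarrow> y \<in> dom T \<Longrightarrow> x + y \<in> dom T"
  and app_add: "x \<in> dom T \<Longrightarrow> y \<in> dom T \<Longrightarrow> T \<bullet>\<^sub>o (x + y) = T \<bullet>\<^sub>o x + T \<bullet>\<^sub>o y"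
  and domain_scaleC: "x \<in> dom T \<Longrightarrow> a *\<^sub>C x \<in> dom T"
  and app_scaleC: "x \<in> dom T \<Longrightarrow> T \<bullet>\<^sub>o (a *\<^sub>C x) = a *\<^sub>C (T \<bullet>\<^sub>o x)"
  and domain_zero: "0 \<in> dom T"
  using sa unfolding self_adjoint_def linear_operator_def by blast+

lemma domain_diff: "x \<in> dom T \<Longrightarrow> y \<in> dom T \<Longrightarrow> x - y \<in> dom T"
  and app_diff: "x \<in> dom T \<Longrightarrow> y \<in> dom T \<Longrightarrow> T \<bullet>\<^sub>o (x - y) = T \<bullet>\<^sub>o x - T \<bullet>\<^sub>o y"
  using domain_add[of x "(-1) *\<^sub>C y"] app_add[of x "(-1) *\<^sub>C y"] domain_scaleC[of y "-1"] app_scaleC[of y "-1"]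
  by (simp_all add: scaleC_minus_left)

lemma domain_sequence: "\<exists>d. (\<forall>n::nat. d n \<in> dom T) \<and> d \<longlonglongrightarrow> x"
proof -
  have "x \<in> closure (dom T)" using sa by (simp add: self_adjoint_def densely_defined_def)
  thus ?thesis by (simp add: closure_sequential)
qed

lemma zero_of_zero_on_domain:
  assumes "bounded_linear P" "\<And>x. x \<in> dom T \<Longrightarrow> P x = 0" shows "P x = 0"
proof -
  obtain d where d: "\<And>n::nat. d n \<in> dom T" "d \<longlonglongrightarrow> x" using domain_sequence[of x] by blast
  have "(\<lambda>n. P (d n)) \<longlonglongrightarrow> P x" by (rule bounded_linear.tendsto[OF assms(1) d(2)])
  thus ?thesis using d(1) assms(2) by (simp add: LIMSEQ_const_iff)
qed

lemma domain_separates: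
  assumes "\<And>x. x \<in> dom T \<Longrightarrow> cinner y x = cinner z x" shows "y = z"
proof -
  obtain d where d: "\<And>n::nat. d n \<in> dom T" "d \<longlonglongrightarrow> y - z" using domain_sequence[of "y - z"] by blast
  have "(\<lambda>n. cinner (y - z) (d n)) \<longlonglongrightarrow> cinner (y - z) (y - z)"
    by (intro tendsto_cinner tendsto_const d(2))
  moreover have "cinner (y - z) (d n) = 0" for n using assms[OF d(1)] by (simp add: cinner_diff_left)
  ultimately have "cinner (y - z) (y - z) = 0" by (simp add: LIMSEQ_const_iff)
  thus ?thesis by (simp add: cinner_self)
qed

text \<open>The use of self-adjointness, as opposed to symmetry: a vector belongs to the domain as soon as it behaves
  like one in scalar products. Closedness and the bijectivity of \<open>T - z\<close> for nonreal \<open>z\<close> rest on it.\<close>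

lemma adjoint_domain:
  assumes "\<And>x. x \<in> dom T \<Longrightarrow> cinner y (T \<bullet>\<^sub>o x) = cinner z x"
  shows "y \<in> dom T" "T \<bullet>\<^sub>o y = z"
proof -
  have "(THE z. \<forall>x\<in>dom T. cinner y (T \<bullet>\<^sub>o x) = cinner z x) = z"
    using assms by (intro the_equality) (auto intro!: domain_separates)
  hence "op_adjoint T y = Some z" unfolding op_adjoint_def using assms by auto
  moreover have "op_adjoint T = T" using sa by (simp add: self_adjoint_def)
  ultimately have "T y = Some z" by simp
  thus "y \<in> dom T" "T \<bullet>\<^sub>o y = z" by (auto simp: app_def)
qed

lemma symmetric_on_domain:
  assumes y: "y \<in> dom T" and x: "x \<in> dom T" shows "cinner y (T \<bullet>\<^sub>o x) = cinner (T \<bullet>\<^sub>o y) x"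
proof -
  have eq: "op_adjoint T = T" using sa by (simp add: self_adjoint_def)
  with y have "op_adjoint T y \<noteq> None" by auto
  then obtain z where z: "\<And>x. x \<in> dom T \<Longrightarrow> cinner y (T \<bullet>\<^sub>o x) = cinner z x"
    unfolding op_adjoint_def by (auto split: if_splits)
  with adjoint_domain(2)[OF z] x show ?thesis by simp
qed

lemma closed_operator:
  assumes d: "\<And>n::nat. d n \<in> dom T" "d \<longlonglongrightarrow> x" and Td: "(\<lambda>n. T \<bullet>\<^sub>o d n) \<longlonglongrightarrow> w"
  shows "x \<in> dom T" "T \<bullet>\<^sub>o x = w"
proof -
  have *: "cinner x (T \<bullet>\<^sub>o v) = cinner w v" if v: "v \<in> dom T" for v
  proof (rule LIMSEQ_unique)
    show "(\<lambda>n. cinner (d n) (T \<bullet>\<^sub>o v)) \<longlonglongrightarrow> cinner x (T \<bullet>\<^sub>o v)" by (intro tendsto_cinner d(2) tendsto_const)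
    show "(\<lambda>n. cinner (d n) (T \<bullet>\<^sub>o v)) \<longlonglongrightarrow> cinner w v"
      unfolding symmetric_on_domain[OF d(1) v] by (intro tendsto_cinner Td tendsto_const)
  qed
  show "x \<in> dom T" "T \<bullet>\<^sub>o x = w" using adjoint_domain[OF *] by auto
qed

text \<open>The scalar product of \<open>x\<close> with \<open>T x\<close> is real, so that of \<open>x\<close> with \<open>T x - z x\<close> has imaginary part
  \<open>- Im z \<parallel>x\<parallel>\<^sup>2\<close>.\<close>

lemma resolvent_bound:
  assumes x: "x \<in> dom T" shows "\<bar>Im z\<bar> * norm x \<le> norm (T \<bullet>\<^sub>o x - z *\<^sub>C x)"
proof -
  have "Im (cinner x (T \<bullet>\<^sub>o x)) = 0"
    using symmetric_on_domain[OF x x] cinner_commute[of x "T \<bullet>\<^sub>o x"] by (metis Reals_cnj_iff complex_is_Real_iff)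
  hence "Im (cinner x (T \<bullet>\<^sub>o x - z *\<^sub>C x)) = - Im z * (norm x)\<^sup>2"
    by (simp add: cinner_diff_right cinner_scaleC_right cinner_self)
  hence "\<bar>Im z\<bar> * (norm x)\<^sup>2 = \<bar>inner (\<i> *\<^sub>C x) (T \<bullet>\<^sub>o x - z *\<^sub>C x)\<bar>"
    by (simp add: cinner_Complex abs_mult)
  also have "\<dots> \<le> norm x * norm (T \<bullet>\<^sub>o x - z *\<^sub>C x)"
    using Cauchy_Schwarz_ineq2[of "\<i> *\<^sub>C x" "T \<bullet>\<^sub>o x - z *\<^sub>C x"] by (simp add: norm_scaleC)
  finally have "norm x * (\<bar>Im z\<bar> * norm x) \<le> norm x * norm (T \<bullet>\<^sub>o x - z *\<^sub>C x)"
    by (simp add: power2_eq_square mult.left_commute)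
  thus ?thesis by (cases "norm x = 0") (simp_all add: mult_le_cancel_left)
qed

text \<open>The range of \<open>T - z\<close> is closed by the lower bound just shown, and a vector orthogonal to it would be an
  eigenvector of \<open>T\<close> for the nonreal number \<open>cnj z\<close>, which the same bound excludes.\<close>

lemma resolvent_surjective:
  assumes z: "Im z \<noteq> 0" obtains x where "x \<in> dom T" "T \<bullet>\<^sub>o x - z *\<^sub>C x = u"
proof -
  define M where "M = (\<lambda>x. T \<bullet>\<^sub>o x - z *\<^sub>C x) ` dom T"
  have cl: "closed M"
    unfolding closed_sequential_limits
  proof (intro allI impI, elim conjE)
    fix w v assume wM: "\<forall>n. w n \<in> M" and w: "w \<longlonglongrightarrow> v"
    have "\<exists>x. x \<in> dom T \<and> T \<bullet>\<^sub>o x - z *\<^sub>C x = w n" for n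
    proof -
      have "w n \<in> (\<lambda>x. T \<bullet>\<^sub>o x - z *\<^sub>C x) ` dom T" using wM by (simp add: M_def)
      then obtain x where "w n = T \<bullet>\<^sub>o x - z *\<^sub>C x" "x \<in> dom T" by (rule imageE)
      thus ?thesis by (intro exI[of _ x]) simp
    qed
    then obtain d where d: "\<And>n. d n \<in> dom T" "\<And>n. T \<bullet>\<^sub>o d n - z *\<^sub>C d n = w n" by metis
    have "Cauchy d"
    proof (rule metric_CauchyI)
      fix e :: real assume "e > 0"
      hence "0 < e * \<bar>Im z\<bar>" using z by simp
      then obtain N where N: "\<And>m n. m \<ge> N \<Longrightarrow> n \<ge> N \<Longrightarrow> dist (w m) (w n) < e * \<bar>Im z\<bar>"
        using metric_CauchyD[OF LIMSEQ_imp_Cauchy[OF w]] by metis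
      have "dist (d m) (d n) < e" if "m \<ge> N" "n \<ge> N" for m n
      proof -
        have dom: "d m \<in> dom T" "d n \<in> dom T" by (rule d(1))+
        have "\<bar>Im z\<bar> * norm (d m - d n) \<le> norm (T \<bullet>\<^sub>o (d m - d n) - z *\<^sub>C (d m - d n))"
          by (rule resolvent_bound[OF domain_diff[OF dom]])
        also have "T \<bullet>\<^sub>o (d m - d n) - z *\<^sub>C (d m - d n) = (T \<bullet>\<^sub>o d m - z *\<^sub>C d m) - (T \<bullet>\<^sub>o d n - z *\<^sub>C d n)"
          by (simp add: app_diff[OF dom] scaleC_diff_right)
        also have "\<dots> = w m - w n" by (simp only: d(2))
        also have "norm (w m - w n) < \<bar>Im z\<bar> * e" using N[OF that] by (simp add: dist_norm mult.commute)
        finally show ?thesis by (simp add: dist_norm mult_less_cancel_left)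
      qed
      thus "\<exists>N. \<forall>m\<ge>N. \<forall>n\<ge>N. dist (d m) (d n) < e" by blast
    qed
    then obtain x where x: "d \<longlonglongrightarrow> x" using Cauchy_convergent convergent_def by blast
    have "(\<lambda>n. w n + z *\<^sub>C d n) \<longlonglongrightarrow> v + z *\<^sub>C x" by (intro tendsto_add w tendsto_scaleC x)
    hence "(\<lambda>n. T \<bullet>\<^sub>o d n) \<longlonglongrightarrow> v + z *\<^sub>C x" by (simp flip: d(2))
    from closed_operator[OF d(1) x this] show "v \<in> M" by (auto simp: M_def image_iff intro!: bexI[of _ x])
  qed
  have zero: "0 \<in> M" using domain_zero app_scaleC[OF domain_zero, of 0] by (auto simp: M_def intro!: image_eqI[of _ _ 0])
  have add: "a + b \<in> M" if "a \<in> M" "b \<in> M" for a b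
  proof -
    obtain x y where "x \<in> dom T" "a = T \<bullet>\<^sub>o x - z *\<^sub>C x" "y \<in> dom T" "b = T \<bullet>\<^sub>o y - z *\<^sub>C y"
      using \<open>a \<in> M\<close> \<open>b \<in> M\<close> by (auto simp: M_def)
    thus ?thesis unfolding M_def
      by (intro image_eqI[of _ _ "x + y"]) (simp_all add: app_add domain_add scaleC_add_right)
  qed
  have scale: "c *\<^sub>C a \<in> M" if "a \<in> M" for a c
  proof -
    obtain x where "x \<in> dom T" "a = T \<bullet>\<^sub>o x - z *\<^sub>C x" using \<open>a \<in> M\<close> by (auto simp: M_def)
    thus ?thesis unfolding M_def
      by (intro image_eqI[of _ _ "c *\<^sub>C x"])
        (simp_all add: app_scaleC domain_scaleC scaleC_diff_right scaleC_scaleC mult.commute)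
  qed
  obtain p where p: "p \<in> M" "\<And>m. m \<in> M \<Longrightarrow> cinner m (u - p) = 0"
    using orthogonal_residual[OF cl zero add scale] by blast
  let ?y = "u - p"
  \<comment> \<open>the residual is an eigenvector of the adjoint for the nonreal number \<open>cnj z\<close>, hence zero\<close>
  have adj: "cinner ?y (T \<bullet>\<^sub>o x) = cinner (cnj z *\<^sub>C ?y) x" if "x \<in> dom T" for x
  proof -
    have "cinner (T \<bullet>\<^sub>o x - z *\<^sub>C x) ?y = 0" using p(2) that by (simp add: M_def)
    hence "cinner ?y (T \<bullet>\<^sub>o x - z *\<^sub>C x) = 0" by (subst cinner_commute) simp
    thus ?thesis by (simp add: cinner_diff_right cinner_scaleC_right cinner_scaleC_left)
  qed
  have "\<bar>Im (cnj z)\<bar> * norm ?y \<le> norm (T \<bullet>\<^sub>o ?y - cnj z *\<^sub>C ?y)"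
    by (rule resolvent_bound[OF adjoint_domain(1)[OF adj]])
  hence "norm ?y = 0" using adjoint_domain(2)[OF adj] z by (simp add: mult_le_0_iff)
  hence "u \<in> M" using p(1) by simp
  thus thesis using that by (auto simp: M_def)
qed

definition resolvent :: "complex \<Rightarrow> 'a \<Rightarrow> 'a"
  where "resolvent z u = (THE x. x \<in> dom T \<and> T \<bullet>\<^sub>o x - z *\<^sub>C x = u)"

lemma resolvent_app:
  assumes z: "Im z \<noteq> 0" and x: "x \<in> dom T" shows "resolvent z (T \<bullet>\<^sub>o x - z *\<^sub>C x) = x"
  unfolding resolvent_def
proof (rule the_equality)
  fix y assume y: "y \<in> dom T \<and> T \<bullet>\<^sub>o y - z *\<^sub>C y = T \<bullet>\<^sub>o x - z *\<^sub>C x"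
  have "T \<bullet>\<^sub>o (y - x) - z *\<^sub>C (y - x) = 0" using y x by (simp add: app_diff scaleC_diff_right algebra_simps)
  hence "\<bar>Im z\<bar> * norm (y - x) \<le> 0" using resolvent_bound[OF domain_diff, of y x z] y x by simp
  thus "y = x" using z by (simp add: mult_le_0_iff)
qed (use x in simp)

lemma
  assumes z: "Im z \<noteq> 0"
  shows resolvent_domain: "resolvent z u \<in> dom T"
    and app_resolvent: "T \<bullet>\<^sub>o (resolvent z u) - z *\<^sub>C resolvent z u = u"
proof -
  obtain x where x: "x \<in> dom T" "T \<bullet>\<^sub>o x - z *\<^sub>C x = u" using resolvent_surjective[OF z, of u] by blast
  with resolvent_app[OF z x(1)] have "resolvent z u = x" by simp
  with x show "resolvent z u \<in> dom T" "T \<bullet>\<^sub>o (resolvent z u) - z *\<^sub>C resolvent z u = u" by simp_all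
qed

lemma resolvent_eqI:
  "Im z \<noteq> 0 \<Longrightarrow> x \<in> dom T \<Longrightarrow> T \<bullet>\<^sub>o x - z *\<^sub>C x = u \<Longrightarrow> resolvent z u = x"
  using resolvent_app[of z x] by simp

lemma resolvent_add:
  assumes z: "Im z \<noteq> 0" shows "resolvent z (u + v) = resolvent z u + resolvent z v"
proof (rule resolvent_eqI[OF z])
  show "resolvent z u + resolvent z v \<in> dom T" by (intro domain_add resolvent_domain z)
  have "T \<bullet>\<^sub>o (resolvent z u + resolvent z v) - z *\<^sub>C (resolvent z u + resolvent z v)
    = (T \<bullet>\<^sub>o (resolvent z u) - z *\<^sub>C resolvent z u) + (T \<bullet>\<^sub>o (resolvent z v) - z *\<^sub>C resolvent z v)"
    unfolding app_add[OF resolvent_domain[OF z] resolvent_domain[OF z]] scaleC_add_right by simp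
  thus "T \<bullet>\<^sub>o (resolvent z u + resolvent z v) - z *\<^sub>C (resolvent z u + resolvent z v) = u + v"
    by (simp only: app_resolvent[OF z])
qed

lemma resolvent_scaleC:
  assumes z: "Im z \<noteq> 0" shows "resolvent z (a *\<^sub>C u) = a *\<^sub>C resolvent z u"
proof (rule resolvent_eqI[OF z])
  show "a *\<^sub>C resolvent z u \<in> dom T" by (intro domain_scaleC resolvent_domain z)
  have "T \<bullet>\<^sub>o (a *\<^sub>C resolvent z u) - z *\<^sub>C (a *\<^sub>C resolvent z u)
    = a *\<^sub>C (T \<bullet>\<^sub>o (resolvent z u) - z *\<^sub>C resolvent z u)"
    unfolding app_scaleC[OF resolvent_domain[OF z]] scaleC_diff_right scaleC_scaleC by (simp add: mult.commute)
  thus "T \<bullet>\<^sub>o (a *\<^sub>C resolvent z u) - z *\<^sub>C (a *\<^sub>C resolvent z u) = a *\<^sub>C u"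
    by (simp only: app_resolvent[OF z])
qed

lemma resolvent_norm:
  assumes z: "Im z \<noteq> 0" shows "\<bar>Im z\<bar> * norm (resolvent z u) \<le> norm u"
  using resolvent_bound[OF resolvent_domain[OF z, of u], of z] unfolding app_resolvent[OF z, of u] .

lemma resolvent_bounded_linear:
  assumes z: "Im z \<noteq> 0" shows "bounded_linear (resolvent z)"
proof (rule bounded_linear_intro)
  show "norm (resolvent z u) \<le> norm u * inverse \<bar>Im z\<bar>" for u
    using resolvent_norm[OF z, of u] z by (simp add: divide_inverse[symmetric] pos_le_divide_eq mult.commute)
qed (simp_all add: resolvent_add[OF z] resolvent_scaleC[OF z] scaleR_scaleC)

lemma resolvent_adjoint:
  assumes z: "Im z \<noteq> 0" shows "cinner (resolvent z u) v = cinner u (resolvent (cnj z) v)"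
proof -
  let ?x = "resolvent z u" and ?y = "resolvent (cnj z) v"
  have z': "Im (cnj z) \<noteq> 0" using z by simp
  have "cinner ?x v = cinner ?x (T \<bullet>\<^sub>o ?y) - cnj z * cinner ?x ?y"
    by (subst app_resolvent[OF z', of v, symmetric]) (simp add: cinner_diff_right cinner_scaleC_right)
  also have "\<dots> = cinner (T \<bullet>\<^sub>o ?x - z *\<^sub>C ?x) ?y"
    using symmetric_on_domain[OF resolvent_domain[OF z] resolvent_domain[OF z'], of u v]
    by (simp add: cinner_diff_left cinner_scaleC_left)
  finally show ?thesis by (simp add: app_resolvent[OF z])
qed

lemma resolvent_app_commute:
  assumes w: "Im w \<noteq> 0" and x: "x \<in> dom T" shows "T \<bullet>\<^sub>o (resolvent w x) = resolvent w (T \<bullet>\<^sub>o x)"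
proof -
  have "resolvent w (T \<bullet>\<^sub>o x) = resolvent w ((T \<bullet>\<^sub>o x - w *\<^sub>C x) + w *\<^sub>C x)" by simp
  also have "\<dots> = x + w *\<^sub>C resolvent w x"
    by (simp only: resolvent_add[OF w] resolvent_scaleC[OF w] resolvent_app[OF w x])
  also have "\<dots> = T \<bullet>\<^sub>o (resolvent w x)"
    by (subst app_resolvent[OF w, of x, symmetric]) simp
  finally show ?thesis by simp
qed

lemma resolvent_commute:
  assumes z: "Im z \<noteq> 0" and w: "Im w \<noteq> 0"
  shows "resolvent z (resolvent w u) = resolvent w (resolvent z u)"
proof (rule resolvent_eqI[OF z resolvent_domain[OF w]])
  let ?x = "resolvent z u"
  have "T \<bullet>\<^sub>o (resolvent w ?x) - z *\<^sub>C resolvent w ?x = resolvent w (T \<bullet>\<^sub>o ?x + (- z) *\<^sub>C ?x)"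
    unfolding resolvent_app_commute[OF w resolvent_domain[OF z]] resolvent_add[OF w] resolvent_scaleC[OF w]
    by (simp add: scaleC_minus_left)
  thus "T \<bullet>\<^sub>o (resolvent w ?x) - z *\<^sub>C resolvent w ?x = resolvent w u"
    by (simp add: scaleC_minus_left app_resolvent[OF z])
qed

section \<open>The spectral theorem\<close>

text \<open>This is the bounded operator \<open>(T - l) (1 + (T - l)\<^sup>2)\<^sup>-\<^sup>1\<close>, the real part of the resolvent at \<open>l + \<i>\<close>.
  It has the same sign as \<open>T - l\<close>, so its projection for the nonpositive half line is the spectral projection of \<open>T\<close>
  for the half line up to \<open>l\<close>.\<close>

definition sign_operator :: "real \<Rightarrow> 'a \<Rightarrow> 'a"
  where "sign_operator l u = (1/2) *\<^sub>R (resolvent (Complex l 1) u + resolvent (Complex l (-1)) u)"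

lemma symmetric_contraction_sign_operator: "symmetric_contraction (sign_operator l)"
  unfolding symmetric_contraction_def
proof (intro conjI allI)
  fix x y a
  let ?z = "Complex l 1" and ?w = "Complex l (-1)"
  have nr: "Im ?z \<noteq> 0" "Im ?w \<noteq> 0" and cnj: "cnj ?z = ?w" "cnj ?w = ?z" by (simp_all add: complex_eq_iff)
  show "sign_operator l (x + y) = sign_operator l x + sign_operator l y"
    unfolding sign_operator_def resolvent_add[OF nr(1)] resolvent_add[OF nr(2)] by (simp add: algebra_simps)
  show "sign_operator l (a *\<^sub>C x) = a *\<^sub>C sign_operator l x"
    unfolding sign_operator_def resolvent_scaleC[OF nr(1)] resolvent_scaleC[OF nr(2)]
    by (simp add: scaleC_scaleR scaleC_add_right)
  show "cinner (sign_operator l x) y = cinner x (sign_operator l y)"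
    using resolvent_adjoint[OF nr(1), of x y] resolvent_adjoint[OF nr(2), of x y] unfolding cnj
    by (simp add: sign_operator_def cinner_scaleR_left cinner_scaleR_right cinner_add_left cinner_add_right)
  show "norm (sign_operator l x) \<le> norm x"
    using norm_triangle_ineq[of "resolvent ?z x" "resolvent ?w x"] resolvent_norm[OF nr(1), of x] resolvent_norm[OF nr(2), of x]
    by (simp add: sign_operator_def)
qed

text \<open>The sign of the form of \<open>T - l\<close> at \<open>v\<close> is read off from the bounded operator at the vector \<open>u\<close> with
  \<open>v = (T - l - \<i>)\<^sup>-\<^sup>1 u\<close>; every \<open>v\<close> in the domain has this form.\<close>

lemma sign_operator_inner:
  assumes v: "v = resolvent (Complex l 1) u"
  shows "inner (sign_operator l u) u = inner v (T \<bullet>\<^sub>o v) - l * (norm v)\<^sup>2"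
proof -
  let ?z = "Complex l 1"
  have nr: "Im ?z \<noteq> 0" by simp
  have cnj: "cnj ?z = Complex l (-1)" by (simp add: complex_eq_iff)
  have "cinner v u = cinner u (resolvent (Complex l (-1)) u)"
    using resolvent_adjoint[OF nr, of u u] by (simp only: cnj v)
  hence "inner u (resolvent (Complex l (-1)) u) = inner v u" by (simp add: inner_eq_Re_cinner)
  moreover have "inner (sign_operator l u) u = (1/2) * (inner v u + inner u (resolvent (Complex l (-1)) u))"
    by (simp add: sign_operator_def v inner_add_left inner_commute[of u])
  ultimately have "inner (sign_operator l u) u = inner v u" by simp
  also have "u = T \<bullet>\<^sub>o v - ?z *\<^sub>C v" using app_resolvent[OF nr, of u] by (simp add: v)
  hence "inner v u = inner v (T \<bullet>\<^sub>o v - ?z *\<^sub>C v)" by simp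
  also have "\<dots> = inner v (T \<bullet>\<^sub>o v) - l * (norm v)\<^sup>2"
    by (simp add: inner_eq_Re_cinner cinner_diff_right cinner_scaleC_right cinner_self)
  finally show ?thesis .
qed

lemma sign_operator_commute_resolvent:
  assumes "Im z \<noteq> 0" shows "commuting (sign_operator l) (resolvent z)"
proof -
  interpret bounded_linear "resolvent z" by (rule resolvent_bounded_linear[OF assms])
  show ?thesis using assms by (simp add: commuting_def sign_operator_def resolvent_commute add scaleR)
qed

lemma sign_operator_commute: "commuting (sign_operator l) (sign_operator m)"
proof -
  interpret bounded_linear "sign_operator l"
    by (rule symmetric_contraction_bounded_linear[OF symmetric_contraction_sign_operator])
  have "sign_operator l (resolvent (Complex m s) x) = resolvent (Complex m s) (sign_operator l x)" if "s \<noteq> 0" for s x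
    using sign_operator_commute_resolvent[of "Complex m s" l] that by (simp add: commuting_def)
  thus ?thesis unfolding commuting_def sign_operator_def[of m] by (simp add: add scaleR)
qed

text \<open>The projection is chosen together with the properties that are used later; all of them are provided by
  the nonpositive spectral projection of the sign operator.\<close>

definition spec_proj :: "real \<Rightarrow> 'a \<Rightarrow> 'a"
  where "spec_proj l = (SOME Q. orthogonal_projection Q \<and>
    (\<forall>x. Q x = x \<longrightarrow> inner (sign_operator l x) x \<le> 0) \<and>
    (\<forall>x. Q x = 0 \<longrightarrow> 0 \<le> inner (sign_operator l x) x) \<and>
    (\<forall>x. Q x = 0 \<longrightarrow> inner (sign_operator l x) x = 0 \<longrightarrow> x = 0) \<and>
    (\<forall>Z. bounded_linear Z \<longrightarrow> commuting (sign_operator l) Z \<longrightarrow> commuting Q Z))"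

lemma
  shows spec_proj: "orthogonal_projection (spec_proj l)"
    and spec_proj_nonpos: "spec_proj l x = x \<Longrightarrow> inner (sign_operator l x) x \<le> 0"
    and spec_proj_nonneg: "spec_proj l x = 0 \<Longrightarrow> 0 \<le> inner (sign_operator l x) x"
    and spec_proj_pos: "spec_proj l x = 0 \<Longrightarrow> inner (sign_operator l x) x = 0 \<Longrightarrow> x = 0"
    and spec_proj_commuting: "bounded_linear Z \<Longrightarrow> commuting (sign_operator l) Z \<Longrightarrow> commuting (spec_proj l) Z"
proof -
  obtain Q where Q: "orthogonal_projection Q" "\<And>x. Q x = x \<Longrightarrow> inner (sign_operator l x) x \<le> 0"
    "\<And>x. Q x = 0 \<Longrightarrow> 0 \<le> inner (sign_operator l x) x"
    "\<And>x. Q x = 0 \<Longrightarrow> inner (sign_operator l x) x = 0 \<Longrightarrow> x = 0"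
    "\<And>Z. bounded_linear Z \<Longrightarrow> commuting (sign_operator l) Z \<Longrightarrow> commuting Q Z"
    using nonpositive_spectral_projection[OF symmetric_contraction_sign_operator[of l]] by metis
  have "orthogonal_projection (spec_proj l) \<and>
    (\<forall>x. spec_proj l x = x \<longrightarrow> inner (sign_operator l x) x \<le> 0) \<and>
    (\<forall>x. spec_proj l x = 0 \<longrightarrow> 0 \<le> inner (sign_operator l x) x) \<and>
    (\<forall>x. spec_proj l x = 0 \<longrightarrow> inner (sign_operator l x) x = 0 \<longrightarrow> x = 0) \<and>
    (\<forall>Z. bounded_linear Z \<longrightarrow> commuting (sign_operator l) Z \<longrightarrow> commuting (spec_proj l) Z)"
    unfolding spec_proj_def by (rule someI[of _ Q]) (use Q in simp)
  thus "orthogonal_projection (spec_proj l)" "spec_proj l x = x \<Longrightarrow> inner (sign_operator l x) x \<le> 0"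
    "spec_proj l x = 0 \<Longrightarrow> 0 \<le> inner (sign_operator l x) x"
    "spec_proj l x = 0 \<Longrightarrow> inner (sign_operator l x) x = 0 \<Longrightarrow> x = 0"
    "bounded_linear Z \<Longrightarrow> commuting (sign_operator l) Z \<Longrightarrow> commuting (spec_proj l) Z"
    by simp_all
qed

lemmas spec_proj_linear = orthogonal_projectionD(1,2)[OF spec_proj] orthogonal_projection_diff[OF spec_proj] orthogonal_projection_zero[OF spec_proj]

lemma spec_proj_idem: "spec_proj l (spec_proj l x) = spec_proj l x" by (rule orthogonal_projectionD(3)[OF spec_proj])

lemma spec_proj_bounded_linear: "bounded_linear (spec_proj l)" by (rule orthogonal_projection_bounded_linear[OF spec_proj])

lemma spec_proj_resolvent: "Im z \<noteq> 0 \<Longrightarrow> spec_proj l (resolvent z x) = resolvent z (spec_proj l x)"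
  using spec_proj_commuting[OF resolvent_bounded_linear[of z] sign_operator_commute_resolvent[of z l]] by (simp add: commuting_def)

lemma spec_proj_commute: "spec_proj l (spec_proj m x) = spec_proj m (spec_proj l x)"
proof -
  have "commuting (spec_proj m) (sign_operator l)"
    by (intro spec_proj_commuting sign_operator_commute symmetric_contraction_bounded_linear symmetric_contraction_sign_operator)
  hence "commuting (sign_operator l) (spec_proj m)" by (simp add: commuting_def)
  from spec_proj_commuting[OF spec_proj_bounded_linear this] show ?thesis by (simp add: commuting_def)
qed

lemma spec_proj_reduces:
  assumes x: "x \<in> dom T" shows "spec_proj l x \<in> dom T" "T \<bullet>\<^sub>o (spec_proj l x) = spec_proj l (T \<bullet>\<^sub>o x)"
proof -
  have nr: "Im \<i> \<noteq> 0" by simp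
  let ?u = "T \<bullet>\<^sub>o x - \<i> *\<^sub>C x"
  have eq: "spec_proj l x = resolvent \<i> (spec_proj l ?u)"
    using spec_proj_resolvent[OF nr, of l ?u] by (simp only: resolvent_app[OF nr x])
  thus "spec_proj l x \<in> dom T" by (simp add: resolvent_domain[OF nr])
  have "T \<bullet>\<^sub>o (spec_proj l x) - \<i> *\<^sub>C spec_proj l x = spec_proj l ?u" unfolding eq by (rule app_resolvent[OF nr])
  thus "T \<bullet>\<^sub>o (spec_proj l x) = spec_proj l (T \<bullet>\<^sub>o x)" by (simp add: spec_proj_linear)
qed

lemma spec_proj_form_le:
  assumes v: "v \<in> dom T" "spec_proj l v = v" shows "inner v (T \<bullet>\<^sub>o v) \<le> l * (norm v)\<^sup>2"
proof -
  let ?u = "T \<bullet>\<^sub>o v - Complex l 1 *\<^sub>C v"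
  have eq: "v = resolvent (Complex l 1) ?u" using resolvent_app[OF _ v(1), of "Complex l 1"] by simp
  have "spec_proj l ?u = ?u" using spec_proj_reduces(2)[OF v(1), of l] v(2) by (simp add: spec_proj_linear)
  from spec_proj_nonpos[OF this] show ?thesis unfolding sign_operator_inner[OF eq] by simp
qed

lemma spec_proj_form_ge:
  assumes v: "v \<in> dom T" "spec_proj l v = 0"
  shows "l * (norm v)\<^sup>2 \<le> inner v (T \<bullet>\<^sub>o v)" "inner v (T \<bullet>\<^sub>o v) = l * (norm v)\<^sup>2 \<Longrightarrow> v = 0"
proof -
  let ?u = "T \<bullet>\<^sub>o v - Complex l 1 *\<^sub>C v"
  have eq: "v = resolvent (Complex l 1) ?u" using resolvent_app[OF _ v(1), of "Complex l 1"] by simp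
  have "T \<bullet>\<^sub>o 0 = 0" using app_scaleC[OF domain_zero, of 0] by simp
  hence u: "spec_proj l ?u = 0" using spec_proj_reduces(2)[OF v(1), of l] v(2) by (simp add: spec_proj_linear)
  from spec_proj_nonneg[OF u] show "l * (norm v)\<^sup>2 \<le> inner v (T \<bullet>\<^sub>o v)" unfolding sign_operator_inner[OF eq] by simp
  assume "inner v (T \<bullet>\<^sub>o v) = l * (norm v)\<^sup>2"
  hence "?u = 0" using spec_proj_pos[OF u] unfolding sign_operator_inner[OF eq] by simp
  thus "v = 0" using eq linear_0[OF bounded_linear.linear[OF resolvent_bounded_linear[of "Complex l 1"]]] by simp
qed

text \<open>On the intersection of the range of \<open>spec_proj l\<close> with the kernel of \<open>spec_proj m\<close> the form of \<open>T\<close> is at most \<open>l\<close>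
  and at least \<open>m\<close>.\<close>

lemma spec_proj_mono:
  assumes "l \<le> m" shows "spec_proj l (spec_proj m x) = spec_proj l x"
proof (cases "l = m")
  case False
  hence less: "l < m" using assms by simp
  have "spec_proj l (x - spec_proj m x) = 0" for x
  proof (rule zero_of_zero_on_domain[where P="\<lambda>x. spec_proj l (x - spec_proj m x)"])
    show "bounded_linear (\<lambda>x. spec_proj l (x - spec_proj m x))"
      by (intro bounded_linear_compose[OF spec_proj_bounded_linear] bounded_linear_sub bounded_linear_ident spec_proj_bounded_linear)
    fix x assume x: "x \<in> dom T"
    let ?v = "spec_proj l (x - spec_proj m x)"
    have v: "?v \<in> dom T" by (intro spec_proj_reduces domain_diff x)
    have "spec_proj l ?v = ?v" by (rule spec_proj_idem)
    moreover have "spec_proj m ?v = 0" by (simp add: spec_proj_commute[of m l] spec_proj_linear spec_proj_idem)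
    ultimately have "m * (norm ?v)\<^sup>2 \<le> l * (norm ?v)\<^sup>2"
      using spec_proj_form_le[OF v, of l] spec_proj_form_ge(1)[OF v, of m] by simp
    hence "(norm ?v)\<^sup>2 \<le> 0" using less by (metis less_le_not_le mult_le_cancel_right not_le)
    thus "?v = 0" by simp
  qed
  thus ?thesis by (simp add: spec_proj_linear)
qed (simp add: spec_proj_idem)

lemma spec_proj_min: "spec_proj s (spec_proj t x) = spec_proj (min s t) x"
  using spec_proj_mono[of s t x] spec_proj_mono[of t s x] spec_proj_commute[of s t x] by (simp add: min_def)

text \<open>The limit \<open>y\<close> of the projections applied to a vector lies in all ranges. It need not be in the domain
  of \<open>T\<close>, but its image under the resolvent is, and still lies in all ranges.\<close>

lemma decreasing_projections_vanish:
  assumes proj: "\<And>n. orthogonal_projection (Q n)" and dec: "\<And>m n x. m \<le> n \<Longrightarrow> Q m (Q n x) = Q n x"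
    and res: "\<And>n u. Q n (resolvent \<i> u) = resolvent \<i> (Q n u)"
    and trivial: "\<And>v. v \<in> dom T \<Longrightarrow> (\<And>n. Q n v = v) \<Longrightarrow> v = 0"
  shows "(\<lambda>n. norm (Q n x)) \<longlonglongrightarrow> 0"
proof -
  obtain y where y: "(\<lambda>n. Q n x) \<longlonglongrightarrow> y" "\<And>m. Q m y = y"
    using decreasing_projections_converge[of Q x, OF proj dec] by blast
  have nr: "Im \<i> \<noteq> 0" by simp
  have "resolvent \<i> y = 0" by (rule trivial) (simp_all add: resolvent_domain res y(2))
  hence "y = 0" using app_resolvent[OF nr, of y] app_scaleC[OF domain_zero, of 0] by simp
  thus ?thesis using tendsto_norm[OF y(1)] by simp
qed

lemma spec_proj_right_limit:
  "((\<lambda>s. spec_proj s x) \<longlongrightarrow> spec_proj t x) (at_right t)"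
proof -
  define r where "r n = t + inverse (real (Suc n))" for n
  have rt: "t \<le> r n" for n by (simp add: r_def)
  have rdec: "r n \<le> r m" if "m \<le> n" for m n using that by (simp add: r_def le_imp_inverse_le)
  let ?Q = "\<lambda>n x. spec_proj (r n) x - spec_proj t x"
  have lim: "(\<lambda>n. norm (?Q n x)) \<longlonglongrightarrow> 0"
  proof (rule decreasing_projections_vanish[where Q="?Q"])
    have "cinner (spec_proj l x) y = cinner x (spec_proj l y)" for l x y
      by (rule orthogonal_projectionD(4)[OF spec_proj])
    thus "orthogonal_projection (?Q n)" for n
      using rt[of n] unfolding orthogonal_projection_def
      by (auto simp: spec_proj_linear spec_proj_min min_absorb1 min_absorb2
          scaleC_diff_right cinner_diff_left cinner_diff_right)
    show "?Q m (?Q n x) = ?Q n x" if "m \<le> n" for m n x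
      using rt[of n] rt[of m] rdec[OF that]
      by (simp add: spec_proj_linear spec_proj_min min_absorb1 min_absorb2)
    show "?Q n (resolvent \<i> u) = resolvent \<i> (?Q n u)" for n u
      using linear_diff[OF bounded_linear.linear[OF resolvent_bounded_linear[of \<i>]]]
      by (simp add: spec_proj_resolvent)
    fix v assume v: "v \<in> dom T" and Q: "\<And>n. ?Q n v = v"
    have "spec_proj t (?Q 0 v) = 0"
      using rt[of 0] by (simp add: spec_proj_linear spec_proj_min min_absorb1)
    hence tv: "spec_proj t v = 0" by (simp only: Q)
    have "inner v (T \<bullet>\<^sub>o v) \<le> t * (norm v)\<^sup>2"
    proof (rule tendsto_lowerbound)
      show "(\<lambda>n. r n * (norm v)\<^sup>2) \<longlonglongrightarrow> t * (norm v)\<^sup>2"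
        unfolding r_def using tendsto_mult[OF tendsto_add[OF tendsto_const LIMSEQ_inverse_real_of_nat] tendsto_const, of t] by simp
      show "\<forall>\<^sub>F n in sequentially. inner v (T \<bullet>\<^sub>o v) \<le> r n * (norm v)\<^sup>2"
        by (intro always_eventually allI spec_proj_form_le v) (use Q tv in simp)
    qed simp
    thus "v = 0" using spec_proj_form_ge[OF v tv] by linarith
  qed
  show ?thesis
    unfolding tendsto_iff
  proof (intro allI impI)
    fix e :: real assume "e > 0"
    then obtain n where n: "norm (?Q n x) < e"
      using order_tendstoD(2)[OF lim] by (auto simp: eventually_sequentially)
    have "\<forall>\<^sub>F s in at_right t. s < r n" by (rule order_tendstoD(2)[OF tendsto_ident_at]) (simp add: r_def)
    moreover have "\<forall>\<^sub>F s in at_right t. t < s" by (simp add: eventually_at_right_less)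
    ultimately show "\<forall>\<^sub>F s in at_right t. dist (spec_proj s x) (spec_proj t x) < e"
    proof eventually_elim
      case (elim s)
      have "spec_proj s x - spec_proj t x = spec_proj s (?Q n x)"
        using elim by (simp add: spec_proj_linear spec_proj_min min_absorb1 min_absorb2)
      thus ?case using orthogonal_projection_norm_le[OF spec_proj, of s "?Q n x"] n by (simp add: dist_norm)
    qed
  qed
qed

lemma zero_of_unbounded_form:
  assumes le: "\<And>n::nat. real n * (norm v)\<^sup>2 \<le> \<bar>inner v (T \<bullet>\<^sub>o v)\<bar>" shows "v = 0"
proof (rule ccontr)
  assume "v \<noteq> 0"
  obtain n where "\<bar>inner v (T \<bullet>\<^sub>o v)\<bar> / (norm v)\<^sup>2 < real n" using reals_Archimedean2 by blast
  with le[of n] \<open>v \<noteq> 0\<close> show False by (simp add: field_simps)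
qed

lemma spec_proj_at_bot: "((\<lambda>s. spec_proj s x) \<longlongrightarrow> 0) at_bot"
proof -
  let ?Q = "\<lambda>n. spec_proj (- real n)"
  have lim: "(\<lambda>n. norm (?Q n x)) \<longlonglongrightarrow> 0"
  proof (rule decreasing_projections_vanish[where Q="?Q"])
    fix v assume v: "v \<in> dom T" and Q: "\<And>n. ?Q n v = v"
    have "real n * (norm v)\<^sup>2 \<le> \<bar>inner v (T \<bullet>\<^sub>o v)\<bar>" for n
      using spec_proj_form_le[OF v Q[of n]] by simp
    thus "v = 0" by (rule zero_of_unbounded_form)
  qed (simp_all add: spec_proj spec_proj_min min_absorb2 spec_proj_resolvent)
  show ?thesis
    unfolding tendsto_iff
  proof (intro allI impI)
    fix e :: real assume "e > 0"
    then obtain n where n: "norm (?Q n x) < e"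
      using order_tendstoD(2)[OF lim] by (auto simp: eventually_sequentially)
    show "\<forall>\<^sub>F s in at_bot. dist (spec_proj s x) 0 < e"
      using eventually_le_at_bot[of "- real n"]
    proof eventually_elim
      case (elim s)
      have "spec_proj s x = spec_proj s (?Q n x)" using elim by (simp add: spec_proj_min min_absorb1)
      thus ?case using orthogonal_projection_norm_le[OF spec_proj, of s "?Q n x"] n by simp
    qed
  qed
qed

lemma spec_proj_at_top: "((\<lambda>s. spec_proj s x) \<longlongrightarrow> x) at_top"
proof -
  let ?Q = "\<lambda>n x. x - spec_proj (real n) x"
  have lim: "(\<lambda>n. norm (?Q n x)) \<longlonglongrightarrow> 0"
  proof (rule decreasing_projections_vanish[where Q="?Q"])
    show "orthogonal_projection (?Q n)" for n by (rule orthogonal_projection_complement[OF spec_proj])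
    show "?Q n (resolvent \<i> u) = resolvent \<i> (?Q n u)" for n u
      using linear_diff[OF bounded_linear.linear[OF resolvent_bounded_linear[of \<i>]]]
      by (simp add: spec_proj_resolvent)
    fix v assume v: "v \<in> dom T" and Q: "\<And>n. ?Q n v = v"
    have "real n * (norm v)\<^sup>2 \<le> \<bar>inner v (T \<bullet>\<^sub>o v)\<bar>" for n
      using spec_proj_form_ge(1)[OF v, of "real n"] Q[of n] by simp
    thus "v = 0" by (rule zero_of_unbounded_form)
  qed (simp add: spec_proj_linear spec_proj_min min_absorb1)
  show ?thesis
    unfolding tendsto_iff
  proof (intro allI impI)
    fix e :: real assume "e > 0"
    then obtain n where n: "norm (?Q n x) < e"
      using order_tendstoD(2)[OF lim] by (auto simp: eventually_sequentially)
    show "\<forall>\<^sub>F s in at_top. dist (spec_proj s x) x < e"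
      using eventually_ge_at_top[of "real n"]
    proof eventually_elim
      case (elim s)
      have "x - spec_proj s x = ?Q n x - spec_proj s (?Q n x)"
        using elim by (simp add: spec_proj_linear spec_proj_min min_absorb2)
      hence "norm (x - spec_proj s x) \<le> norm (?Q n x)"
        using orthogonal_projection_norm_le[OF orthogonal_projection_complement[OF spec_proj[of s]], of "?Q n x"]
        by (simp only:)
      thus ?case using n by (simp add: dist_norm norm_minus_commute)
    qed
  qed
qed

lemma spectral_family_spec_proj: "spectral_family spec_proj"
  unfolding spectral_family_def
  using spec_proj spec_proj_min spec_proj_right_limit
    spec_proj_at_bot spec_proj_at_top by blast

text \<open>On the part of the space between \<open>a\<close> and \<open>b\<close> the form of \<open>T - c\<close>, with the midpoint \<open>c\<close>, is at
  most \<open>(b - a) / 2\<close>; polarisation turns this into a norm bound. The second vector of the polarised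
  form should be a multiple of \<open>T y - c y\<close>, which need not lie in the domain and is approximated.\<close>

lemma spec_proj_midpoint_bound:
  assumes ab: "a \<le> b" and y: "y \<in> dom T" "spec_proj b y = y" "spec_proj a y = 0"
  shows "norm (T \<bullet>\<^sub>o y - ((a + b) / 2) *\<^sub>R y) \<le> (b - a) / 2 * norm y"
proof -
  let ?c = "(a + b) / 2" and ?r = "(b - a) / 2"
  let ?L = "\<lambda>v. T \<bullet>\<^sub>o v - ?c *\<^sub>R v"
  let ?P = "\<lambda>v. spec_proj b v - spec_proj a v"
  define q where "q v = inner v (?L v)" for v
  have q: "\<bar>q v\<bar> \<le> ?r * (norm v)\<^sup>2" if v: "v \<in> dom T" "spec_proj b v = v" "spec_proj a v = 0" for v
    using spec_proj_form_le[OF v(1,2)] spec_proj_form_ge(1)[OF v(1,3)]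
    by (simp add: q_def inner_diff_right power2_norm_eq_inner[symmetric] abs_le_iff field_simps)
  have Ldiff: "inner v (?L w) = inner (?L v) w" if "v \<in> dom T" "w \<in> dom T" for v w
    using symmetric_on_domain[OF that] by (simp add: inner_diff_left inner_diff_right inner_eq_Re_cinner
        cinner_scaleR_left cinner_scaleR_right cinner_diff_left cinner_diff_right)
  have polar: "4 * inner w (?L y) \<le> ?r * (2 * (norm y)\<^sup>2 + 2 * (norm w)\<^sup>2)"
    if w: "w \<in> dom T" "spec_proj b w = w" "spec_proj a w = 0" for w
  proof -
    have "q (y + w) - q (y - w) = 4 * inner w (?L y)"
    proof -
      define g k where "g = ?L y" and "k = ?L w"
      have "?L (y + w) = g + k" "?L (y - w) = g - k"
        unfolding g_def k_def app_add[OF y(1) w(1)] app_diff[OF y(1) w(1)] by (simp_all add: algebra_simps)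
      moreover have "inner y k = inner w g" using Ldiff[OF y(1) w(1)] by (simp only: g_def k_def inner_commute)
      ultimately have "q (y + w) - q (y - w) = 4 * inner w g"
        by (simp add: q_def inner_add_left inner_add_right inner_diff_left inner_diff_right)
      thus ?thesis by (simp only: g_def)
    qed
    moreover have "\<bar>q (y + w)\<bar> \<le> ?r * (norm (y + w))\<^sup>2" "\<bar>q (y - w)\<bar> \<le> ?r * (norm (y - w))\<^sup>2"
      using y w by (intro q; simp add: domain_add domain_diff spec_proj_linear)+
    ultimately have "4 * inner w (?L y) \<le> ?r * ((norm (y + w))\<^sup>2 + (norm (y - w))\<^sup>2)"
      by (simp add: distrib_left)
    thus ?thesis by (simp only: parallelogram)
  qed
  have polar': "4 * inner w (?L y) \<le> ?r * (2 * (norm y)\<^sup>2 + 2 * (norm w)\<^sup>2)" if w: "?P w = w" for w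
  proof -
    obtain d where d: "\<And>n::nat. d n \<in> dom T" "d \<longlonglongrightarrow> w" using domain_sequence[of w] by blast
    have lim: "(\<lambda>n. ?P (d n)) \<longlonglongrightarrow> w"
      using tendsto_diff[OF bounded_linear.tendsto[OF spec_proj_bounded_linear d(2)]
          bounded_linear.tendsto[OF spec_proj_bounded_linear d(2)], of b a] by (simp only: w)
    show ?thesis
    proof (rule tendsto_le)
      show "(\<lambda>n. 4 * inner (?P (d n)) (?L y)) \<longlonglongrightarrow> 4 * inner w (?L y)" by (intro tendsto_intros lim)
      show "(\<lambda>n. ?r * (2 * (norm y)\<^sup>2 + 2 * (norm (?P (d n)))\<^sup>2)) \<longlonglongrightarrow> ?r * (2 * (norm y)\<^sup>2 + 2 * (norm w)\<^sup>2)"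
        by (intro tendsto_intros lim)
      show "\<forall>\<^sub>F n in sequentially. 4 * inner (?P (d n)) (?L y) \<le> ?r * (2 * (norm y)\<^sup>2 + 2 * (norm (?P (d n)))\<^sup>2)"
        using ab by (intro always_eventually allI polar)
          (simp_all add: domain_diff spec_proj_reduces d(1) spec_proj_linear spec_proj_min)
    qed simp
  qed
  let ?g = "?L y"
  have Pg: "?P ?g = ?g"
  proof -
    have "spec_proj b (T \<bullet>\<^sub>o y) = T \<bullet>\<^sub>o y" using spec_proj_reduces(2)[OF y(1), of b] y(2) by simp
    moreover have "spec_proj a (T \<bullet>\<^sub>o y) = 0"
      using spec_proj_reduces(2)[OF y(1), of a] y(3) app_scaleC[OF domain_zero, of 0] by simp
    ultimately show ?thesis
      by (simp add: spec_proj_linear orthogonal_projection_scaleR[OF spec_proj] y)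
  qed
  show ?thesis
  proof (cases "y = 0 \<or> ?g = 0")
    case True
    thus ?thesis using ab app_scaleC[OF domain_zero, of 0] by auto
  next
    case False
    let ?s = "norm y / norm ?g"
    have "?P (r *\<^sub>R v) = r *\<^sub>R ?P v" for r v
      by (simp add: orthogonal_projection_scaleR[OF spec_proj] scaleR_right_diff_distrib)
    from this[of ?s ?g] have "?P (?s *\<^sub>R ?g) = ?s *\<^sub>R ?g" by (simp only: Pg)
    from polar'[OF this] have "4 * (?s * (norm ?g)\<^sup>2) \<le> ?r * (2 * (norm y)\<^sup>2 + 2 * (?s * norm ?g)\<^sup>2)"
      by (simp add: power2_norm_eq_inner)
    moreover have "?s * (norm ?g)\<^sup>2 = norm y * norm ?g" "?s * norm ?g = norm y"
      using False by (simp_all add: power2_eq_square)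
    ultimately have "4 * (norm y * norm ?g) \<le> ?r * (2 * (norm y)\<^sup>2 + 2 * (norm y)\<^sup>2)" by (simp only:)
    also have "\<dots> = 4 * (norm y * (?r * norm y))" by (simp add: power2_eq_square)
    finally have "norm y * norm ?g \<le> norm y * (?r * norm y)" by linarith
    hence "norm ?g \<le> ?r * norm y" by (rule mult_left_le_imp_le) (use False in simp)
    thus ?thesis .
  qed
qed

lemma spec_proj_local_bound:
  assumes ab: "a \<le> b" and y: "spec_proj b y = y" "spec_proj a y = 0"
  shows "y \<in> dom T" "norm (T \<bullet>\<^sub>o y - a *\<^sub>R y) \<le> (b - a) * norm y"
proof -
  have bound: "norm (T \<bullet>\<^sub>o y - a *\<^sub>R y) \<le> (b - a) * norm y"
    if y: "y \<in> dom T" "spec_proj b y = y" "spec_proj a y = 0" for y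
  proof -
    have "(a + b) / 2 = a + (b - a) / 2" by (simp add: field_simps)
    hence "((a + b) / 2) *\<^sub>R y = a *\<^sub>R y + ((b - a) / 2) *\<^sub>R y" by (simp only: scaleR_left_distrib)
    hence "T \<bullet>\<^sub>o y - a *\<^sub>R y = (T \<bullet>\<^sub>o y - ((a + b) / 2) *\<^sub>R y) + ((b - a) / 2) *\<^sub>R y" by simp
    hence "norm (T \<bullet>\<^sub>o y - a *\<^sub>R y) \<le> norm (T \<bullet>\<^sub>o y - ((a + b) / 2) *\<^sub>R y) + norm (((b - a) / 2) *\<^sub>R y)"
      by (simp only: norm_triangle_ineq)
    also have "\<dots> \<le> (b - a) / 2 * norm y + (b - a) / 2 * norm y"
      by (intro add_mono spec_proj_midpoint_bound[OF ab y]) (use ab in simp)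
    finally show ?thesis by (simp add: mult.commute)
  qed
  obtain d where d: "\<And>n::nat. d n \<in> dom T" "d \<longlonglongrightarrow> y" using domain_sequence[of y] by blast
  let ?d = "\<lambda>n. spec_proj b (d n) - spec_proj a (d n)"
  have lim: "?d \<longlonglongrightarrow> y"
    using tendsto_diff[OF bounded_linear.tendsto[OF spec_proj_bounded_linear d(2)]
        bounded_linear.tendsto[OF spec_proj_bounded_linear d(2)], of b a] by (simp add: y)
  have dom: "?d n \<in> dom T" for n by (intro domain_diff spec_proj_reduces d(1))
  have range: "spec_proj b (?d m - ?d n) = ?d m - ?d n" "spec_proj a (?d m - ?d n) = 0" for m n
    using ab by (simp_all add: spec_proj_linear spec_proj_min min_absorb1)
  let ?g = "\<lambda>n. T \<bullet>\<^sub>o (?d n) - a *\<^sub>R ?d n"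
  have "Cauchy ?g"
  proof (rule metric_CauchyI)
    fix e :: real assume "e > 0"
    hence "0 < e / (b - a + 1)" using ab by simp
    then obtain N where N: "\<And>m n. m \<ge> N \<Longrightarrow> n \<ge> N \<Longrightarrow> dist (?d m) (?d n) < e / (b - a + 1)"
      using metric_CauchyD[OF LIMSEQ_imp_Cauchy[OF lim]] by metis
    have "dist (?g m) (?g n) < e" if "m \<ge> N" "n \<ge> N" for m n
    proof -
      have "?g m - ?g n = T \<bullet>\<^sub>o (?d m - ?d n) - a *\<^sub>R (?d m - ?d n)"
        unfolding app_diff[OF dom dom] by (simp add: algebra_simps)
      hence "dist (?g m) (?g n) \<le> (b - a) * norm (?d m - ?d n)"
        using bound[OF domain_diff[OF dom dom] range] by (simp only: dist_norm)
      also have "\<dots> \<le> (b - a + 1) * norm (?d m - ?d n)" by (intro mult_right_mono) auto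
      also have "\<dots> < e" using N[OF that] ab by (simp add: dist_norm pos_less_divide_eq mult.commute)
      finally show ?thesis .
    qed
    thus "\<exists>N. \<forall>m\<ge>N. \<forall>n\<ge>N. dist (?g m) (?g n) < e" by blast
  qed
  then obtain w where w: "?g \<longlonglongrightarrow> w" using Cauchy_convergent convergent_def by blast
  have "(\<lambda>n. ?g n + a *\<^sub>R ?d n) \<longlonglongrightarrow> w + a *\<^sub>R y" by (intro tendsto_intros w lim)
  hence "(\<lambda>n. T \<bullet>\<^sub>o (?d n)) \<longlonglongrightarrow> w + a *\<^sub>R y" by simp
  from closed_operator(1)[OF dom lim this] show ydom: "y \<in> dom T" .
  show "norm (T \<bullet>\<^sub>o y - a *\<^sub>R y) \<le> (b - a) * norm y" by (rule bound[OF ydom y])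
qed

text \<open>A Riemann sum with mesh \<open>h\<close> approximates both the identity function and \<open>T\<close> up to \<open>h\<close>: the errors
  made on the pieces are orthogonal, so their squares add up.\<close>

lemma riemann_sum:
  assumes h: "0 \<le> h" and "b = a + real n * h" and "d = spec_proj b x - spec_proj a x"
  shows "\<exists>S\<in>step_lists.
    (\<forall>t. t \<notin> {a<..b} \<longrightarrow> step_function S t = 0) \<and>
    (\<forall>t\<in>{a<..b}. cmod (complex_of_real t - step_function S t) \<le> h) \<and>
    spec_proj b (T \<bullet>\<^sub>o d - step_integral spec_proj S x)
      = T \<bullet>\<^sub>o d - step_integral spec_proj S x \<and>
    (norm (T \<bullet>\<^sub>o d - step_integral spec_proj S x))\<^sup>2 \<le> h\<^sup>2 * (norm d)\<^sup>2"
  using assms(2,3)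
proof (induction n arbitrary: b d)
  case 0
  thus ?case using app_scaleC[OF domain_zero, of 0]
    by (intro bexI[of _ "[]"]) (simp_all add: spec_proj_linear)
next
  case (Suc n b' D)
  let ?E = spec_proj
  define b where "b = a + real n * h"
  have bb': "b' - b = h" and ab: "a \<le> b" and le: "b \<le> b'"
    using h by (simp_all add: b_def Suc.prems(1) algebra_simps)
  define d where "d = ?E b x - ?E a x"
  obtain S where S: "S \<in> step_lists" and out: "\<forall>t. t \<notin> {a<..b} \<longrightarrow> step_function S t = 0"
    and inside: "\<forall>t\<in>{a<..b}. cmod (complex_of_real t - step_function S t) \<le> h"
    and S_range: "?E b (T \<bullet>\<^sub>o d - step_integral ?E S x) = T \<bullet>\<^sub>o d - step_integral ?E S x"
    and S_norm: "(norm (T \<bullet>\<^sub>o d - step_integral ?E S x))\<^sup>2 \<le> h\<^sup>2 * (norm d)\<^sup>2"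
    using Suc.IH[OF b_def d_def] by (elim bexE conjE)
  define e where "e = T \<bullet>\<^sub>o d - step_integral ?E S x"
  have eb: "?E b e = e" and en: "(norm e)\<^sup>2 \<le> h\<^sup>2 * (norm d)\<^sup>2" using S_range S_norm by (simp_all add: e_def)
  define d' where "d' = ?E b' x - ?E b x"
  have d': "?E b' d' = d'" "?E b d' = 0" using le by (simp_all add: d'_def spec_proj_linear spec_proj_min min_absorb1)
  note local = spec_proj_local_bound[OF le d']
  define e' where "e' = T \<bullet>\<^sub>o d' - b *\<^sub>R d'"
  have Td': "?E b' (T \<bullet>\<^sub>o d') = T \<bullet>\<^sub>o d'" "?E b (T \<bullet>\<^sub>o d') = 0"
    using spec_proj_reduces(2)[OF local(1), of b'] spec_proj_reduces(2)[OF local(1), of b] d'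
      app_scaleC[OF domain_zero, of 0] by simp_all
  have e': "?E b' e' = e'" "?E b e' = 0"
    by (simp_all add: e'_def spec_proj_linear orthogonal_projection_scaleR[OF spec_proj] d' Td')
  have "(norm e')\<^sup>2 \<le> (h * norm d')\<^sup>2" using local(2) by (intro power_mono) (simp_all add: e'_def bb')
  hence e'n: "(norm e')\<^sup>2 \<le> h\<^sup>2 * (norm d')\<^sup>2" by (simp add: power_mult_distrib)
  have ortho: "inner u v = 0" if "?E b u = u" "?E b v = 0" for u v
    using orthogonal_projection_inner[OF spec_proj, of b u v] that by simp
  have db: "?E b d = d" using ab by (simp add: d_def spec_proj_linear spec_proj_min min_absorb2)
  have D: "D = d + d'" by (simp add: d_def d'_def Suc.prems(2))
  have "?E a d = 0" using ab by (simp add: d_def spec_proj_linear spec_proj_min min_absorb1)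
  hence ddom: "d \<in> dom T" using spec_proj_local_bound(1)[OF ab db] by simp
  let ?S = "(complex_of_real b, b, b') # S"
  have err: "T \<bullet>\<^sub>o (d + d') - step_integral ?E ?S x = e + e'"
    using app_add[OF ddom local(1)] by (simp add: e_def e'_def scaleC_of_real flip: d'_def)
  have "?E b' e = e" using eb spec_proj_min[of b' b e] le by (simp add: min_absorb2)
  hence fixed: "?E b' (e + e') = e + e'" by (simp add: spec_proj_linear e')
  have "(norm (e + e'))\<^sup>2 = (norm e)\<^sup>2 + (norm e')\<^sup>2" by (simp add: norm_add_square ortho eb e')
  also have "\<dots> \<le> h\<^sup>2 * ((norm d)\<^sup>2 + (norm d')\<^sup>2)" using en e'n by (simp add: distrib_left)
  also have "(norm d)\<^sup>2 + (norm d')\<^sup>2 = (norm (d + d'))\<^sup>2" by (simp add: norm_add_square ortho db d')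
  finally have norm: "(norm (e + e'))\<^sup>2 \<le> h\<^sup>2 * (norm (d + d'))\<^sup>2" .
  have steps: "?S \<in> step_lists" using S le by (simp add: step_lists_Cons)
  have zero: "step_function ?S t = 0" if "t \<notin> {a<..b'}" for t
    using that out ab le by (auto simp: indicator_def)
  have near: "cmod (complex_of_real t - step_function ?S t) \<le> h" if t: "t \<in> {a<..b'}" for t
  proof (cases "t \<le> b")
    case True
    thus ?thesis using inside t by (simp add: indicator_def)
  next
    case False
    hence "step_function ?S t = complex_of_real b" using out t by (simp add: indicator_def)
    moreover have "cmod (complex_of_real t - complex_of_real b) = \<bar>t - b\<bar>"
      by (metis norm_of_real of_real_diff)
    ultimately show ?thesis using False t bb' by simp
  qed
  show ?case
  proof (rule bexI[OF _ steps], intro conjI allI ballI impI)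
    show "step_function ?S t = 0" if "t \<notin> {a<..b'}" for t by (rule zero[OF that])
    show "cmod (complex_of_real t - step_function ?S t) \<le> h" if "t \<in> {a<..b'}" for t by (rule near[OF that])
    show "?E b' (T \<bullet>\<^sub>o D - step_integral ?E ?S x) = T \<bullet>\<^sub>o D - step_integral ?E ?S x"
      unfolding D err by (rule fixed)
    show "(norm (T \<bullet>\<^sub>o D - step_integral ?E ?S x))\<^sup>2 \<le> h\<^sup>2 * (norm D)\<^sup>2"
      unfolding D err by (rule norm)
  qed
qed

text \<open>Let \<open>P n\<close> be the projection for the interval from \<open>- n\<close> to \<open>n\<close>. Riemann sums with mesh \<open>1/n\<close> on this
  interval (with \<open>n + 1\<close> for \<open>n\<close>, to keep the mesh finite) are close to
  \<open>T (P n x)\<close> as vectors and to the identity as functions. If \<open>\<lambda>\<^sup>2\<close> is integrable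
  at \<open>x\<close>, then \<open>T (P n x)\<close> converges to the spectral integral, and closedness of \<open>T\<close> puts \<open>x\<close> into its
  domain. If conversely \<open>x\<close> is in the domain, then \<open>T (P n x) = P n (T x)\<close> is bounded, and so are the
  truncated integrals of \<open>\<lambda>\<^sup>2\<close>.\<close>

theorem spectral_integral_spec_proj: "spectral_integral spec_proj complex_of_real = T"
proof -
  let ?E = spec_proj and ?id = complex_of_real
  note SF = spectral_family_spec_proj
  let ?J = "spectral_integral ?E ?id"
  have id: "?id \<in> borel_measurable borel" by simp
  have "\<exists>S\<in>step_lists.
    (\<forall>t. t \<notin> {- real (Suc n)<..real (Suc n)} \<longrightarrow> step_function S t = 0) \<and>
    (\<forall>t\<in>{- real (Suc n)<..real (Suc n)}. cmod (?id t - step_function S t) \<le> inverse (real (Suc n))) \<and>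
    norm (T \<bullet>\<^sub>o (?E (real (Suc n)) x - ?E (- real (Suc n)) x) - step_integral ?E S x) \<le> inverse (real (Suc n)) * norm x"
    for n x
  proof -
    let ?N = "real (Suc n)" and ?h = "inverse (real (Suc n))"
    have end_eq: "- ?N + real (2 * Suc n * Suc n) * ?h = ?N" by (simp add: field_simps)
    have h0: "0 \<le> ?h" by simp
    have proj: "norm (?E ?N x - ?E (- ?N) x) \<le> norm x"
    proof -
      have "?E ?N x - ?E (- ?N) x = ?E ?N (x - ?E (- ?N) x)"
        by (simp add: spec_proj_linear spec_proj_min min_absorb2)
      thus ?thesis
        using orthogonal_projection_norm_le[OF spec_proj, of ?N "x - ?E (- ?N) x"]
          orthogonal_projection_norm_le[OF orthogonal_projection_complement[OF spec_proj[of "- ?N"]], of x]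
        by simp
    qed
    obtain S where S: "S \<in> step_lists" "\<forall>t. t \<notin> {- ?N<..?N} \<longrightarrow> step_function S t = 0"
      "\<forall>t\<in>{- ?N<..?N}. cmod (?id t - step_function S t) \<le> ?h"
      "(norm (T \<bullet>\<^sub>o (?E ?N x - ?E (- ?N) x) - step_integral ?E S x))\<^sup>2 \<le> ?h\<^sup>2 * (norm (?E ?N x - ?E (- ?N) x))\<^sup>2"
      using riemann_sum[OF h0 end_eq[symmetric] refl, of x] by (elim bexE conjE) (rule that)
    have "norm (T \<bullet>\<^sub>o (?E ?N x - ?E (- ?N) x) - step_integral ?E S x) \<le> ?h * norm (?E ?N x - ?E (- ?N) x)"
      by (rule power2_le_imp_le) (use S(4) in \<open>simp_all add: power_mult_distrib\<close>)
    also have "\<dots> \<le> ?h * norm x" by (intro mult_left_mono proj) simp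
    finally show ?thesis using S(1-3) by blast
  qed
  then obtain S where S: "\<And>n x. S n x \<in> step_lists"
    "\<And>n x t. t \<notin> {- real (Suc n)<..real (Suc n)} \<Longrightarrow> step_function (S n x) t = 0"
    "\<And>n x t. t \<in> {- real (Suc n)<..real (Suc n)} \<Longrightarrow> cmod (?id t - step_function (S n x) t) \<le> inverse (real (Suc n))"
    "\<And>n x. norm (T \<bullet>\<^sub>o (?E (real (Suc n)) x - ?E (- real (Suc n)) x) - step_integral ?E (S n x) x) \<le> inverse (real (Suc n)) * norm x"
    by metis
  define P where "P n x = ?E (real (Suc n)) x - ?E (- real (Suc n)) x" for n x
  have Pdom: "P n x \<in> dom T" for n x
    unfolding P_def by (rule spec_proj_local_bound(1)[of "- real (Suc n)" "real (Suc n)"])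
      (simp_all add: spec_proj_linear spec_proj_min min_absorb1 min_absorb2)
  have Plim: "(\<lambda>n. P n x) \<longlonglongrightarrow> x" for x
  proof -
    have top: "filterlim (\<lambda>n. real (Suc n)) at_top sequentially"
      by (rule filterlim_compose[OF filterlim_real_sequentially filterlim_Suc])
    hence bot: "filterlim (\<lambda>n. - real (Suc n)) at_bot sequentially"
      by (simp only: filterlim_uminus_at_bot minus_minus)
    show ?thesis
      unfolding P_def
      using tendsto_diff[OF filterlim_compose[OF spec_proj_at_top top, of x]
          filterlim_compose[OF spec_proj_at_bot bot, of x]] by simp
  qed
  have err: "(\<lambda>n. T \<bullet>\<^sub>o (P n x) - step_integral ?E (S n x) x) \<longlonglongrightarrow> 0" for x
  proof (rule tendsto_norm_zero_cancel, rule tendsto_sandwich[OF _ _ tendsto_const])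
    show "(\<lambda>n. inverse (real (Suc n)) * norm x) \<longlonglongrightarrow> 0"
      using tendsto_mult[OF LIMSEQ_inverse_real_of_nat tendsto_const[of "norm x"]] by simp
  qed (use S(4) in \<open>auto simp: P_def\<close>)
  have sub1: "x \<in> dom T \<and> T \<bullet>\<^sub>o x = ?J \<bullet>\<^sub>o x" if x: "square_integrable_at ?E ?id x" for x
  proof -
    let ?\<mu> = "spectral_measure_at ?E x"
    have fin: "finite_measure ?\<mu>" and sets: "sets ?\<mu> = sets borel"
      by (rule finite_spectral_measure[OF SF], rule sets_spectral_measure[OF SF])
    have lim: "(\<lambda>n. sqdist ?\<mu> ?id (step_function (S n x))) \<longlonglongrightarrow> 0"
    proof (rule sqdist_dominated[of "{?\<mu>}"])
      note sets[measurable_cong]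
      show "(\<integral>\<^sup>+t. (ennreal ((cmod (?id t))\<^sup>2) + 1) \<partial>?\<mu>) < \<infinity>"
        using x finite_measure.emeasure_finite[OF fin, of UNIV]
        by (subst nn_integral_add) (auto simp: square_integrable_at_def[OF SF] sqdist_def spectral_measure_at_def less_top)
      fix n t
      have "(cmod (?id t - step_function (S n x) t))\<^sup>2 \<le> (cmod (?id t))\<^sup>2 + 1"
      proof (cases "t \<in> {- real (Suc n)<..real (Suc n)}")
        case True
        have "cmod (?id t - step_function (S n x) t) \<le> 1"
          using S(3)[OF True, of x] inverse_le_1_iff[of "real (Suc n)"] by linarith
        hence "(cmod (?id t - step_function (S n x) t))\<^sup>2 \<le> 1" by (simp add: power_le_one)
        thus ?thesis by (simp add: add_increasing)
      qed (simp add: S(2))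
      from ennreal_leI[OF this] show "ennreal ((cmod (?id t - step_function (S n x) t))\<^sup>2) \<le> ennreal ((cmod (?id t))\<^sup>2) + 1"
        by (simp add: ennreal_plus)
    next
      fix t
      have "(\<lambda>n. ?id t - step_function (S n x) t) \<longlonglongrightarrow> 0"
      proof (rule tendsto_norm_zero_cancel, rule tendsto_sandwich[OF _ _ tendsto_const LIMSEQ_inverse_real_of_nat])
        obtain N where N: "\<bar>t\<bar> < real N" using reals_Archimedean2 by blast
        show "\<forall>\<^sub>F n in sequentially. cmod (?id t - step_function (S n x) t) \<le> inverse (real (Suc n))"
          using eventually_ge_at_top[of N] by eventually_elim (rule S(3), use N in auto)
      qed simp
      from tendsto_diff[OF tendsto_const[of "?id t"] this]
      show "(\<lambda>n. step_function (S n x) t) \<longlonglongrightarrow> ?id t" by simp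
    qed (use fin sets in auto)
    have "(\<lambda>n. step_integral ?E (S n x) x) \<longlonglongrightarrow> ?J \<bullet>\<^sub>o x"
      by (rule spectral_integral_limit[OF SF id x S(1) lim])
    from tendsto_add[OF err[of x] this] have "(\<lambda>n. T \<bullet>\<^sub>o (P n x)) \<longlonglongrightarrow> ?J \<bullet>\<^sub>o x" by simp
    from closed_operator[OF Pdom Plim this] show ?thesis by simp
  qed
  have sub2: "square_integrable_at ?E ?id x" if x: "x \<in> dom T" for x
  proof (rule square_integrable_of_truncations[OF SF id])
    let ?\<mu> = "spectral_measure_at ?E x" and ?K = "norm (T \<bullet>\<^sub>o x) + norm (T \<bullet>\<^sub>o x) + norm x"
    fix n :: nat
    let ?s = "step_function (S n x)" and ?I = "{- real (Suc n)<..real (Suc n)}"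
    let ?g = "\<lambda>t. indicator ?I t * ?id t"
    have TP: "T \<bullet>\<^sub>o (P n x) = ?E (real (Suc n)) (T \<bullet>\<^sub>o x) - ?E (- real (Suc n)) (T \<bullet>\<^sub>o x)"
      by (simp only: P_def app_diff[OF spec_proj_reduces(1)[OF x] spec_proj_reduces(1)[OF x]]
          spec_proj_reduces(2)[OF x])
    have "norm (T \<bullet>\<^sub>o (P n x)) \<le> norm (T \<bullet>\<^sub>o x) + norm (T \<bullet>\<^sub>o x)"
      unfolding TP by (rule order_trans[OF norm_triangle_ineq4 add_mono]; rule orthogonal_projection_norm_le[OF spec_proj])
    moreover have "norm (T \<bullet>\<^sub>o (P n x) - step_integral ?E (S n x) x) \<le> norm x"
      using S(4)[of n x] mult_right_mono[OF inverse_le_1_iff[THEN iffD2], of "real (Suc n)" "norm x"]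
      by (simp add: P_def)
    ultimately have "norm (step_integral ?E (S n x) x) \<le> ?K"
      using norm_triangle_sub[of "step_integral ?E (S n x) x" "T \<bullet>\<^sub>o (P n x)"] by (simp add: norm_minus_commute)
    hence "ennreal ((norm (step_integral ?E (S n x) x))\<^sup>2) \<le> ennreal (?K\<^sup>2)" by (intro ennreal_leI power_mono) auto
    hence K: "sqdist ?\<mu> ?s (\<lambda>_. 0) \<le> ennreal (?K\<^sup>2)" by (simp only: norm_step_integral[OF SF S(1)])
    have "sqdist ?\<mu> (truncate ?id n) (\<lambda>_. 0) \<le> 2 * sqdist ?\<mu> ?g ?s + 2 * sqdist ?\<mu> ?s (\<lambda>_. 0)"
    proof -
      have "sqdist ?\<mu> (truncate ?id n) (\<lambda>_. 0) \<le> sqdist ?\<mu> ?g (\<lambda>_. 0)"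
        unfolding sqdist_def by (intro nn_integral_mono ennreal_leI) (auto simp: truncate_def indicator_def)
      also have "\<dots> \<le> 2 * sqdist ?\<mu> ?g ?s + 2 * sqdist ?\<mu> ?s (\<lambda>_. 0)"
        by (rule sqdist_triangle) (auto simp: sets_spectral_measure[OF SF])
      finally show ?thesis .
    qed
    also have "\<dots> \<le> 2 * ennreal ((norm x)\<^sup>2) + 2 * ennreal (?K\<^sup>2)"
    proof (intro add_mono mult_left_mono K)
      have "sqdist ?\<mu> ?g ?s \<le> (\<integral>\<^sup>+t. 1 \<partial>?\<mu>)"
        unfolding sqdist_def
      proof (rule nn_integral_mono)
        fix t
        have "cmod (?g t - ?s t) \<le> 1"
        proof (cases "t \<in> {- real (Suc n)<..real (Suc n)}")
          case True
          thus ?thesis using S(3)[OF True, of x] inverse_le_1_iff[of "real (Suc n)"] by simp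
        next
          case False
          thus ?thesis using S(2)[OF False, of x] by simp
        qed
        hence "(cmod (?g t - ?s t))\<^sup>2 \<le> 1" by (simp add: power_le_one)
        from ennreal_leI[OF this]
        show "ennreal ((cmod (?g t - ?s t))\<^sup>2) \<le> 1" by simp
      qed
      also have "\<dots> = ennreal ((norm x)\<^sup>2)"
        using emeasure_spectral_measure_UNIV[OF SF, of x] by (simp add: spectral_measure_at_def)
      finally show "sqdist ?\<mu> ?g ?s \<le> ennreal ((norm x)\<^sup>2)" .
    qed auto
    finally show "sqdist ?\<mu> (truncate ?id n) (\<lambda>_. 0) \<le> 2 * ennreal ((norm x)\<^sup>2) + 2 * ennreal (?K\<^sup>2)" .
  qed (simp add: ennreal_mult_less_top)
  show ?thesis
  proof
    fix x
    show "?J x = T x"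
    proof (cases "x \<in> dom T")
      case True
      with sub2 have "square_integrable_at ?E ?id x" by blast
      moreover from this have "x \<in> dom ?J" by (simp only: dom_spectral_integral[OF SF])
      ultimately show ?thesis using sub1 True by (force simp: app_def)
    next
      case False
      with sub1 have "x \<notin> dom ?J" by (auto simp only: dom_spectral_integral[OF SF])
      with False show ?thesis by (simp add: domIff)
    qed
  qed
qed

end

text \<open>The choice operator may a priori pick a spectral family other than the constructed one, so the results on
  \<open>f(T)\<close> start from these two properties.\<close>

lemma spectral_family_of_self_adjoint:
  assumes "self_adjoint T"
  shows "spectral_family (spectral_family_of T)" "spectral_integral (spectral_family_of T) complex_of_real = T"
proof -
  interpret self_adjoint_operator T by unfold_locales (rule assms)
  have "spectral_family (spectral_family_of T) \<and> spectral_integral (spectral_family_of T) complex_of_real = T"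
    unfolding spectral_family_of_def
    by (rule someI[of _ spec_proj])
      (use spectral_family_spec_proj spectral_integral_spec_proj in simp)
  thus "spectral_family (spectral_family_of T)" "spectral_integral (spectral_family_of T) complex_of_real = T"
    by auto
qed

section \<open>Support on the spectrum\<close>

context
  fixes E :: "real \<Rightarrow> 'a::chilbert_space \<Rightarrow> 'a"
  assumes E: "spectral_family E"
begin

lemma spectral_integral_const: "spectral_integral E (\<lambda>_. c) \<bullet>\<^sub>o x = c *\<^sub>C x"
proof -
  let ?\<mu> = "spectral_measure_at E x"
  let ?S = "\<lambda>n. [(c, - real n, real n)]"
  have "(\<lambda>n. sqdist ?\<mu> (\<lambda>_. c) (step_function (?S n))) \<longlonglongrightarrow> 0"
  proof (rule sqdist_bounded_limit[of "{?\<mu>}", where M="cmod c"])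
    fix t :: real
    obtain N where N: "\<bar>t\<bar> < real N" using reals_Archimedean2 by blast
    have "\<forall>\<^sub>F n in sequentially. step_function (?S n) t = c"
      using eventually_ge_at_top[of N] by eventually_elim (use N in \<open>auto simp: indicator_def\<close>)
    thus "(\<lambda>n. step_function (?S n) t) \<longlonglongrightarrow> c" by (simp add: tendsto_eventually)
  qed (auto simp: indicator_def finite_spectral_measure[OF E] sets_spectral_measure[OF E])
  hence "(\<lambda>n. step_integral E (?S n) x) \<longlonglongrightarrow> spectral_integral E (\<lambda>_. c) \<bullet>\<^sub>o x"
    by (intro spectral_integral_limit[OF E] square_integrable_bounded[OF E, of _ "cmod c"]) (auto simp: step_lists_Cons)
  moreover have "(\<lambda>n. step_integral E (?S n) x) \<longlonglongrightarrow> c *\<^sub>C (x - 0)"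
  proof -
    have top: "(\<lambda>n. E (real n) x) \<longlonglongrightarrow> x"
      using E filterlim_compose[OF _ filterlim_real_sequentially, of "\<lambda>t. E t x"] by (simp add: spectral_family_def)
    have "filterlim (\<lambda>n. - real n) at_bot sequentially"
      by (simp only: filterlim_uminus_at_bot minus_minus filterlim_real_sequentially)
    hence bot: "(\<lambda>n. E (- real n) x) \<longlonglongrightarrow> 0"
      using E filterlim_compose[of "\<lambda>t. E t x" "nhds 0" at_bot] by (simp add: spectral_family_def)
    show ?thesis using tendsto_scaleC[OF tendsto_diff[OF top bot], of c] by simp
  qed
  ultimately show ?thesis using LIMSEQ_unique by fastforce
qed

text \<open>A vector between \<open>l - e\<close> and \<open>l + e\<close> is an approximate eigenvector, which contradicts the
  boundedness of the inverse of \<open>T - l\<close> when \<open>e\<close> is small.\<close>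

lemma spectral_gap:
  assumes T: "spectral_integral E complex_of_real = T" and l: "complex_of_real l \<in> resolvent_set T"
  obtains a b where "a < l" "l < b" "\<And>x. E a x = E b x"
proof -
  obtain C0 where C0: "\<And>x. x \<in> dom T \<Longrightarrow> norm x \<le> C0 * norm (T \<bullet>\<^sub>o x - complex_of_real l *\<^sub>C x)"
    using l by (auto simp: resolvent_set_def)
  define C where "C = max C0 1"
  have C: "C > 0" "norm x \<le> C * norm (T \<bullet>\<^sub>o x - complex_of_real l *\<^sub>C x)" if "x \<in> dom T" for x
    using C0[OF that] mult_right_mono[of C0 C "norm (T \<bullet>\<^sub>o x - complex_of_real l *\<^sub>C x)"] by (auto simp: C_def)
  have C_pos: "C > 0" by (simp add: C_def)
  define e where "e = 1 / (2 * C)"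
  have e: "e > 0" using C_pos by (simp add: e_def)
  let ?a = "l - e" and ?b = "l + e"
  note P = spectral_family_projection[OF E]
  have "E ?b v - E ?a v = 0" for v
  proof -
    define x where "x = E ?b v - E ?a v"
    let ?\<mu> = "spectral_measure_at E x"
    have sets: "sets ?\<mu> = sets borel" and fin: "finite_measure ?\<mu>"
      by (rule sets_spectral_measure[OF E], rule finite_spectral_measure[OF E])
    interpret finite_measure ?\<mu> by (rule fin)
    have "E ?b x = x" "E ?a x = 0"
      using e by (simp_all add: x_def orthogonal_projection_diff[OF P] spectral_family_min[OF E])
    hence "measure ?\<mu> {?a<..?b} = (norm x)\<^sup>2" using e by (simp add: measure_spectral_measure_Ioc[OF E])
    moreover have "measure ?\<mu> (space ?\<mu>) = (norm x)\<^sup>2"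
      using emeasure_spectral_measure_UNIV[OF E, of x] by (simp add: space_spectral_measure[OF E] measure_def)
    ultimately have "measure ?\<mu> (space ?\<mu> - {?a<..?b}) = 0"
      by (subst finite_measure_compl) (simp_all add: sets)
    hence "space ?\<mu> - {?a<..?b} \<in> null_sets ?\<mu>"
      by (intro null_setsI) (simp_all add: sets emeasure_eq_measure space_spectral_measure[OF E])
    from AE_not_in[OF this] have AE: "AE t in ?\<mu>. t \<in> {?a<..?b}"
      by (simp add: space_spectral_measure[OF E])
    have "sqdist ?\<mu> complex_of_real (\<lambda>_. complex_of_real l) \<le> (\<integral>\<^sup>+t. ennreal (e\<^sup>2) \<partial>?\<mu>)"
      unfolding sqdist_def
    proof (rule nn_integral_mono_AE, use AE in eventually_elim)
      case (elim t)
      have "cmod (complex_of_real t - complex_of_real l) = \<bar>t - l\<bar>" by (metis norm_of_real of_real_diff)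
      also have "\<dots> \<le> e" using elim by auto
      finally show ?case by (intro ennreal_leI power_mono) auto
    qed
    also have "\<dots> = ennreal (e\<^sup>2 * (norm x)\<^sup>2)"
      by (simp add: emeasure_spectral_measure_UNIV[OF E] space_spectral_measure[OF E] ennreal_mult')
    finally have near: "sqdist ?\<mu> complex_of_real (\<lambda>_. complex_of_real l) \<le> ennreal (e\<^sup>2 * (norm x)\<^sup>2)" .
    have cst: "square_integrable_at E (\<lambda>_. complex_of_real l) x"
      by (rule square_integrable_bounded[OF E, of _ "\<bar>l\<bar>"]) simp
    have id: "square_integrable_at E complex_of_real x"
    proof -
      have "sqdist ?\<mu> complex_of_real (\<lambda>_. 0)
          \<le> 2 * sqdist ?\<mu> complex_of_real (\<lambda>_. complex_of_real l) + 2 * sqdist ?\<mu> (\<lambda>_. complex_of_real l) (\<lambda>_. 0)"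
        by (rule sqdist_triangle[OF sets]) auto
      also have "\<dots> < \<infinity>"
        using cst le_less_trans[OF near ennreal_less_top] by (simp add: square_integrable_at_def[OF E] ennreal_mult_less_top)
      finally show ?thesis by (simp add: square_integrable_at_def[OF E])
    qed
    have dom: "x \<in> dom T" using id dom_spectral_integral[OF E] T by blast
    have "ennreal ((norm (T \<bullet>\<^sub>o x - complex_of_real l *\<^sub>C x))\<^sup>2) \<le> 2 * sqdist ?\<mu> complex_of_real (\<lambda>_. complex_of_real l)"
      using spectral_integral_diff_norm[OF E _ _ id cst] by (simp add: T spectral_integral_const)
    also have "\<dots> \<le> 2 * ennreal (e\<^sup>2 * (norm x)\<^sup>2)" by (intro mult_left_mono near) simp
    also have "\<dots> = ennreal (2 * (e\<^sup>2 * (norm x)\<^sup>2))" by (simp add: ennreal_mult')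
    finally have le: "(norm (T \<bullet>\<^sub>o x - complex_of_real l *\<^sub>C x))\<^sup>2 \<le> 2 * (e\<^sup>2 * (norm x)\<^sup>2)"
      by (simp add: ennreal_le_iff)
    have "(norm x)\<^sup>2 \<le> (C * norm (T \<bullet>\<^sub>o x - complex_of_real l *\<^sub>C x))\<^sup>2"
      by (intro power_mono C(2)[OF dom]) simp
    also have "\<dots> = C\<^sup>2 * (norm (T \<bullet>\<^sub>o x - complex_of_real l *\<^sub>C x))\<^sup>2" by (rule power_mult_distrib)
    also have "\<dots> \<le> C\<^sup>2 * (2 * (e\<^sup>2 * (norm x)\<^sup>2))" by (intro mult_left_mono le) simp
    also have "\<dots> = (norm x)\<^sup>2 / 2" using C_pos by (simp add: e_def power2_eq_square)
    finally have "(norm x)\<^sup>2 \<le> 0" by simp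
    thus ?thesis by (simp add: x_def)
  qed
  hence "E ?a x = E ?b x" for x by simp
  thus thesis using that[of ?a ?b] e by simp
qed

text \<open>Each real point of the resolvent set lies in an interval with rational end points on which the spectral
  family is constant. Countably many such intervals, all null for the spectral measures, cover the set
  where \<open>f\<close> does not vanish.\<close>

lemma spectral_integral_vanishing:
  assumes T: "spectral_integral E complex_of_real = T" and f: "f \<in> borel_measurable borel"
    and zero: "\<And>t. complex_of_real t \<in> spectrum T \<Longrightarrow> f t = 0"
  shows "spectral_integral E f = zero_operator"
proof
  fix x
  let ?\<mu> = "spectral_measure_at E x"
  have sets: "sets ?\<mu> = sets borel" by (rule sets_spectral_measure[OF E])
  interpret finite_measure ?\<mu> by (rule finite_spectral_measure[OF E])
  define G where "G = {p. fst p \<in> \<rat> \<and> snd p \<in> \<rat> \<and> fst p < snd p \<and> (\<forall>x. E (fst p) x = E (snd p) x)}"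
  have "G \<subseteq> \<rat> \<times> \<rat>" by (auto simp: G_def)
  hence countable: "countable G" by (rule countable_subset) (intro countable_SIGMA countable_rat)
  have null: "(\<Union>p\<in>G. {fst p<..snd p}) \<in> null_sets ?\<mu>"
  proof (rule null_sets_UN'[OF countable])
    fix p assume "p \<in> G"
    hence "measure ?\<mu> {fst p<..snd p} = 0"
      by (auto simp: G_def measure_spectral_measure_Ioc[OF E])
    thus "{fst p<..snd p} \<in> null_sets ?\<mu>" by (intro null_setsI) (simp_all add: sets emeasure_eq_measure)
  qed
  have cover: "t \<in> (\<Union>p\<in>G. {fst p<..snd p})" if t: "f t \<noteq> 0" for t
  proof -
    have "complex_of_real t \<in> resolvent_set T" using zero[of t] t by (auto simp: spectrum_def)
    then obtain a b where ab: "a < t" "t < b" "\<And>x. E a x = E b x" using spectral_gap[OF T] by blast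
    obtain p where p: "p \<in> \<rat>" "a < p" "p < t" using Rats_dense_in_real[OF ab(1)] by blast
    obtain q where q: "q \<in> \<rat>" "t < q" "q < b" using Rats_dense_in_real[OF ab(2)] by blast
    \<comment> \<open>between \<open>a\<close> and \<open>b\<close> the spectral family is constant\<close>
    have const: "E s x = E a x" if "a \<le> s" "s \<le> b" for s x
    proof -
      have "E s x = E s (E b x)" using that by (simp add: spectral_family_min[OF E] min_absorb1)
      also have "\<dots> = E s (E a x)" by (simp add: ab(3))
      also have "\<dots> = E a x" using that by (simp add: spectral_family_min[OF E] min_absorb2)
      finally show ?thesis .
    qed
    have "E p x = E q x" for x using const[of p x] const[of q x] p q ab by simp
    hence "(p, q) \<in> G" using p q by (simp add: G_def)
    moreover have "t \<in> {fst (p, q)<..snd (p, q)}" using p q by simp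
    ultimately show ?thesis by blast
  qed
  have "AE t in ?\<mu>. ennreal ((cmod (f t - 0))\<^sup>2) = 0"
    using AE_not_in[OF null] by eventually_elim (use cover in auto)
  hence "sqdist ?\<mu> f (\<lambda>_. 0) = 0" unfolding sqdist_def by (subst nn_integral_cong_AE) auto
  moreover from this have L2: "square_integrable_at E f x" by (simp add: square_integrable_at_def[OF E])
  ultimately have "spectral_integral E f \<bullet>\<^sub>o x = 0" using spectral_integral_norm(1)[OF E f L2] by simp
  moreover have "x \<in> dom (spectral_integral E f)" using L2 by (simp only: dom_spectral_integral[OF E])
  ultimately show "spectral_integral E f x = zero_operator x" by (auto simp: zero_operator_def app_def)
qed

end

section \<open>Operator-valued distributions\<close>

lemma nth_derivative_Suc: "nth_derivative (Suc n) f = (\<lambda>t. vector_derivative (nth_derivative n f) (at t))"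
  by (simp add: nth_derivative_def)

lemma nth_derivative_0 [simp]: "nth_derivative 0 f = f"
  by (simp add: nth_derivative_def)

lemma nth_derivative_linear:
  assumes f: "smooth_function f" and g: "smooth_function g"
  shows "nth_derivative n (\<lambda>t. a * f t + b * g t) = (\<lambda>t. a * nth_derivative n f t + b * nth_derivative n g t)"
proof (induction n)
  case (Suc n)
  have "vector_derivative (\<lambda>t. a * nth_derivative n f t + b * nth_derivative n g t) (at t)
      = a * vector_derivative (nth_derivative n f) (at t) + b * vector_derivative (nth_derivative n g) (at t)" for t
  proof (rule vector_derivative_at, intro has_vector_derivative_add has_vector_derivative_mult_right)
    show "(nth_derivative n f has_vector_derivative vector_derivative (nth_derivative n f) (at t)) (at t)"
      using f by (simp add: smooth_function_def vector_derivative_works[symmetric])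
    show "(nth_derivative n g has_vector_derivative vector_derivative (nth_derivative n g) (at t)) (at t)"
      using g by (simp add: smooth_function_def vector_derivative_works[symmetric])
  qed
  thus ?case by (simp add: nth_derivative_Suc Suc)
qed simp

lemma smooth_function_linear:
  assumes f: "smooth_function f" and g: "smooth_function g"
  shows "smooth_function (\<lambda>t. a * f t + b * g t)"
  unfolding smooth_function_def nth_derivative_linear[OF f g]
  using f g by (auto simp: smooth_function_def intro!: derivative_intros)

lemma test_functions_iff:
  "f \<in> test_functions \<longleftrightarrow> smooth_function f \<and> (\<exists>K. compact K \<and> (\<forall>t. t \<notin> K \<longrightarrow> f t = 0))"
  by (auto simp: test_functions_def test_functions_on_def)

lemma test_functions_linear:
  assumes f: "f \<in> test_functions" and g: "g \<in> test_functions"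
  shows "(\<lambda>t. a * f t + b * g t) \<in> test_functions"
proof -
  obtain K K' where "compact K" "\<And>t. t \<notin> K \<Longrightarrow> f t = 0" "compact K'" "\<And>t. t \<notin> K' \<Longrightarrow> g t = 0"
    using f g by (auto simp: test_functions_iff)
  hence "compact (K \<union> K')" "\<forall>t. t \<notin> K \<union> K' \<longrightarrow> a * f t + b * g t = 0" by (auto intro: compact_Un)
  thus ?thesis using f g smooth_function_linear unfolding test_functions_iff by blast
qed

lemma test_function_continuous: "f \<in> test_functions \<Longrightarrow> continuous_on UNIV f"
proof -
  assume "f \<in> test_functions"
  hence "\<forall>t. nth_derivative 0 f differentiable at t" unfolding test_functions_iff smooth_function_def by blast
  thus ?thesis by (auto intro!: continuous_at_imp_continuous_on differentiable_imp_continuous_within)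
qed

lemma test_function_measurable: "f \<in> test_functions \<Longrightarrow> f \<in> borel_measurable borel"
  by (intro borel_measurable_continuous_onI test_function_continuous)

lemma test_function_bounded:
  assumes f: "f \<in> test_functions" obtains M where "0 \<le> M" "\<And>t. cmod (f t) \<le> M"
proof -
  obtain K where K: "compact K" "\<And>t. t \<notin> K \<Longrightarrow> f t = 0" using f by (auto simp: test_functions_iff)
  have "compact (f ` K)"
    by (rule compact_continuous_image[OF continuous_on_subset[OF test_function_continuous[OF f]] K(1)]) simp
  hence "bounded (f ` K)" by (rule compact_imp_bounded)
  then obtain B where B: "\<And>t. t \<in> K \<Longrightarrow> cmod (f t) \<le> B" by (auto simp: bounded_iff)
  have "cmod (f t) \<le> max B 0" for t using B[of t] K(2)[of t] by (cases "t \<in> K") auto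
  thus thesis using that[of "max B 0"] by simp
qed

lemma topspace_test_topology: "topspace test_topology \<subseteq> test_functions"
proof -
  have "(\<lambda>t. f t + g t) \<in> test_functions" if "f \<in> test_functions" "g \<in> test_functions" for f g
    using test_functions_linear[OF that, of 1 1] by simp
  thus ?thesis unfolding test_topology_def topology_generated_by_topspace by (auto simp: basic_zero_nbhds_def)
qed

text \<open>The uniform bound strictly below \<open>e\<close> leaves room for a small ball of the supremum norm around each
  member; this makes the set open.\<close>

definition sup_ball :: "real \<Rightarrow> (real \<Rightarrow> complex) set"
  where "sup_ball e = {f \<in> test_functions. \<exists>c<e. \<forall>t. cmod (f t) \<le> c}"

lemma openin_sup_ball:
  assumes K: "compact K" shows "openin (test_topology_on K) (sup_ball e \<inter> test_functions_on K)"
proof (subst openin_subopen, intro ballI)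
  fix f assume f: "f \<in> sup_ball e \<inter> test_functions_on K"
  then obtain c where c: "c < e" "\<And>t. cmod (f t) \<le> c" by (auto simp: sup_ball_def)
  let ?r = "(e - c) / 2"
  let ?B = "{g \<in> test_functions_on K. \<forall>n\<le>0. \<forall>t. cmod (nth_derivative n (\<lambda>s. g s - f s) t) < ?r}"
  have r: "?r > 0" using c by simp
  have "openin (test_topology_on K) ?B"
    unfolding test_topology_on_def by (rule topology_generated_by_Basis) (use f r in blast)
  moreover have "f \<in> ?B" using f r by simp
  moreover have "?B \<subseteq> sup_ball e \<inter> test_functions_on K"
  proof
    fix g assume g: "g \<in> ?B"
    have "cmod (g t) \<le> (c + e) / 2" for t
    proof -
      have "cmod (g t - f t) < ?r" using g by simp
      thus ?thesis using norm_triangle_ineq[of "g t - f t" "f t"] c(2)[of t] by (simp add: field_simps)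
    qed
    moreover have "(c + e) / 2 < e" using c by simp
    moreover have "g \<in> test_functions" using g K by (auto simp: test_functions_def)
    ultimately show "g \<in> sup_ball e \<inter> test_functions_on K" using g unfolding sup_ball_def by blast
  qed
  ultimately show "\<exists>B. openin (test_topology_on K) B \<and> f \<in> B \<and> B \<subseteq> sup_ball e \<inter> test_functions_on K" by blast
qed

lemma sup_ball_basic_zero_nbhd:
  assumes e: "e > 0" shows "sup_ball e \<in> basic_zero_nbhds"
proof -
  have zero: "(\<lambda>t. 0) \<in> sup_ball e"
  proof -
    have "nth_derivative n (\<lambda>t. 0 :: complex) = (\<lambda>t. 0)" for n
      by (induction n) (simp_all add: nth_derivative_Suc)
    hence "(\<lambda>t. 0) \<in> test_functions"
      by (auto simp: test_functions_iff smooth_function_def intro!: exI[of _ "{}"])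
    thus ?thesis using e by (auto simp: sup_ball_def intro!: exI[of _ 0])
  qed
  have convex: "(\<lambda>t. complex_of_real u * f t + complex_of_real (1 - u) * g t) \<in> sup_ball e"
    if f: "f \<in> sup_ball e" and g: "g \<in> sup_ball e" and u: "0 \<le> u" "u \<le> 1" for f g u
  proof -
    obtain c d where c: "c < e" "\<And>t. cmod (f t) \<le> c" and d: "d < e" "\<And>t. cmod (g t) \<le> d"
      using f g by (auto simp: sup_ball_def)
    have "cmod (complex_of_real u * f t + complex_of_real (1 - u) * g t) \<le> max c d" for t
    proof -
      have "cmod (complex_of_real u * f t + complex_of_real (1 - u) * g t)
          \<le> cmod (complex_of_real u * f t) + cmod (complex_of_real (1 - u) * g t)" by (rule norm_triangle_ineq)
      also have "\<dots> = u * cmod (f t) + (1 - u) * cmod (g t)"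
        using u by (simp only: norm_mult norm_of_real abs_of_nonneg diff_ge_0_iff_ge)
      also have "\<dots> \<le> u * max c d + (1 - u) * max c d"
        using c(2)[of t] d(2)[of t] u by (intro add_mono mult_left_mono) auto
      finally show ?thesis by (simp add: algebra_simps)
    qed
    moreover have "max c d < e" using c d by simp
    moreover have "(\<lambda>t. complex_of_real u * f t + complex_of_real (1 - u) * g t) \<in> test_functions"
      using f g by (intro test_functions_linear) (auto simp: sup_ball_def)
    ultimately show ?thesis unfolding sup_ball_def by blast
  qed
  have balanced: "(\<lambda>t. a * f t) \<in> sup_ball e" if f: "f \<in> sup_ball e" and a: "cmod a \<le> 1" for f a
  proof -
    obtain c where c: "c < e" "\<And>t. cmod (f t) \<le> c" using f by (auto simp: sup_ball_def)
    have "cmod (a * f t) \<le> c" for t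
      using mult_mono[OF a c(2)[of t]] by (simp add: norm_mult)
    moreover have "(\<lambda>t. a * f t) \<in> test_functions"
      using f test_functions_linear[of f f a 0] by (simp add: sup_ball_def)
    ultimately show ?thesis using c(1) unfolding sup_ball_def by blast
  qed
  show ?thesis
    unfolding basic_zero_nbhds_def mem_Collect_eq
  proof (intro conjI ballI allI impI)
    show "sup_ball e \<subseteq> test_functions" by (auto simp: sup_ball_def)
  qed (use zero convex balanced openin_sup_ball in auto)
qed

text \<open>An estimate by the supremum norm alone suffices: balls of that norm are neighbourhoods for the
  inductive limit topology, and strong continuity is tested on one vector at a time.\<close>

lemma operator_valued_distribution_of_sup_bound:
  fixes \<delta> :: "(real \<Rightarrow> complex) \<Rightarrow> 'a::chilbert_space operator"
  assumes bounded: "\<And>f. f \<in> test_functions \<Longrightarrow> \<delta> f \<in> bounded_operators"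
    and lin: "operator_linear_on test_functions \<delta>"
    and bound: "\<And>f M x. f \<in> test_functions \<Longrightarrow> (\<And>t. cmod (f t) \<le> M) \<Longrightarrow> norm (\<delta> f \<bullet>\<^sub>o x) \<le> C * M * norm x"
  shows "operator_valued_distribution \<delta>"
proof -
  have pointwise: "continuous_map test_topology euclidean (\<lambda>f. \<delta> f \<bullet>\<^sub>o x)" for x
    unfolding continuous_map_def
  proof (intro conjI allI impI)
    fix U :: "'a set" assume "openin euclidean U"
    hence U: "open U" by simp
    show "openin test_topology {f \<in> topspace test_topology. \<delta> f \<bullet>\<^sub>o x \<in> U}"
    proof (subst openin_subopen, intro ballI)
      fix f assume f: "f \<in> {f \<in> topspace test_topology. \<delta> f \<bullet>\<^sub>o x \<in> U}"
      hence ftest: "f \<in> test_functions" using topspace_test_topology by blast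
      obtain r where r: "r > 0" "ball (\<delta> f \<bullet>\<^sub>o x) r \<subseteq> U" using U f open_contains_ball by blast
      define e where "e = r / (\<bar>C\<bar> * norm x + 1)"
      have den: "\<bar>C\<bar> * norm x + 1 > 0" by (simp add: add_nonneg_pos)
      have e: "e > 0" using r den by (simp add: e_def)
      let ?V = "(\<lambda>g t. f t + g t) ` sup_ball e"
      have V: "openin test_topology ?V"
        unfolding test_topology_def
        by (rule topology_generated_by_Basis) (use ftest sup_ball_basic_zero_nbhd[OF e] in blast)
      have "(\<lambda>t. 0) \<in> sup_ball e" using sup_ball_basic_zero_nbhd[OF e] by (simp add: basic_zero_nbhds_def)
      hence fV: "f \<in> ?V" by (intro image_eqI[of _ _ "\<lambda>t. 0"]) auto
      have "\<delta> (\<lambda>t. f t + g t) \<bullet>\<^sub>o x \<in> U" if g: "g \<in> sup_ball e" for g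
      proof -
        obtain c where c: "c < e" "\<And>t. cmod (g t) \<le> c" and gtest: "g \<in> test_functions"
          using g by (auto simp: sup_ball_def)
        have c0: "0 \<le> c" using order_trans[OF norm_ge_zero c(2)] .
        have dom: "x \<in> dom (\<delta> f) \<inter> dom (\<delta> g)"
          using bounded[OF ftest] bounded[OF gtest] by (simp add: bounded_operators_def)
        have "\<delta> (\<lambda>t. 1 * f t + 1 * g t) \<bullet>\<^sub>o x = 1 *\<^sub>C (\<delta> f \<bullet>\<^sub>o x) + 1 *\<^sub>C (\<delta> g \<bullet>\<^sub>o x)"
          using lin ftest gtest dom unfolding operator_linear_on_def by blast
        hence "dist (\<delta> f \<bullet>\<^sub>o x) (\<delta> (\<lambda>t. f t + g t) \<bullet>\<^sub>o x) = norm (\<delta> g \<bullet>\<^sub>o x)" by (simp add: dist_norm)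
        also have "\<dots> \<le> C * c * norm x" by (rule bound[OF gtest c(2)])
        also have "\<dots> = c * (C * norm x)" by (simp add: mult_ac)
        also have "\<dots> \<le> c * (\<bar>C\<bar> * norm x + 1)"
          using c0 mult_right_mono[OF abs_ge_self[of C], of "norm x"] by (intro mult_left_mono) auto
        also have "\<dots> < e * (\<bar>C\<bar> * norm x + 1)" using c(1) den by simp
        also have "\<dots> = r" using den by (simp add: e_def)
        finally show ?thesis using r(2) by (auto simp: subset_eq)
      qed
      moreover have "?V \<subseteq> topspace test_topology" by (rule openin_subset[OF V])
      ultimately have "?V \<subseteq> {f \<in> topspace test_topology. \<delta> f \<bullet>\<^sub>o x \<in> U}" by blast
      with V fV show "\<exists>V. openin test_topology V \<and> f \<in> V \<and> V \<subseteq> {f \<in> topspace test_topology. \<delta> f \<bullet>\<^sub>o x \<in> U}"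
        by blast
    qed
  qed simp
  have "continuous_map test_topology euclidean (app \<circ> \<delta>)"
    unfolding euclidean_product_topology[symmetric] continuous_map_componentwise_UNIV
    using pointwise by simp
  hence "continuous_map test_topology SOT \<delta>"
    unfolding SOT_def using bounded topspace_test_topology by (intro continuous_map_pullback') auto
  thus ?thesis using bounded lin by (simp add: operator_valued_distribution_def)
qed

theorem theorem7:
  fixes T :: "'a::chilbert_space operator"
  assumes "self_adjoint T"
  shows "\<exists>\<delta> :: (real \<Rightarrow> complex) \<Rightarrow> 'a operator.
    (\<forall>f\<in>borel_p T. linear_operator (\<delta> f)) \<and>
    operator_linear_on (borel_p T) \<delta> \<and>
    (\<forall>f\<in>borel_p T. \<delta> f = functional_calculus T f) \<and>
    (\<forall>(fn :: nat \<Rightarrow> real \<Rightarrow> complex) f.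
      (\<forall>n. fn n \<in> borel_p T) \<and> f \<in> borel_p T \<and>
      (\<exists>M. \<forall>n t. cmod (fn n t) \<le> M) \<and> (\<forall>t. (\<lambda>n. fn n t) \<longlonglongrightarrow> f t) \<longrightarrow>
      (\<forall>x. (\<forall>n. x \<in> dom (\<delta> (fn n))) \<and> x \<in> dom (\<delta> f) \<and>
        (\<lambda>n. \<delta> (fn n) \<bullet>\<^sub>o x) \<longlonglongrightarrow> \<delta> f \<bullet>\<^sub>o x)) \<and>
    (bounded_operator T \<longrightarrow> operator_valued_distribution \<delta>) \<and>
    (\<forall>f\<in>borel_p T. (\<forall>t. complex_of_real t \<in> spectrum T \<longrightarrow> f t = 0) \<longrightarrow>
      \<delta> f = zero_operator) \<and>
    (\<forall>f\<in>borel_p T. \<forall>x \<in> dom T \<inter> dom (\<delta> f). \<forall>y \<in> dom T \<inter> dom (\<delta> f).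
      y \<in> dom (\<delta> (\<lambda>t. cnj (f t))) \<and>
      cinner y (\<delta> f \<bullet>\<^sub>o x) = cinner (\<delta> (\<lambda>t. cnj (f t)) \<bullet>\<^sub>o y) x)"
proof -
  define E where "E = spectral_family_of T"
  have E: "spectral_family E" and T: "spectral_integral E complex_of_real = T"
    unfolding E_def by (rule spectral_family_of_self_adjoint[OF assms])+
  let ?\<delta> = "spectral_integral E"
  note dom = dom_spectral_integral[OF E]
  have meas: "f \<in> borel_measurable borel" if "f \<in> borel_p T" for f using that by (simp add: borel_p_def)
  have linear_on: "operator_linear_on F ?\<delta>" if F: "\<And>f. f \<in> F \<Longrightarrow> f \<in> borel_measurable borel" for F
    unfolding operator_linear_on_def
  proof (intro allI ballI)
    fix a b f g x assume f: "f \<in> F" and g: "g \<in> F" and "x \<in> dom (?\<delta> f) \<inter> dom (?\<delta> g)"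
    hence x: "square_integrable_at E f x" "square_integrable_at E g x" by (simp_all only: Int_iff dom)
    show "x \<in> dom (?\<delta> (\<lambda>t. a * f t + b * g t)) \<and>
      ?\<delta> (\<lambda>t. a * f t + b * g t) \<bullet>\<^sub>o x = a *\<^sub>C (?\<delta> f \<bullet>\<^sub>o x) + b *\<^sub>C (?\<delta> g \<bullet>\<^sub>o x)"
      unfolding dom using square_integrable_linear[OF E F[OF f] F[OF g] x] spectral_integral_linear[OF E F[OF f] F[OF g] x]
      by (intro conjI)
  qed
  have distribution: "operator_valued_distribution ?\<delta>"
  proof (rule operator_valued_distribution_of_sup_bound[where C=2])
    fix f assume f: "f \<in> test_functions"
    have fm: "f \<in> borel_measurable borel" by (rule test_function_measurable[OF f])
    obtain M where M: "\<And>t. cmod (f t) \<le> M" using test_function_bounded[OF f] by blast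
    have "x \<in> dom (?\<delta> f)" for x unfolding dom by (rule square_integrable_bounded[OF E M])
    moreover have "\<forall>x. norm (?\<delta> f \<bullet>\<^sub>o x) \<le> (2 * M) * norm x" using spectral_integral_bound[OF E fm M] by blast
    ultimately show "?\<delta> f \<in> bounded_operators"
      using linear_operator_spectral_integral[OF E fm] by (auto simp: bounded_operators_def bounded_operator_def)
  next
    show "operator_linear_on test_functions ?\<delta>" by (rule linear_on) (rule test_function_measurable)
  next
    show "norm (?\<delta> f \<bullet>\<^sub>o x) \<le> 2 * M * norm x" if "f \<in> test_functions" "\<And>t. cmod (f t) \<le> M" for f M x
      by (rule spectral_integral_bound[OF E test_function_measurable[OF that(1)] that(2)])
  qed
  show ?thesis
  proof (intro exI[of _ ?\<delta>] conjI ballI allI impI)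
    show "linear_operator (?\<delta> f)" if "f \<in> borel_p T" for f
      by (rule linear_operator_spectral_integral[OF E meas[OF that]])
    show "operator_linear_on (borel_p T) ?\<delta>" by (rule linear_on[OF meas])
    show "?\<delta> f = functional_calculus T f" for f by (simp add: functional_calculus_def E_def)
    show "operator_valued_distribution ?\<delta>" by (rule distribution)
    show "?\<delta> f = zero_operator" if "f \<in> borel_p T" "\<forall>t. complex_of_real t \<in> spectrum T \<longrightarrow> f t = 0" for f
      using spectral_integral_vanishing[OF E T meas[OF that(1)]] that(2) by blast
  next
    fix fn f x
    assume A: "(\<forall>n. fn n \<in> borel_p T) \<and> f \<in> borel_p T \<and> (\<exists>M. \<forall>n t. cmod (fn n t) \<le> M) \<and>
      (\<forall>t. (\<lambda>n. fn n t) \<longlonglongrightarrow> f t)"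
    then obtain M where M: "\<And>n t. cmod (fn n t) \<le> M" by blast
    have f: "f \<in> borel_measurable borel" and fn: "\<And>n. fn n \<in> borel_measurable borel"
      and lim: "\<And>t. (\<lambda>n. fn n t) \<longlonglongrightarrow> f t" using A meas by blast+
    note conv = spectral_integral_bounded_convergence[OF E f fn M lim]
    show "x \<in> dom (?\<delta> (fn n))" for n unfolding dom by (rule conv(1))
    show "x \<in> dom (?\<delta> f)" unfolding dom by (rule conv(2))
    show "(\<lambda>n. ?\<delta> (fn n) \<bullet>\<^sub>o x) \<longlonglongrightarrow> ?\<delta> f \<bullet>\<^sub>o x" by (rule conv(3))
  next
    fix f x y
    assume f: "f \<in> borel_p T" and x: "x \<in> dom T \<inter> dom (?\<delta> f)" and y: "y \<in> dom T \<inter> dom (?\<delta> f)"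
    have x': "square_integrable_at E f x" and y': "square_integrable_at E f y"
      using x y by (simp_all only: dom Int_iff)
    show "y \<in> dom (?\<delta> (\<lambda>t. cnj (f t)))" unfolding dom by (rule square_integrable_cnj[OF E y'])
    show "cinner y (?\<delta> f \<bullet>\<^sub>o x) = cinner (?\<delta> (\<lambda>t. cnj (f t)) \<bullet>\<^sub>o y) x"
      by (rule spectral_integral_adjoint[OF E meas[OF f] x' y'])
  qed
qed

end
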